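(* Let $\lambda\in\mathbb{C}$ with $0<|\lambda|<1$, let $\tau>1$, and let $\omega\in\mathbb{R}$ satisfy $$\inf_{q\in\mathbb{Z},\,q\ge1} q^{\tau}\operatorname{dist}(q\omega,\mathbb{Z})>0 .$$ Let $\alpha_n=\lambda e^{2\pi i\omega n^2}$ for $n\ge0$, let $\beta\in\partial\mathbb{D}$, and for each $N\ge1$ let $e^{2\pi i\theta_1},\dots,e^{2\pi i\theta_N}$ (with $\theta_j=\theta_j^N\in[0,1)$) be the $N$ zeros, all lying on the unit circle, of the para-orthogonal polynomial $\Phi_N(z;\beta)$ associated with $(\alpha_n)$. Write $\mathfrak{L}_{\underline{\theta},N}$ for the Laplace functional of the $N$ points $\theta_1,\dots,\theta_N$, and $\mathfrak{L}^{R}_{2\omega,N}$ for the Laplace functional of the $N$ points $\{2n\omega \bmod 1\}_{n=1}^{N}$. Then for every nonnegative, continuous, compactly supported function $f:\mathbb{R}\to\mathbb{R}$, $$\lim_{N\to\infty}\bigl(\mathfrak{L}_{\underline{\theta},N}(f)-\mathfrak{L}^{R}_{2\omega,N}(f)\bigr)=0 .$$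
   Context: $\mathbb{D}=\{z\in\mathbb{C}:|z|<1\}$ and $\mathbb{T}=\mathbb{R}/\mathbb{Z}$. Given $\alpha_n\in\mathbb{D}$, $n\ge0$, define $\Phi_0(z)=1$, $\Phi_{n+1}(z)=z\Phi_n(z)-\overline{\alpha_n}\Phi_n^*(z)$, where $\Phi_n^*(z)=z^n\overline{\Phi_n(\overline{z}^{-1})}$. For $\beta\in\partial\mathbb{D}$ the para-orthogonal polynomial is $\Phi_n(z;\beta)=z\Phi_{n-1}(z)-\overline{\beta}\,\Phi_{n-1}^*(z)$; its $n$ zeros are simple and lie on $\partial\mathbb{D}$. The Laplace functional of $N$ points $x_1,\dots,x_N\in\mathbb{T}$ is, for $f:\mathbb{R}\to\mathbb{R}$ nonnegative, continuous and compactly supported, $$\mathfrak{L}_{\underline{x},N}(f)=\int_{\mathbb{T}}\exp\Bigl(-\sum_{n=1}^N f\bigl(N x_n(\theta)\bigr)\Bigr)\,d\theta,$$ where $x_n(\theta)\in[-\tfrac12,\tfrac12)$ is the representative of $x_n-\theta \pmod 1$. *)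

theory Defs
  imports "HOL-Analysis.Analysis" "HOL-Computational_Algebra.Polynomial"
begin

definition reversed_poly :: "nat \<Rightarrow> complex poly \<Rightarrow> complex poly" where
  "reversed_poly n p = (\<Sum>k\<le>n. monom (cnj (coeff p (n - k))) k)"

text \<open>For \<open>degree p \<le> n\<close>, \<open>reversed_poly n p\<close> is the polynomial \<open>p\<^sup>*(z) = z\<^sup>n cnj (p (1 / cnj z))\<close>;
  taking it as a polynomial fixes its value at \<open>z = 0\<close>.\<close>

lemma poly_reversed_poly:
  assumes "degree p \<le> n" and "z \<noteq> 0"
  shows "poly (reversed_poly n p) z = z ^ n * cnj (poly p (inverse (cnj z)))"
proof -
  have "poly p w = (\<Sum>k\<le>n. coeff p k * w ^ k)" for w
    unfolding poly_altdef using assms(1)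
    by (intro sum.mono_neutral_left) (auto simp: coeff_eq_0)
  hence "z ^ n * cnj (poly p (inverse (cnj z))) = (\<Sum>k\<le>n. cnj (coeff p k) * (z ^ n * inverse z ^ k))"
    by (simp add: sum_distrib_left mult_ac)
  also have "\<dots> = (\<Sum>k\<le>n. cnj (coeff p k) * z ^ (n - k))"
    using assms(2) by (intro sum.cong refl) (simp add: power_diff power_inverse divide_inverse)
  also have "\<dots> = (\<Sum>k\<le>n. cnj (coeff p (n - k)) * z ^ k)"
    by (rule sum.reindex_bij_witness[where i = "\<lambda>k. n - k" and j = "\<lambda>k. n - k"]) auto
  also have "\<dots> = poly (reversed_poly n p) z"
    by (simp add: reversed_poly_def poly_sum poly_monom)
  finally show ?thesis by simp
qed

primrec szego_poly :: "(nat \<Rightarrow> complex) \<Rightarrow> nat \<Rightarrow> complex poly" where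
  "szego_poly \<alpha> 0 = 1"
| "szego_poly \<alpha> (Suc n) =
     [:0, 1:] * szego_poly \<alpha> n - smult (cnj (\<alpha> n)) (reversed_poly n (szego_poly \<alpha> n))"

lemma degree_reversed_poly: "degree (reversed_poly n p) \<le> n"
  unfolding reversed_poly_def
  by (intro degree_sum_le) (auto intro: order.trans[OF degree_monom_le])

lemma degree_szego_poly: "degree (szego_poly \<alpha> n) \<le> n"
proof (induction n)
  case (Suc n)
  have "degree ([:0, 1:] * szego_poly \<alpha> n) \<le> Suc n"
    using Suc degree_mult_le[of "[:0, 1:]" "szego_poly \<alpha> n"] by simp
  moreover have "degree (smult (cnj (\<alpha> n)) (reversed_poly n (szego_poly \<alpha> n))) \<le> Suc n"
    using degree_smult_le degree_reversed_poly le_SucI order.trans by metis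
  ultimately show ?case by (auto intro: degree_diff_le)
qed simp

text \<open>Only meaningful for \<open>n \<ge> 1\<close>.\<close>

definition para_orthogonal_poly :: "(nat \<Rightarrow> complex) \<Rightarrow> complex \<Rightarrow> nat \<Rightarrow> complex poly" where
  "para_orthogonal_poly \<alpha> \<beta> n =
     [:0, 1:] * szego_poly \<alpha> (n - 1)
       - smult (cnj \<beta>) (reversed_poly (n - 1) (szego_poly \<alpha> (n - 1)))"

definition centered_rep :: "real \<Rightarrow> real" where
  "centered_rep t = t - of_int \<lfloor>t + 1 / 2\<rfloor>"

lemma centered_rep_unique:
  "centered_rep t = r \<longleftrightarrow> r \<in> {- 1 / 2..<1 / 2} \<and> t - r \<in> \<int>"
proof
  assume "centered_rep t = r"
  moreover have "centered_rep t \<in> {- 1 / 2..<1 / 2}"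
    unfolding centered_rep_def atLeastLessThan_iff by linarith
  ultimately show "r \<in> {- 1 / 2..<1 / 2} \<and> t - r \<in> \<int>"
    by (auto simp: centered_rep_def)
next
  assume r: "r \<in> {- 1 / 2..<1 / 2} \<and> t - r \<in> \<int>"
  then obtain k :: int where "t - r = of_int k" by (auto elim: Ints_cases)
  with r have "\<lfloor>t + 1 / 2\<rfloor> = k" by (intro floor_unique) auto
  with \<open>t - r = of_int k\<close> show "centered_rep t = r" by (simp add: centered_rep_def)
qed

text \<open>Points of \<open>\<real>/\<int>\<close> are given by real representatives \<open>x 1, \<dots>, x N\<close>.  The integrand depends on
  them, and on \<open>\<theta>\<close>, only modulo 1, so the integral over the circle is one over \<open>[0, 1)\<close>.\<close>

definition laplace_functional :: "(nat \<Rightarrow> real) \<Rightarrow> nat \<Rightarrow> (real \<Rightarrow> real) \<Rightarrow> real" where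
  "laplace_functional x N f =
     (LBINT \<theta>:{0..<1}. exp (- (\<Sum>n=1..N. f (real N * centered_rep (x n - \<theta>)))))"

end

theory Submission
  imports Defs "HOL-Complex_Analysis.Cauchy_Integral_Formula"
begin

text \<open>After rotating out the phases of \<open>\<alpha>\<^sub>n\<close>, the ratio \<open>z \<Phi>\<^sub>n / \<Phi>\<^sub>n\<^sup>*\<close> on the unit circle follows
  \<open>c \<mapsto> e(y + n \<Omega>) (c - r) / (1 - r c)\<close> with \<open>r = \<bar>\<lambda>\<bar>\<close> and \<open>\<Omega> = 2 \<omega>\<close>, and the zeros of \<open>\<Phi>\<^sub>N(z; \<beta>)\<close> are
  the parameters at which its phase takes a prescribed value modulo 1.  Shifting the time by \<open>k\<close>
  amounts to shifting the parameter by \<open>k \<Omega>\<close>.  Hence a single block of length \<open>L\<close> on which some phase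
  orbit first contracts and then expands by a huge factor (the phase picture of a localized
  eigenfunction) recurs at all parameters \<open>c - k \<Omega>\<close>, and near each of these every incoming phase
  makes a full turn, so \<open>\<Phi>\<^sub>N(z; \<beta>)\<close> has a zero there.  The Diophantine condition keeps these zeros
  apart.  Thus all but \<open>L = o(N)\<close> zeros are \<open>o(1/N)\<close>-close to a translate of the rotation orbit,
  which suffices because the Laplace functional is translation invariant.

  To find the block, note that the logarithm of the contraction rate is the boundary value of a
  harmonic function whose value at the centre of the disc gives a positive Lyapunov exponent,
  while subadditivity and unique ergodicity bound the expansion uniformly from above.  So orbits
  contract at nearly all parameters, and also at most of the \<open>L + 1\<close> solutions of the boundary value
  problem on a block, since these are spread evenly.  The same applies to the time-reversed
  orbits, so some solution is good at both ends.\<close>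

section \<open>Phases on the unit circle\<close>

text \<open>Contraction over a first stretch and expansion over a last one are estimates about two
  different orbits; they concern the same orbit only at the finitely many solutions of a two-point
  boundary value problem. Bounds in measure say nothing about a finite set, so solutions have to be
  counted. The boundary values are chosen for this: the orbit starts at the phase \<open>y\<close>
  of the spectral parameter, so that it extends to the disc and vanishes at the centre, and it ends
  at an integer, so that the reversed orbit starts at a fixed offset from \<open>y\<close> modulo 1.

  Windows of length \<open>w\<close> yield factors \<open>exp (w gam / 2)\<close>, while the block
  length is at most a power of \<open>w\<close>. With \<open>w\<close> a small power of
  \<open>N\<close>, the block is no longer than \<open>sqrt N\<close>, and the errors are smaller
  than every power of \<open>1 / N\<close>. This is needed because the targets
  \<open>n \<Omega>\<close> are separated only by some power of \<open>1 / N\<close>. Monotone real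
  lifts, in place of transfer matrices, reduce the existence of zeros to the intermediate value
  theorem.\<close>

abbreviation circ :: "real \<Rightarrow> complex" where
  "circ t \<equiv> cis (2 * pi * t)"

lemma circ_add_int [simp]: "circ (t + of_int k) = circ t"
proof -
  have "2 * pi * (t + of_int k) = 2 * pi * t + 2 * pi * of_int k" by (simp add: ring_distribs)
  hence "circ (t + of_int k) = circ t * cis (2 * pi * of_int k)"
    by (simp only: cis_mult)
  thus ?thesis by simp
qed

lemma circ_eq_iff: "circ s = circ t \<longleftrightarrow> s - t \<in> \<int>"
proof
  assume "circ s = circ t"
  hence "sin (2 * pi * s) = sin (2 * pi * t)" "cos (2 * pi * s) = cos (2 * pi * t)"
    by (auto simp: complex_eq_iff)
  then obtain n where "2 * pi * s = 2 * pi * t + 2 * pi * of_int n"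
    using sin_cos_eq_iff[of "2 * pi * s" "2 * pi * t"] by auto
  hence "2 * pi * (s - t - of_int n) = 0" by (simp add: algebra_simps)
  hence "s - t = of_int n" by simp
  thus "s - t \<in> \<int>" by simp
next
  assume "s - t \<in> \<int>"
  then obtain k where "s - t = of_int k" by (auto elim: Ints_cases)
  hence "s = t + of_int k" by simp
  thus "circ s = circ t" by simp
qed

lemma norm_circ_diff: "(norm (circ s - circ t))\<^sup>2 = 4 * (sin (pi * (s - t)))\<^sup>2"
proof -
  have "(norm (circ s - circ t))\<^sup>2
      = (cos (2 * pi * s) - cos (2 * pi * t))\<^sup>2 + (sin (2 * pi * s) - sin (2 * pi * t))\<^sup>2"
    by (simp add: cmod_power2)
  also have "\<dots> = 2 - 2 * cos (2 * pi * s - 2 * pi * t)"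
    using sin_cos_squared_add3[of "2 * pi * s"] sin_cos_squared_add3[of "2 * pi * t"]
    by (simp add: power2_eq_square cos_diff algebra_simps)
  also have "2 * pi * s - 2 * pi * t = 2 * (pi * (s - t))" by (simp add: algebra_simps)
  also have "2 - 2 * cos (2 * (pi * (s - t))) = 4 * (sin (pi * (s - t)))\<^sup>2"
    by (simp add: cos_double_sin)
  finally show ?thesis .
qed

lemma sin_pi_ge:
  assumes "\<bar>t\<bar> \<le> 1/2"
  shows "\<bar>sin (pi * t)\<bar> \<ge> 2 * \<bar>t\<bar>"
proof -
  have *: "sin (pi * u) \<ge> 2 * u" if "0 \<le> u" "u \<le> 1/2" for u :: real
  proof -
    have conc: "concave_on {0..pi} sin"
      by (rule f''_le0_imp_concave[where f' = cos and f'' = "\<lambda>x. - sin x"])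
         (auto intro!: derivative_eq_intros sin_ge_zero simp: convex_real_interval)
    have "sin ((1 - 2*u) *\<^sub>R 0 + (2*u) *\<^sub>R (pi/2)) \<ge> (1 - 2*u) * sin 0 + (2*u) * sin (pi/2)"
      by (rule concave_onD[OF conc]) (use that in auto)
    thus ?thesis by (simp add: mult_ac)
  qed
  show ?thesis
    using *[of t] *[of "-t"] assms by (cases "t \<ge> 0") auto
qed

text \<open>The chord is \<open>2 * \<bar>sin (pi * u)\<bar>\<close> with \<open>u\<close> the
  signed distance to the nearest integer, and Jordan's inequality bounds it below by
  \<open>4 * \<bar>u\<bar>\<close>.\<close>

lemma circ_near_int:
  assumes "norm (circ s - circ t) \<le> 4 * d"
  obtains k :: int where "\<bar>s - t - of_int k\<bar> \<le> d"
proof -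
  define k where "k = round (s - t)"
  define u where "u = s - t - of_int k"
  have u: "\<bar>u\<bar> \<le> 1/2" unfolding u_def k_def using of_int_round_abs_le[of "s-t"]
    by (simp add: abs_minus_commute)
  have "circ s = circ (t + u)"
    using circ_add_int[of "t + u" k] by (simp add: u_def)
  hence "(norm (circ s - circ t))\<^sup>2 = 4 * (sin (pi * u))\<^sup>2"
    using norm_circ_diff[of "t+u" t] by simp
  also have "\<dots> = (2 * \<bar>sin (pi * u)\<bar>)\<^sup>2" by (simp add: power_mult_distrib)
  finally have "norm (circ s - circ t) = 2 * \<bar>sin (pi * u)\<bar>"
    by (rule power2_eq_imp_eq) auto
  with sin_pi_ge[OF u] assms have "4 * \<bar>u\<bar> \<le> 4 * d" by simp
  with that[of k] show ?thesis by (simp add: u_def)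
qed

section \<open>Moebius maps of the circle and their real lifts\<close>

locale moebius_rotation =
  fixes r :: real
  assumes r0: "0 < r" and r1: "r < 1"
begin

definition mob :: "complex \<Rightarrow> complex" where
  "mob c = (c - of_real r) / (1 - of_real r * c)"

text \<open>On the circle \<open>mob c = c * (1 - r * cnj c) / (1 - r * c)\<close>. The last
  quotient is one of conjugate numbers in the right half-plane, so its argument is twice an
  arctangent, and dividing by \<open>2 * pi\<close> leaves \<open>arctan _ / pi\<close>. No branch
  has to be chosen.\<close>

definition lift :: "real \<Rightarrow> real" where
  "lift t = t + arctan (r * sin (2 * pi * t) / (1 - r * cos (2 * pi * t))) / pi"

text \<open>This is the Poisson kernel; it turns out to be the derivative of
  \<open>lift\<close>.\<close>

definition speed :: "real \<Rightarrow> real" where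
  "speed t = (1 - r\<^sup>2) / (norm (1 - of_real r * circ t))\<^sup>2"

lemma r_cos_less: "r * cos x < 1"
proof -
  have "r * cos x \<le> r * 1" using r0 by (intro mult_left_mono) auto
  thus ?thesis using r1 by simp
qed

lemma one_minus_r_sq_pos: "0 < 1 - r\<^sup>2"
  using r0 r1 by (simp add: abs_square_less_1)

lemma norm_1_minus_lower:
  fixes c :: complex
  assumes "norm c \<le> 1" shows "norm (1 - of_real r * c) \<ge> 1 - r"
proof -
  have "norm (of_real r * c) \<le> r * 1"
    using mult_left_mono[OF assms, of r] r0 by (simp add: norm_mult)
  thus ?thesis using norm_triangle_ineq2[of 1 "of_real r * c"] by simp
qed

lemma norm_1_minus_upper:
  fixes c :: complex
  assumes "norm c \<le> 1" shows "norm (1 - of_real r * c) \<le> 1 + r"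
proof -
  have "norm (of_real r * c) \<le> r * 1"
    using mult_left_mono[OF assms, of r] r0 by (simp add: norm_mult)
  thus ?thesis using norm_triangle_ineq4[of 1 "of_real r * c"] by simp
qed

lemma one_minus_nz: "norm (c::complex) \<le> 1 \<Longrightarrow> 1 - of_real r * c \<noteq> 0"
  using norm_1_minus_lower[of c] r1 by fastforce

lemma norm_one_minus_pos: "norm (c::complex) \<le> 1 \<Longrightarrow> norm (1 - of_real r * c) > 0"
  using one_minus_nz[of c] by simp

lemma norm_circ_sq: "(norm (1 - of_real r * circ t))\<^sup>2
    = (1 - r * cos (2 * pi * t))\<^sup>2 + (r * sin (2 * pi * t))\<^sup>2"
  by (simp add: cmod_power2)

lemma circ_lift: "circ (lift t) = mob (circ t)"
proof -
  define X Y where "X = 1 - r * cos (2 * pi * t)" and "Y = r * sin (2 * pi * t)"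
  have X: "X > 0" using r_cos_less by (simp add: X_def)
  define S where "S = X\<^sup>2 + Y\<^sup>2"
  have S: "S > 0" using X by (simp add: S_def sum_power2_gt_zero_iff)
  define a where "a = arctan (Y / X)"
  have sq: "1 + (Y/X)\<^sup>2 = S / X\<^sup>2" using X by (simp add: S_def field_simps)
  have c: "(cos a)\<^sup>2 = X\<^sup>2 / S" "cos a * sin a = X * Y / S"
  proof -
    have "sqrt (S / X\<^sup>2) = sqrt S / X" using X by (simp add: real_sqrt_divide)
    hence ca: "cos a = X / sqrt S" and sa: "sin a = Y / sqrt S"
      using X by (simp_all add: a_def cos_arctan sin_arctan sq)
    show "(cos a)\<^sup>2 = X\<^sup>2 / S"
      unfolding ca power_divide using S by simp
    show "cos a * sin a = X * Y / S"
      unfolding ca sa times_divide_times_eq using S by simp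
  qed
  have "cis (2 * a) = Complex ((X\<^sup>2 - Y\<^sup>2) / S) (2 * X * Y / S)"
  proof -
    have "cos (2 * a) = 2 * (cos a)\<^sup>2 - 1" by (simp add: cos_double_cos)
    also have "\<dots> = (2 * X\<^sup>2 - S) / S" unfolding c using S by (simp add: field_simps)
    also have "\<dots> = (X\<^sup>2 - Y\<^sup>2) / S" by (simp add: S_def)
    finally have "cos (2 * a) = (X\<^sup>2 - Y\<^sup>2) / S" .
    moreover have "sin (2 * a) = 2 * X * Y / S" using c(2) by (simp only: sin_double) (metis mult.assoc mult.commute times_divide_eq_right)
    ultimately show ?thesis by (simp add: complex_eq_iff)
  qed
  also have "\<dots> = Complex X Y / Complex X (-Y)"
    using S by (simp add: complex_eq_iff Re_divide Im_divide S_def power2_eq_square)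
  finally have cis: "cis (2 * a) = Complex X Y / Complex X (-Y)" .
  have "2 * pi * lift t = 2 * pi * t + 2 * a"
    by (simp add: lift_def a_def X_def Y_def ring_distribs)
  hence "circ (lift t) = circ t * (Complex X Y / Complex X (-Y))"
    by (simp add: cis_mult [symmetric] cis)
  also have "Complex X (-Y) = 1 - of_real r * circ t"
    by (simp add: complex_eq_iff X_def Y_def)
  also have "circ t * (Complex X Y / (1 - of_real r * circ t)) = mob (circ t)"
  proof -
    have "Complex X Y = 1 - of_real r * cis (- (2 * pi * t))"
      by (simp add: complex_eq_iff X_def Y_def)
    hence "circ t * Complex X Y = circ t - of_real r * (circ t * cis (- (2 * pi * t)))"
      by (simp only: right_diff_distrib mult.left_commute mult_1_right)
    also have "circ t * cis (- (2 * pi * t)) = 1" by (simp add: cis_mult)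
    finally show ?thesis by (simp add: mob_def)
  qed
  finally show ?thesis .
qed

lemma lift_deriv: "(lift has_real_derivative speed t) (at t)"
proof -
  define X Y where "X = 1 - r * cos (2 * pi * t)" and "Y = r * sin (2 * pi * t)"
  have X: "X > 0" using r_cos_less by (simp add: X_def)
  define S where "S = X\<^sup>2 + Y\<^sup>2"
  have S: "S > 0" using X by (simp add: S_def sum_power2_gt_zero_iff)
  have sq: "1 + (Y/X)\<^sup>2 = S / X\<^sup>2" using X by (simp add: S_def field_simps)
  have "((\<lambda>t. r * sin (2 * pi * t) / (1 - r * cos (2 * pi * t))) has_real_derivative
     ((r * (2 * pi * cos (2 * pi * t))) * X - Y * (r * (2 * pi * sin (2 * pi * t)))) / (X * X)) (at t)"
    unfolding X_def Y_def
    by (rule DERIV_divide) (use X in \<open>auto intro!: derivative_eq_intros simp: X_def\<close>)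
  hence "((\<lambda>t. arctan (r * sin (2 * pi * t) / (1 - r * cos (2 * pi * t)))) has_real_derivative
     inverse (1 + (Y/X)\<^sup>2) * (((r * (2 * pi * cos (2 * pi * t))) * X - Y * (r * (2 * pi * sin (2 * pi * t)))) / (X * X))) (at t)"
    unfolding X_def Y_def by (intro DERIV_chain2[OF DERIV_arctan])
  hence "(lift has_real_derivative
     1 + inverse (1 + (Y/X)\<^sup>2) * (((r * (2 * pi * cos (2 * pi * t))) * X - Y * (r * (2 * pi * sin (2 * pi * t)))) / (X * X)) / pi) (at t)"
    unfolding lift_def[abs_def] by (intro DERIV_add DERIV_ident DERIV_cdivide)
  also have "1 + inverse (1 + (Y/X)\<^sup>2) * (((r * (2 * pi * cos (2 * pi * t))) * X - Y * (r * (2 * pi * sin (2 * pi * t)))) / (X * X)) / pi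
      = 1 + 2 * (r * cos (2 * pi * t) * X - Y * Y) / S"
    unfolding sq using X S by (simp add: Y_def field_simps power2_eq_square)
  also have "\<dots> = (S + 2 * (r * cos (2 * pi * t) * X - Y * Y)) / S" using S by (simp add: field_simps)
  also have "S + 2 * (r * cos (2 * pi * t) * X - Y * Y) = 1 - r\<^sup>2"
  proof -
    have "r * cos (2 * pi * t) = 1 - X" by (simp add: X_def)
    moreover have "(1 - X)\<^sup>2 + Y\<^sup>2 = r\<^sup>2 * ((cos (2 * pi * t))\<^sup>2 + (sin (2 * pi * t))\<^sup>2)"
      by (simp add: X_def Y_def power_mult_distrib flip: distrib_left)
    ultimately show ?thesis unfolding S_def
      by (simp only:) (simp add: power2_eq_square algebra_simps)
  qed
  also have "S = (norm (1 - of_real r * circ t))\<^sup>2"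
    by (simp only: norm_circ_sq S_def X_def Y_def)
  finally show ?thesis by (simp only: speed_def)
qed

lemma speed_pos: "speed t > 0"
  using one_minus_r_sq_pos norm_one_minus_pos[of "circ t"] by (simp add: speed_def)

lemma lift_add_int [simp]: "lift (t + of_int k) = lift t + of_int k"
proof -
  have "cos (2 * pi * (t + of_int k)) = cos (2 * pi * t)" "sin (2 * pi * (t + of_int k)) = sin (2 * pi * t)"
    using circ_add_int[of t k] by (auto simp: complex_eq_iff simp del: circ_add_int)
  thus ?thesis by (simp add: lift_def)
qed

lemma lift_near: "\<bar>lift t - t\<bar> < 1 / 2"
  using arctan_bounded[of "r * sin (2 * pi * t) / (1 - r * cos (2 * pi * t))"]
  by (auto simp: lift_def abs_if field_simps)

lemma lift_strict_mono: "strict_mono lift"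
  by (rule strict_monoI) (metis DERIV_pos_imp_increasing lift_deriv speed_pos)

lemma lift_le [simp]: "lift a \<le> lift b \<longleftrightarrow> a \<le> b"
  using lift_strict_mono by (simp add: strict_mono_less_eq)

lemma mob_diff:
  assumes "norm a \<le> 1" "norm b \<le> 1"
  shows "mob a - mob b = (1 - of_real r ^ 2) * (a - b) / ((1 - of_real r * a) * (1 - of_real r * b))"
proof -
  have "mob a - mob b = ((a - of_real r) * (1 - of_real r * b) - (b - of_real r) * (1 - of_real r * a))
      / ((1 - of_real r * a) * (1 - of_real r * b))"
    unfolding mob_def by (rule diff_frac_eq) (use one_minus_nz assms in auto)
  also have "(a - of_real r) * (1 - of_real r * b) - (b - of_real r) * (1 - of_real r * a)
      = (1 - of_real r ^ 2) * (a - b)"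
    by (simp add: algebra_simps power2_eq_square)
  finally show ?thesis .
qed

text \<open>A difference of two Moebius values factors through the two denominators, so a chord is
  stretched exactly by the geometric mean of the derivatives at its ends. This two-point identity
  lets an extreme derivative at one point govern all other points.\<close>

lemma lift_chord:
  "(norm (circ (lift s) - circ (lift t)))\<^sup>2 = speed s * speed t * (norm (circ s - circ t))\<^sup>2"
proof -
  have "norm (1 - complex_of_real r ^ 2) = 1 - r\<^sup>2"
  proof -
    have "1 - complex_of_real r ^ 2 = of_real (1 - r\<^sup>2)" by simp
    thus ?thesis using one_minus_r_sq_pos by (simp only: norm_of_real abs_of_pos)
  qed
  thus ?thesis
    unfolding circ_lift speed_def
    by (simp only: mob_diff norm_cis order_refl norm_mult norm_divide power_mult_distrib power_divide)
       (simp add: power2_eq_square)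
qed

lemma circ_reflect: "circ (1/2 - t) = - cnj (circ t)"
proof -
  have eq: "2 * pi * (1/2 - t) = pi + - (2 * pi * t)" by (simp add: algebra_simps)
  have "circ (1/2 - t) = cis pi * cis (- (2 * pi * t))" unfolding eq by (rule cis_mult [symmetric])
  thus ?thesis by (simp only: cis_pi cis_cnj) simp
qed

lemma mob_reflect_identities:
  fixes d :: complex
  assumes "1 - of_real r * d \<noteq> 0"
  shows "1 + of_real r * ((d - of_real r) / (1 - of_real r * d)) = of_real (1 - r\<^sup>2) / (1 - of_real r * d)"
    and "- (d - of_real r) / (1 - of_real r * d) - of_real r = - d * of_real (1 - r\<^sup>2) / (1 - of_real r * d)"
proof -
  define e where "e = 1 - of_real r * d"
  have e: "e \<noteq> 0" using assms by (simp add: e_def)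
  have "1 + of_real r * ((d - of_real r) / e) = (e + of_real r * (d - of_real r)) / e"
    using e by (simp add: add_divide_distrib)
  also have "e + of_real r * (d - of_real r) = of_real (1 - r\<^sup>2)"
    by (simp add: e_def algebra_simps power2_eq_square)
  finally show "1 + of_real r * ((d - of_real r) / (1 - of_real r * d)) = of_real (1 - r\<^sup>2) / (1 - of_real r * d)"
    by (simp only: e_def)
  have "- (d - of_real r) / e - of_real r = (- (d - of_real r) - of_real r * e) / e"
    using e by (simp add: diff_divide_distrib)
  also have "- (d - of_real r) - of_real r * e = - d * of_real (1 - r\<^sup>2)"
    by (simp add: e_def algebra_simps power2_eq_square)
  finally show "- (d - of_real r) / (1 - of_real r * d) - of_real r = - d * of_real (1 - r\<^sup>2) / (1 - of_real r * d)"
    by (simp only: e_def)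
qed

text \<open>Since \<open>r\<close> is real, conjugation by \<open>c \<mapsto> - cnj c\<close>, which
  is \<open>t \<mapsto> 1/2 - t\<close> on lifts, turns \<open>mob\<close> into its inverse. On the
  circle this fixes the lift up to an integer, which vanishes because \<open>lift\<close> moves
  points by less than \<open>1/2\<close>.\<close>

lemma lift_reflect: "lift (1/2 - lift t) = 1/2 - t"
proof -
  have nz: "1 - complex_of_real r * cnj (circ t) \<noteq> 0" by (rule one_minus_nz) simp
  have "circ (lift (1/2 - lift t)) = mob (- cnj (mob (circ t)))"
    by (simp only: circ_lift circ_reflect)
  also have "\<dots> = - cnj (circ t)"
  proof -
    define d where "d = cnj (circ t)"
    have nz: "1 - complex_of_real r * d \<noteq> 0" using nz by (simp add: d_def)
    have r2: "complex_of_real (1 - r\<^sup>2) \<noteq> 0" using one_minus_r_sq_pos by (simp only: of_real_eq_0_iff)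
    have "mob (- cnj (mob (circ t))) = (- (d - r) / (1 - r * d) - r) / (1 + r * ((d - r) / (1 - r * d)))"
    proof -
      have "cnj (mob (circ t)) = (d - r) / (1 - r * d)" by (simp add: mob_def d_def)
      thus ?thesis by (simp only: mob_def[of "- _"] minus_divide_left[symmetric] mult_minus_right diff_minus_eq_add)
    qed
    also have "1 + r * ((d - r) / (1 - r * d)) = complex_of_real (1 - r\<^sup>2) / (1 - r * d)"
      by (rule mob_reflect_identities(1)[OF nz])
    also have "- (d - r) / (1 - r * d) - r = - d * complex_of_real (1 - r\<^sup>2) / (1 - r * d)"
      by (rule mob_reflect_identities(2)[OF nz])
    also have "\<dots> / (complex_of_real (1 - r\<^sup>2) / (1 - r * d)) = - d"
      using nz r2 by (simp only: divide_divide_eq_right) simp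
    finally show ?thesis by (simp add: d_def)
  qed
  also have "\<dots> = circ (1/2 - t)" by (simp only: circ_reflect)
  finally obtain k where k: "lift (1/2 - lift t) - (1/2 - t) = of_int k"
    unfolding circ_eq_iff by (auto elim: Ints_cases)
  have "\<bar>lift (1/2 - lift t) - (1/2 - t)\<bar> < 1"
    using lift_near[of "1/2 - lift t"] lift_near[of t] by linarith
  with k have "k = 0" by linarith
  with k show ?thesis by simp
qed

lemma speed_reflect: "speed (1/2 - lift t) = 1 / speed t"
proof -
  have nz: "1 - complex_of_real r * circ t \<noteq> 0" by (rule one_minus_nz) simp
  have "norm (1 - r * circ (1/2 - lift t)) = norm (1 + r * cnj (mob (circ t)))"
    by (simp only: circ_reflect circ_lift) simp
  also have "\<dots> = norm (cnj (1 + r * mob (circ t)))" by simp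
  also have "\<dots> = norm (1 + r * mob (circ t))" by (simp only: complex_mod_cnj)
  also have "1 + r * mob (circ t) = complex_of_real (1 - r\<^sup>2) / (1 - r * circ t)"
    unfolding mob_def by (rule mob_reflect_identities(1)[OF nz])
  also have "norm \<dots> = (1 - r\<^sup>2) / norm (1 - r * circ t)"
    unfolding norm_divide norm_of_real using one_minus_r_sq_pos by simp
  finally show ?thesis using one_minus_r_sq_pos nz by (simp add: speed_def power_divide power2_eq_square)
qed

section \<open>Phase orbits and resonant blocks\<close>

text \<open>Phases are kept in the real line rather than modulo 1: this counts full turns and makes
  the orbit monotone in the parameter \<open>y\<close> and in the initial value
  \<open>c\<close>.\<close>

primrec phase :: "real \<Rightarrow> nat \<Rightarrow> real \<Rightarrow> real \<Rightarrow> real" where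
  "phase \<Omega> 0 y c = c"
| "phase \<Omega> (Suc n) y c = y + real n * \<Omega> + lift (phase \<Omega> n y c)"

definition dphase :: "real \<Rightarrow> nat \<Rightarrow> real \<Rightarrow> real \<Rightarrow> real" where
  "dphase \<Omega> n y c = (\<Prod>k<n. speed (phase \<Omega> k y c))"

lemma dphase_0 [simp]: "dphase \<Omega> 0 y c = 1"
  and dphase_Suc: "dphase \<Omega> (Suc n) y c = speed (phase \<Omega> n y c) * dphase \<Omega> n y c"
  by (simp_all add: dphase_def mult.commute)

lemma dphase_pos: "dphase \<Omega> n y c > 0"
  by (simp add: dphase_def prod_pos speed_pos)

lemma phase_add: "phase \<Omega> (m + n) y c = phase \<Omega> n (y + real m * \<Omega>) (phase \<Omega> m y c)"
  by (induction n) (simp_all add: algebra_simps)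

lemma dphase_add:
  "dphase \<Omega> (m + n) y c = dphase \<Omega> m y c * dphase \<Omega> n (y + real m * \<Omega>) (phase \<Omega> m y c)"
  by (induction n) (simp_all add: dphase_Suc phase_add)

lemma phase_deriv: "(phase \<Omega> n y has_real_derivative dphase \<Omega> n y c) (at c)"
proof (induction n)
  case 0
  have "phase \<Omega> 0 y = (\<lambda>c. c)" by (rule ext) simp
  thus ?case by simp
next
  case (Suc n)
  have "((\<lambda>c. lift (phase \<Omega> n y c)) has_real_derivative speed (phase \<Omega> n y c) * dphase \<Omega> n y c) (at c)"
    by (rule DERIV_chain2[OF lift_deriv Suc])
  hence "((\<lambda>c. y + real n * \<Omega> + lift (phase \<Omega> n y c)) has_real_derivative
     0 + speed (phase \<Omega> n y c) * dphase \<Omega> n y c) (at c)"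
    by (intro DERIV_add DERIV_const)
  moreover have "phase \<Omega> (Suc n) y = (\<lambda>c. y + real n * \<Omega> + lift (phase \<Omega> n y c))" by (rule ext) simp
  ultimately show ?case by (simp add: dphase_Suc)
qed

lemma phase_add_int [simp]: "phase \<Omega> n y (c + of_int k) = phase \<Omega> n y c + of_int k"
  by (induction n) simp_all

lemma phase_shift_int: "phase \<Omega> n (y + of_int k) c = phase \<Omega> n y c + of_int (k * int n)"
proof (induction n)
  case (Suc n)
  show ?case unfolding phase.simps Suc lift_add_int by (simp add: algebra_simps)
qed simp

lemma dphase_add_int [simp]: "dphase \<Omega> n y (c + of_int k) = dphase \<Omega> n y c"
  by (simp only: dphase_def phase_add_int speed_def circ_add_int)

section \<open>Monotonicity, contraction and expansion of phase orbits\<close>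

lemma phase_mono:
  assumes "y \<le> y'" "c \<le> c'"
  shows "phase \<Omega> n y c \<le> phase \<Omega> n y' c'"
proof (induction n)
  case (Suc n)
  hence "lift (phase \<Omega> n y c) \<le> lift (phase \<Omega> n y' c')" by (simp only: lift_le)
  with assms(1) show ?case by (simp del: lift_le)
qed (use assms in auto)

text \<open>Every step adds \<open>y\<close> itself after a monotone map, so an increase of the
  parameter shows in full at the end, however strongly the orbit contracts. This is the
  transversality in the spectral parameter.\<close>

lemma phase_rate:
  assumes "y \<le> y'" "c' - c \<ge> y' - y"
  shows "phase \<Omega> n y' c' - phase \<Omega> n y c \<ge> y' - y"
proof (cases n)
  case (Suc m)
  have "phase \<Omega> m y c \<le> phase \<Omega> m y' c'" by (rule phase_mono) (use assms in auto)
  hence "lift (phase \<Omega> m y c) \<le> lift (phase \<Omega> m y' c')" by (simp only: lift_le)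
  thus ?thesis by (simp add: Suc)
qed (use assms in auto)

lemma phase_chord:
  "(norm (circ (phase \<Omega> n y c) - circ (phase \<Omega> n y c')))\<^sup>2
     = dphase \<Omega> n y c * dphase \<Omega> n y c' * (norm (circ c - circ c'))\<^sup>2"
proof (induction n)
  case (Suc n)
  have *: "circ (y + real n * \<Omega> + t) = circ (y + real n * \<Omega>) * circ t" for t
    by (simp only: cis_mult distrib_left)
  have "norm (circ (phase \<Omega> (Suc n) y c) - circ (phase \<Omega> (Suc n) y c'))
      = norm (circ (lift (phase \<Omega> n y c)) - circ (lift (phase \<Omega> n y c')))"
    unfolding phase.simps * right_diff_distrib[symmetric] norm_mult by simp
  thus ?case
    by (simp only: lift_chord Suc dphase_Suc) (simp add: mult_ac)
qed simp

lemma phase_mean_value: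
  assumes "c < c'"
  obtains b where "c < b" "b < c'" "phase \<Omega> n y c' - phase \<Omega> n y c = (c' - c) * dphase \<Omega> n y b"
  using MVT2[OF assms phase_deriv] by blast

text \<open>By the chord identity, a small derivative at one point forces contraction wherever the
  derivative is not large, and the latter fails only on a short arc.\<close>

lemma contracting_hit:
  assumes eps: "0 < \<epsilon>" and con: "dphase \<Omega> n y c0 \<le> \<epsilon> ^ 3"
  obtains c' and k :: int where "c \<le> c'" "c' \<le> c + \<epsilon>"
    "\<bar>phase \<Omega> n y c' - phase \<Omega> n y c0 - of_int k\<bar> \<le> \<epsilon> / 2"
proof -
  show thesis
  proof (cases "\<epsilon> \<ge> 1")
    case True
    define k where "k = round (phase \<Omega> n y c - phase \<Omega> n y c0)"
    have "\<bar>phase \<Omega> n y c - phase \<Omega> n y c0 - of_int k\<bar> \<le> 1/2"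
      unfolding k_def using of_int_round_abs_le by (metis abs_minus_commute)
    thus ?thesis using True eps by (intro that[of c k]) auto
  next
    case False
    obtain b where b: "c < b" "b < c + \<epsilon>"
      "phase \<Omega> n y (c + \<epsilon>) - phase \<Omega> n y c = \<epsilon> * dphase \<Omega> n y b"
      using phase_mean_value[of c "c + \<epsilon>" \<Omega> n y] eps by auto
    have "phase \<Omega> n y (c + \<epsilon>) \<le> phase \<Omega> n y (c + of_int 1)"
      by (rule phase_mono) (use False in auto)
    also have "\<dots> = phase \<Omega> n y c + 1" using phase_add_int[where k = 1] by simp
    finally have *: "\<epsilon> * dphase \<Omega> n y b \<le> 1" using b(3) by linarith
    \<comment> \<open>The exponent 3 balances here: a factor \<open>1 / \<epsilon>\<close> from the
      mean value point and \<open>\<epsilon> ^ 3\<close> from \<open>c0\<close> leave a chord of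
      order \<open>\<epsilon>\<close>.\<close>
    have "(norm (circ (phase \<Omega> n y b) - circ (phase \<Omega> n y c0)))\<^sup>2
        = dphase \<Omega> n y b * dphase \<Omega> n y c0 * (norm (circ b - circ c0))\<^sup>2" by (rule phase_chord)
    also have "\<dots> \<le> dphase \<Omega> n y b * \<epsilon> ^ 3 * 2\<^sup>2"
    proof (intro mult_mono power_mono)
      show "norm (circ b - circ c0) \<le> 2" using norm_triangle_ineq4[of "circ b" "circ c0"] by simp
    qed (use con dphase_pos[of \<Omega> n y b] dphase_pos[of \<Omega> n y c0] eps in \<open>auto simp: less_imp_le\<close>)
    also have "\<dots> = (\<epsilon> * dphase \<Omega> n y b) * (4 * \<epsilon>\<^sup>2)" by (simp add: power2_eq_square power3_eq_cube)
    also have "\<dots> \<le> 1 * (4 * \<epsilon>\<^sup>2)" using * by (intro mult_right_mono) auto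
    also have "\<dots> = (4 * (\<epsilon> / 2))\<^sup>2" by (simp add: power2_eq_square)
    finally have "norm (circ (phase \<Omega> n y b) - circ (phase \<Omega> n y c0)) \<le> 4 * (\<epsilon> / 2)"
      by (rule power2_le_imp_le) (use eps in auto)
    then obtain k :: int where "\<bar>phase \<Omega> n y b - phase \<Omega> n y c0 - of_int k\<bar> \<le> \<epsilon> / 2"
      by (rule circ_near_int)
    thus ?thesis using b by (intro that[of b k]) auto
  qed
qed

text \<open>If the image of the short arc fell short of a turn by more than
  \<open>\<epsilon>\<close>, the complementary arc would contain a point \<open>b\<close> with
  derivative above \<open>\<epsilon>\<close>. The product of the derivatives at \<open>a\<close> and
  \<open>b\<close> would then be at least \<open>1 / \<epsilon>\<^sup>2\<close>, and the chord
  identity would put \<open>b\<close> within \<open>\<epsilon> / 2\<close> of \<open>a\<close>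
  modulo 1.\<close>

lemma expanding_turn:
  assumes eps: "0 < \<epsilon>" "\<epsilon> < 1/2" and expa: "dphase \<Omega> n y a \<ge> 1 / \<epsilon> ^ 3"
  shows "phase \<Omega> n y (a + \<epsilon>) - phase \<Omega> n y (a - \<epsilon>) \<ge> 1 - \<epsilon>"
proof (rule ccontr)
  assume "\<not> ?thesis"
  moreover have "phase \<Omega> n y (a - \<epsilon> + of_int 1) = phase \<Omega> n y (a - \<epsilon>) + 1"
    using phase_add_int[where k = 1] by simp
  ultimately have *: "phase \<Omega> n y (a - \<epsilon> + 1) - phase \<Omega> n y (a + \<epsilon>) > \<epsilon>" by simp
  obtain b where b: "a + \<epsilon> < b" "b < a - \<epsilon> + 1"
    "phase \<Omega> n y (a - \<epsilon> + 1) - phase \<Omega> n y (a + \<epsilon>) = (a - \<epsilon> + 1 - (a + \<epsilon>)) * dphase \<Omega> n y b"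
    using phase_mean_value[of "a + \<epsilon>" "a - \<epsilon> + 1" \<Omega> n y] eps by auto
  have "(a - \<epsilon> + 1 - (a + \<epsilon>)) * dphase \<Omega> n y b \<le> 1 * dphase \<Omega> n y b"
    using dphase_pos[of \<Omega> n y b] eps by (intro mult_right_mono) auto
  with b * have db: "dphase \<Omega> n y b > \<epsilon>" by simp
  define N where "N = norm (circ b - circ a)"
  have "1 / \<epsilon>\<^sup>2 = \<epsilon> * (1 / \<epsilon> ^ 3)" using eps by (simp add: power2_eq_square power3_eq_cube)
  also have "\<dots> \<le> dphase \<Omega> n y b * dphase \<Omega> n y a"
    using db expa eps by (intro mult_mono) auto
  finally have "1 / \<epsilon>\<^sup>2 * N\<^sup>2 \<le> dphase \<Omega> n y b * dphase \<Omega> n y a * N\<^sup>2"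
    by (rule mult_right_mono) simp
  also have "\<dots> = (norm (circ (phase \<Omega> n y b) - circ (phase \<Omega> n y a)))\<^sup>2"
    by (simp add: phase_chord N_def)
  also have "\<dots> \<le> 2\<^sup>2"
    using norm_triangle_ineq4[of "circ (phase \<Omega> n y b)" "circ (phase \<Omega> n y a)"]
    by (intro power_mono) auto
  finally have "N\<^sup>2 \<le> (2 * \<epsilon>)\<^sup>2" using eps by (simp add: field_simps power2_eq_square)
  hence "N \<le> 2 * \<epsilon>" by (rule power2_le_imp_le) (use eps in auto)
  hence "norm (circ b - circ a) \<le> 4 * (\<epsilon> / 2)" by (simp add: N_def)
  then obtain k :: int where k: "\<bar>b - a - of_int k\<bar> \<le> \<epsilon> / 2" by (rule circ_near_int)
  from k b eps have "real_of_int k > 0" "real_of_int k < 1" by linarith+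
  thus False by simp
qed

text \<open>The incoming phase \<open>F\<close> need not be near \<open>c0\<close>: either it is focused on the orbit of \<open>c0\<close> at
  time \<open>p\<close>, or it sits on the short exceptional arc and leaves it on both sides as the parameter moves.\<close>

lemma resonance_turn:
  assumes eps: "0 < \<epsilon>" "\<epsilon> < 1/2"
    and con: "dphase \<Omega> p y c0 \<le> \<epsilon> ^ 3"
    and expa: "dphase \<Omega> q (y + real p * \<Omega>) (phase \<Omega> p y c0) \<ge> 1 / \<epsilon> ^ 3"
    and F: "\<And>x x'. x \<le> x' \<Longrightarrow> F x' - F x \<ge> x' - (x :: real)"
  shows "phase \<Omega> (p + q) (y + 4 * \<epsilon>) (F (x + 4 * \<epsilon>)) - phase \<Omega> (p + q) (y - 4 * \<epsilon>) (F (x - 4 * \<epsilon>)) \<ge> 1"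
proof -
  define a where "a = phase \<Omega> p y c0"
  define f where "f h = phase \<Omega> p (y + h) (F (x + h))" for h
  have f_rate: "f h' - f h \<ge> h' - h" if "h \<le> h'" for h h'
    unfolding f_def using phase_rate[of "y + h" "y + h'" "F (x + h')" "F (x + h)" \<Omega> p] F[of "x + h" "x + h'"] that
    by auto
  obtain c1 m1 where c1: "F x \<le> c1" "c1 \<le> F x + \<epsilon>" "\<bar>phase \<Omega> p y c1 - a - of_int m1\<bar> \<le> \<epsilon> / 2"
    unfolding a_def by (rule contracting_hit[OF eps(1) con])
  obtain c2 m2 where c2: "F x - \<epsilon> \<le> c2" "c2 \<le> F x - \<epsilon> + \<epsilon>" "\<bar>phase \<Omega> p y c2 - a - of_int m2\<bar> \<le> \<epsilon> / 2"
    unfolding a_def by (rule contracting_hit[OF eps(1) con])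
  have "phase \<Omega> p y c2 \<le> phase \<Omega> p y c1" by (rule phase_mono) (use c1 c2 in auto)
  with c1 c2 eps have "real_of_int m2 < real_of_int m1 + 1" by linarith
  hence "real_of_int m2 < of_int (m1 + 1)" by simp
  hence "m2 < m1 + 1" by (simp only: of_int_less_iff)
  \<comment> \<open>Equality is the focused case. If \<open>m2 < m1\<close>, whole turns lie between
    the two hits, which only enlarges the image.\<close>
  hence m: "real_of_int m2 \<le> real_of_int m1" by simp
  have "phase \<Omega> p y c1 \<le> f \<epsilon>" unfolding f_def
    by (rule phase_mono) (use c1 F[of x "x + \<epsilon>"] eps in auto)
  moreover have "f (- \<epsilon>) \<le> phase \<Omega> p y c2" unfolding f_def
    by (rule phase_mono) (use c2 F[of "x - \<epsilon>" x] eps in auto)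
  \<comment> \<open>The first \<open>\<epsilon>\<close> carries the incoming phase past
    \<open>c1\<close> or \<open>c2\<close>; another \<open>2 * \<epsilon>\<close> at unit rate
    absorbs the error \<open>\<epsilon> / 2\<close> of the hit and leaves the margin
    \<open>\<epsilon>\<close> around \<open>a\<close> that the expanding half needs.\<close>
  moreover have "f (3 * \<epsilon>) - f \<epsilon> \<ge> 2 * \<epsilon>" "f (- \<epsilon>) - f (- (3 * \<epsilon>)) \<ge> 2 * \<epsilon>"
    using f_rate[of \<epsilon> "3 * \<epsilon>"] f_rate[of "- (3 * \<epsilon>)" "- \<epsilon>"] eps by auto
  ultimately have hi: "f (3 * \<epsilon>) \<ge> a + \<epsilon> + of_int m1" and lo: "f (- (3 * \<epsilon>)) \<le> a - \<epsilon> + of_int m1"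
    using c1 c2 m by linarith+
  define g where "g h = phase \<Omega> (p + q) (y + h) (F (x + h))" for h
  have g: "g h = phase \<Omega> q (y + real p * \<Omega> + h) (f h)" for h
    by (simp add: g_def f_def phase_add algebra_simps)
  have "phase \<Omega> q (y + real p * \<Omega>) (a + \<epsilon>) + of_int m1 \<le> g (3 * \<epsilon>)"
    unfolding g phase_add_int [symmetric] by (rule phase_mono) (use hi eps in auto)
  moreover have "g (- (3 * \<epsilon>)) \<le> phase \<Omega> q (y + real p * \<Omega>) (a - \<epsilon>) + of_int m1"
    unfolding g phase_add_int [symmetric] by (rule phase_mono) (use lo eps in auto)
  moreover have "phase \<Omega> q (y + real p * \<Omega>) (a + \<epsilon>) - phase \<Omega> q (y + real p * \<Omega>) (a - \<epsilon>) \<ge> 1 - \<epsilon>"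
    by (rule expanding_turn) (use eps expa in \<open>auto simp: a_def\<close>)
  moreover have "g h' - g h \<ge> h' - h" if "h \<le> h'" for h h'
    unfolding g_def using phase_rate[of "y + h" "y + h'" "F (x + h')" "F (x + h)" \<Omega> "p + q"] F[of "x + h" "x + h'"] that
    by auto
  \<comment> \<open>The last \<open>\<epsilon>\<close> on either side more than makes up the deficit
    in the bound \<open>1 - \<epsilon>\<close>.\<close>
  from this[of "3 * \<epsilon>" "4 * \<epsilon>"] this[of "- (4 * \<epsilon>)" "- (3 * \<epsilon>)"] eps
  have "g (4 * \<epsilon>) - g (3 * \<epsilon>) \<ge> \<epsilon>" "g (- (3 * \<epsilon>)) - g (- (4 * \<epsilon>)) \<ge> \<epsilon>" by auto
  ultimately have "g (4 * \<epsilon>) - g (- (4 * \<epsilon>)) \<ge> 1" using eps by linarith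
  thus ?thesis by (simp add: g_def)
qed

text \<open>Monotone maps that commute with integer translations cannot undo a full turn, so
  whatever follows a resonant block is harmless.\<close>

lemma phase_increase_tail:
  assumes "y \<le> y'" "c' - c \<ge> 1"
  shows "phase \<Omega> n y' c' - phase \<Omega> n y c \<ge> 1"
proof -
  have "phase \<Omega> n y c + of_int 1 = phase \<Omega> n y (c + of_int 1)" by (simp only: phase_add_int)
  also have "\<dots> \<le> phase \<Omega> n y' c'" by (rule phase_mono) (use assms in auto)
  finally show ?thesis by simp
qed

text \<open>Time reversal: up to reflection, the backward orbit is a phase orbit for \<open>-\<Omega>\<close>.\<close>

lemma phase_reverse:
  fixes y \<Omega> L
  defines "G \<equiv> \<lambda>k. phase \<Omega> k y y"
  defines "f \<equiv> \<lambda>i. y + (real L - real i - 1) * \<Omega> + 1/2 - G (L - i)"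
  shows "i \<le> L \<Longrightarrow> phase (-\<Omega>) i (y + (real L - 2) * \<Omega>) (f 0) = f i"
    and "i \<le> L \<Longrightarrow> dphase (-\<Omega>) i (y + (real L - 2) * \<Omega>) (f 0) = 1 / dphase \<Omega> i (y + real (L - i) * \<Omega>) (G (L - i))"
proof -
  define Y where "Y = y + (real L - 2) * \<Omega>"
  \<comment> \<open>A forward step applies \<open>lift\<close> and then rotates. Going back, the
    rotation is removed before reflecting, so \<open>f i\<close> already involves the orbit point of
    index \<open>L - i - 1\<close>; this produces the offset \<open>L - 2\<close> in
    \<open>Y\<close>.\<close>
  have f: "f i = 1/2 - lift (G (L - Suc i))" if "i < L" for i
  proof -
    have "L - i = Suc (L - Suc i)" using that by simp
    hence "G (L - i) = y + real (L - Suc i) * \<Omega> + lift (G (L - Suc i))"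
      unfolding G_def by (simp only: phase.simps)
    thus ?thesis using that by (simp add: f_def of_nat_diff algebra_simps)
  qed
  have step: "f (Suc i) = Y + real i * (-\<Omega>) + lift (f i)" if "i < L" for i
    unfolding f[OF that] lift_reflect by (simp add: f_def Y_def algebra_simps)
  have ph: "phase (-\<Omega>) i Y (f 0) = f i" if "i \<le> L" for i
    using that by (induction i) (simp_all add: step del: of_nat_Suc)
  show "i \<le> L \<Longrightarrow> phase (-\<Omega>) i (y + (real L - 2) * \<Omega>) (f 0) = f i"
    using ph by (simp add: Y_def)
  have "dphase (-\<Omega>) i Y (f 0) = 1 / dphase \<Omega> i (y + real (L - i) * \<Omega>) (G (L - i))" if "i \<le> L" for i
    using that
  proof (induction i)
    case (Suc i)
    have "dphase \<Omega> (1 + i) (y + real (L - Suc i) * \<Omega>) (G (L - Suc i))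
       = speed (G (L - Suc i)) * dphase \<Omega> i (y + real (L - i) * \<Omega>) (G (L - i))"
    proof -
      have eq: "L - i = Suc (L - Suc i)" using Suc.prems by simp
      have "phase \<Omega> 1 (y + real (L - Suc i) * \<Omega>) (G (L - Suc i)) = G (L - i)"
        unfolding eq G_def by simp
      moreover have "y + real (L - Suc i) * \<Omega> + real 1 * \<Omega> = y + real (L - i) * \<Omega>"
        unfolding eq by (simp add: algebra_simps)
      moreover have "dphase \<Omega> 1 (y + real (L - Suc i) * \<Omega>) (G (L - Suc i)) = speed (G (L - Suc i))"
        by (simp add: dphase_def)
      ultimately show ?thesis unfolding dphase_add by (simp only:)
    qed
    moreover have "speed (f i) = 1 / speed (G (L - Suc i))"
      using f[of i] Suc.prems speed_reflect by simp
    ultimately show ?case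
      using Suc ph[of i] by (simp add: dphase_Suc)
  qed simp
  thus "i \<le> L \<Longrightarrow> dphase (-\<Omega>) i (y + (real L - 2) * \<Omega>) (f 0) = 1 / dphase \<Omega> i (y + real (L - i) * \<Omega>) (G (L - i))"
    by (simp add: Y_def)
qed

end

section \<open>Lyapunov exponent\<close>

text \<open>A natural exponent keeps all later bounds ordinary powers; a real exponent can be
  rounded up because \<open>q \<ge> 1\<close>.\<close>

definition diophantine :: "real \<Rightarrow> bool" where
  "diophantine \<Omega> \<longleftrightarrow> (\<exists>c>0. \<exists>t::nat. \<forall>q::nat. q \<ge> 1 \<longrightarrow>
      (\<forall>j::int. c / real q ^ t \<le> \<bar>real q * \<Omega> - of_int j\<bar>))"

lemma diophantineE:
  assumes "diophantine \<Omega>"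
  obtains c t where "c > 0" "\<And>q j. q \<ge> (1::nat) \<Longrightarrow> c / real q ^ t \<le> \<bar>real q * \<Omega> - of_int j\<bar>"
  using assms unfolding diophantine_def by blast

lemma diophantine_uminus:
  assumes "diophantine \<Omega>" shows "diophantine (- \<Omega>)"
proof -
  obtain c t where c: "c > 0" "\<And>q j. q \<ge> (1::nat) \<Longrightarrow> c / real q ^ t \<le> \<bar>real q * \<Omega> - of_int j\<bar>"
    using diophantineE[OF assms] by blast
  have "c / real q ^ t \<le> \<bar>real q * (- \<Omega>) - of_int j\<bar>" if "q \<ge> 1" for q :: nat and j :: int
    using c(2)[OF that, of "- j"] by (simp add: abs_if split: if_splits)
  with c(1) show ?thesis unfolding diophantine_def by blast
qed

lemma diophantine_mult:
  assumes "diophantine \<Omega>" "m \<ge> (1::nat)" shows "diophantine (real m * \<Omega>)"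
proof -
  obtain c t where c: "c > 0" "\<And>q j. q \<ge> (1::nat) \<Longrightarrow> c / real q ^ t \<le> \<bar>real q * \<Omega> - of_int j\<bar>"
    using diophantineE[OF assms(1)] by blast
  have "(c / real m ^ t) / real q ^ t \<le> \<bar>real q * (real m * \<Omega>) - of_int j\<bar>" if "q \<ge> 1" for q :: nat and j :: int
  proof -
    have "q * m \<ge> 1" using that assms(2) by simp
    from c(2)[OF this, of j] show ?thesis by (simp add: power_mult_distrib mult_ac)
  qed
  moreover have "c / real m ^ t > 0" using c(1) assms(2) by simp
  ultimately show ?thesis unfolding diophantine_def by blast
qed

section \<open>Quantitative density of rotation orbits\<close>

text \<open>Dirichlet's theorem supplies \<open>q \<le> M\<close> for which
  \<open>q \<Omega>\<close> is within \<open>1 / M\<close> of an integer, and the Diophantine bound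
  keeps that step at least \<open>c / M ^ t\<close> long. Hence \<open>M ^ t / c\<close> such steps
  go once around the circle without leaving gaps longer than \<open>1 / M\<close>.\<close>

lemma diophantine_covering:
  assumes "diophantine \<Omega>"
  obtains K b :: nat where "\<And>M x y. M \<ge> 1 \<Longrightarrow>
     \<exists>k\<le>K * M ^ b. \<exists>j::int. \<bar>y - x - real k * \<Omega> - of_int j\<bar> \<le> 1 / real M"
proof -
  obtain c t where c: "c > 0" "\<And>q j. q \<ge> (1::nat) \<Longrightarrow> c / real q ^ t \<le> \<bar>real q * \<Omega> - of_int j\<bar>"
    using diophantineE[OF assms] by blast
  define K where "K = nat \<lceil>1 / c\<rceil>"
  have K: "1 / c \<le> real K" unfolding K_def by linarith
  have "\<exists>k\<le>K * M ^ (t + 1). \<exists>j::int. \<bar>y - x - real k * \<Omega> - of_int j\<bar> \<le> 1 / real M"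
    if M: "M \<ge> 1" for M :: nat and x y :: real
  proof -
    obtain h q' where q': "0 < q'" "q' \<le> int M" "\<bar>of_int q' * \<Omega> - of_int h\<bar> < 1 / M"
      using Dirichlet_approx[of M \<Omega>] M by (metis less_eq_Suc_le One_nat_def)
    define q where "q = nat q'"
    have q: "1 \<le> q" "q \<le> M" "\<bar>real q * \<Omega> - of_int h\<bar> < 1 / M"
      using q' by (auto simp: q_def)
    define d where "d = real q * \<Omega> - of_int h"
    have "c / real M ^ t \<le> c / real q ^ t"
      using q c(1) by (intro divide_left_mono power_mono mult_pos_pos) auto
    with c(2)[OF q(1), of h] have d: "c / real M ^ t \<le> \<bar>d\<bar>" by (simp add: d_def)
    have "0 < c / real M ^ t" using c(1) M by simp
    with d have d0: "\<bar>d\<bar> > 0" by linarith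
    \<comment> \<open>This representative of \<open>y - x\<close> modulo 1 lies on the side towards
      which \<open>d\<close> points, so the real number \<open>v\<close> of steps needed to reach it
      is nonnegative.\<close>
    define j where "j = (if d > 0 then \<lfloor>y - x\<rfloor> else \<lceil>y - x\<rceil>)"
    define v where "v = (y - x - of_int j) / d"
    have v: "0 \<le> v" "v * \<bar>d\<bar> \<le> 1"
    proof -
      have a: "0 \<le> (y - x - of_int j) / d \<and> \<bar>y - x - of_int j\<bar> \<le> 1"
      proof (cases "d > 0")
        case True
        have "0 \<le> y - x - of_int \<lfloor>y - x\<rfloor>" "y - x - of_int \<lfloor>y - x\<rfloor> \<le> 1" by linarith+
        with True show ?thesis by (simp add: j_def)
      next
        case False
        have "y - x - of_int \<lceil>y - x\<rceil> \<le> 0" "y - x - of_int \<lceil>y - x\<rceil> \<ge> - 1" by linarith+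
        with False d0 show ?thesis by (auto simp: j_def intro!: divide_nonpos_nonpos)
      qed
      thus "0 \<le> v" by (simp add: v_def)
      have "v * \<bar>d\<bar> = \<bar>y - x - of_int j\<bar>" using a d0 \<open>0 \<le> v\<close>
        by (metis v_def abs_mult abs_of_nonneg d0 less_numeral_extra(3) nonzero_eq_divide_eq abs_zero)
      thus "v * \<bar>d\<bar> \<le> 1" using a by simp
    qed
    define i where "i = nat \<lfloor>v\<rfloor>"
    have i: "real i \<le> v" "v < real i + 1" using v(1) unfolding i_def by linarith+
    have "real i * \<bar>d\<bar> \<le> v * \<bar>d\<bar>" using i by (intro mult_right_mono) auto
    with v(2) have "real i * \<bar>d\<bar> \<le> 1" by linarith
    hence "real i \<le> 1 / \<bar>d\<bar>" using d0 by (simp add: field_simps)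
    also have "\<dots> \<le> 1 / (c / real M ^ t)" using d d0 c(1) M by (intro divide_left_mono) auto
    also have "\<dots> = (1 / c) * real M ^ t" by simp
    also have "\<dots> \<le> real K * real M ^ t" using K by (intro mult_right_mono) auto
    finally have "real i \<le> real (K * M ^ t)" by simp
    hence "i \<le> K * M ^ t" by (simp only: of_nat_le_iff)
    hence iq: "i * q \<le> K * M ^ (t + 1)" using q(2) mult_le_mono[of i "K * M ^ t" q M] by (simp add: mult_ac)
    have "y - x - real (i * q) * \<Omega> - of_int (j - int i * h) = (y - x - of_int j) - real i * d"
      by (simp add: d_def algebra_simps)
    also have "y - x - of_int j = v * d" using d0 by (simp add: v_def)
    also have "v * d - real i * d = (v - real i) * d" by (simp add: algebra_simps)
    also have "\<bar>\<dots>\<bar> \<le> 1 * \<bar>d\<bar>" unfolding abs_mult using i by (intro mult_right_mono) auto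
    also have "\<dots> \<le> 1 / M" using q(3) by (simp add: d_def)
    finally show ?thesis using iq by blast
  qed
  thus ?thesis by (intro that[of K "t + 1"]) blast
qed

lemma diophantine_dense:
  assumes "diophantine \<Omega>" "\<delta> > 0"
  obtains K :: nat where "\<And>x y. \<exists>k\<le>K. \<exists>j::int. \<bar>y - x - real k * \<Omega> - of_int j\<bar> \<le> \<delta>"
proof -
  obtain K b where K: "\<And>M x y. M \<ge> 1 \<Longrightarrow>
     \<exists>k\<le>K * M ^ b. \<exists>j::int. \<bar>y - x - real k * \<Omega> - of_int j\<bar> \<le> 1 / real M"
    using diophantine_covering[OF assms(1)] by blast
  obtain M where M: "inverse (real (Suc M)) < \<delta>" using reals_Archimedean[OF assms(2)] by blast
  have "\<exists>k\<le>K * Suc M ^ b. \<exists>j::int. \<bar>y - x - real k * \<Omega> - of_int j\<bar> \<le> \<delta>" for x y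
  proof -
    obtain k j where "k \<le> K * Suc M ^ b" "\<bar>y - x - real k * \<Omega> - of_int j\<bar> \<le> 1 / real (Suc M)"
      using K[of "Suc M" y x] by auto
    with M show ?thesis by (intro exI[of _ k] conjI exI[of _ j]) (auto simp: inverse_eq_divide)
  qed
  thus ?thesis by (rule that)
qed

lemma periodic_int:
  fixes u :: "real \<Rightarrow> 'a"
  assumes "\<And>x. u (x + 1) = u x"
  shows "u (x + of_int j) = u x"
proof -
  have n: "u (x + real n) = u x" for n x
  proof (induction n)
    case (Suc n)
    thus ?case using assms[of "x + real n"] by (simp add: add_ac)
  qed simp
  show ?thesis
  proof (cases "j \<ge> 0")
    case True
    thus ?thesis using n[of x "nat j"] by simp
  next
    case False
    thus ?thesis using n[of "x + of_int j" "nat (- j)"] by simp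
  qed
qed

lemma periodic_uniformly_continuous:
  fixes u :: "real \<Rightarrow> real"
  assumes cont: "continuous_on UNIV u" and per: "\<And>x. u (x + 1) = u x" and "\<epsilon> > 0"
  obtains \<delta> where "\<delta> > 0" "\<And>x y. \<bar>x - y\<bar> \<le> \<delta> \<Longrightarrow> \<bar>u x - u y\<bar> \<le> \<epsilon>"
proof -
  have "uniformly_continuous_on {-1..2} u"
    by (intro compact_uniformly_continuous continuous_on_subset[OF cont]) auto
  then obtain d where d: "d > 0" "\<And>x y. x \<in> {-1..2} \<Longrightarrow> y \<in> {-1..2} \<Longrightarrow> dist x y < d \<Longrightarrow> dist (u x) (u y) < \<epsilon>"
    unfolding uniformly_continuous_on_def using \<open>\<epsilon> > 0\<close> by metis
  have "\<bar>u x - u y\<bar> \<le> \<epsilon>" if "\<bar>x - y\<bar> \<le> min (d / 2) 1" for x y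
  proof -
    define i where "i = \<lfloor>x\<rfloor>"
    have "u (x + of_int (- i)) = u x" "u (y + of_int (- i)) = u y"
      by (rule periodic_int[of u, OF per])+
    moreover have "dist (u (x + of_int (- i))) (u (y + of_int (- i))) < \<epsilon>"
    proof (rule d(2))
      have "real_of_int i \<le> x" "x < real_of_int i + 1" unfolding i_def by linarith+
      thus "x + of_int (- i) \<in> {-1..2}" "y + of_int (- i) \<in> {-1..2}" using that by auto
    qed (use that d(1) in \<open>auto simp: dist_real_def\<close>)
    ultimately show ?thesis by (simp add: dist_real_def)
  qed
  thus ?thesis using d(1) by (intro that[of "min (d/2) 1"]) auto
qed

text \<open>Uniform convergence in the ergodic theorem, with a constant independent of
  \<open>x\<close>. Dropping at most \<open>K\<close> terms moves \<open>x\<close> close to any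
  prescribed \<open>y\<close>, at bounded cost, and uniform continuity then compares the two sums.
  Integrating over \<open>y\<close> replaces the sum at \<open>y\<close> by its mean, zero.\<close>

lemma rotation_sum_upper_bound:
  fixes u :: "real \<Rightarrow> real"
  assumes cont: "continuous_on UNIV u" and per: "\<And>x. u (x + 1) = u x"
    and mean: "\<And>a. ((\<lambda>t. u (a + t)) has_integral 0) {0..1}"
    and dio: "diophantine \<Omega>" and "\<epsilon> > 0"
  shows "\<exists>C. \<forall>k x. (\<Sum>i<k. u (x + real i * \<Omega>)) \<le> \<epsilon> * real k + C"
proof -
  obtain \<delta> where \<delta>: "\<delta> > 0" "\<And>x y. \<bar>x - y\<bar> \<le> \<delta> \<Longrightarrow> \<bar>u x - u y\<bar> \<le> \<epsilon>"
    using periodic_uniformly_continuous[OF cont per \<open>\<epsilon> > 0\<close>] by blast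
  obtain K where K: "\<And>x y. \<exists>k\<le>K. \<exists>j::int. \<bar>y - x - real k * \<Omega> - of_int j\<bar> \<le> \<delta>"
    using diophantine_dense[OF dio \<delta>(1)] by blast
  have "bounded (u ` {0..1})"
    by (intro compact_imp_bounded compact_continuous_image continuous_on_subset[OF cont]) auto
  then obtain B where B: "\<And>x. x \<in> {0..1} \<Longrightarrow> \<bar>u x\<bar> \<le> B"
    unfolding bounded_real by (metis image_eqI)
  have B: "\<bar>u x\<bar> \<le> B" for x
  proof -
    have "u x = u (frac x)" using periodic_int[of u, OF per, of "frac x" "\<lfloor>x\<rfloor>"] by (simp add: frac_def)
    thus ?thesis using B[of "frac x"] frac_lt_1[of x] by (simp add: less_imp_le)
  qed
  have B0: "B \<ge> 0" using B[of 0] by linarith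
  have "(\<Sum>i<k. u (x + real i * \<Omega>)) \<le> \<epsilon> * real k + 2 * B * real K" for k x
  proof -
    define S where "S x = (\<Sum>i<k. u (x + real i * \<Omega>))" for x
    have step: "S x \<le> S (x + \<Omega>) + 2 * B" for x
    proof -
      have "S (x + \<Omega>) = (\<Sum>i<k. u (x + real (Suc i) * \<Omega>))"
        unfolding S_def by (intro sum.cong refl arg_cong[of _ _ u]) (simp add: algebra_simps)
      also have "\<dots> = (\<Sum>i<Suc k. u (x + real i * \<Omega>)) - u x"
        by (subst sum.lessThan_Suc_shift) simp
      also have "\<dots> = S x + u (x + real k * \<Omega>) - u x" by (simp add: S_def)
      finally show ?thesis using B[of x] B[of "x + real k * \<Omega>"] by linarith
    qed
    have steps: "S x \<le> S (x + real n * \<Omega>) + 2 * B * real n" for n x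
    proof (induction n)
      case (Suc n)
      have "x + real n * \<Omega> + \<Omega> = x + real (Suc n) * \<Omega>" by (simp add: algebra_simps)
      with Suc step[of "x + real n * \<Omega>"] show ?case by (simp add: algebra_simps)
    qed simp
    have comp: "S x \<le> S y + (\<epsilon> * real k + 2 * B * real K)" for y
    proof -
      obtain n j where n: "n \<le> K" "\<bar>y - x - real n * \<Omega> - of_int j\<bar> \<le> \<delta>" using K by blast
      have "S (x + real n * \<Omega>) \<le> (\<Sum>i<k. u (y + real i * \<Omega>) + \<epsilon>)"
        unfolding S_def
      proof (intro sum_mono)
        fix i
        have "u (x + real n * \<Omega> + real i * \<Omega>) = u (x + real n * \<Omega> + real i * \<Omega> + of_int j)"
          using periodic_int[of u, OF per] by simp
        also have "\<dots> \<le> u (y + real i * \<Omega>) + \<epsilon>"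
          using \<delta>(2)[of "x + real n * \<Omega> + real i * \<Omega> + of_int j" "y + real i * \<Omega>"] n(2) by linarith
        finally show "u (x + real n * \<Omega> + real i * \<Omega>) \<le> u (y + real i * \<Omega>) + \<epsilon>" .
      qed
      also have "\<dots> = S y + \<epsilon> * real k" by (simp add: S_def sum.distrib mult.commute)
      finally have "S x \<le> S y + \<epsilon> * real k + 2 * B * real n" using steps[of x n] by linarith
      moreover have "2 * B * real n \<le> 2 * B * real K" using n(1) B0 by (intro mult_left_mono) auto
      ultimately show ?thesis by linarith
    qed
    have "((\<lambda>y. \<Sum>i<k. u (real i * \<Omega> + y)) has_integral (\<Sum>i<k. 0)) {0..1}"
      by (intro has_integral_sum mean) auto
    hence "(S has_integral 0) {0..1}" by (simp add: S_def[abs_def] add.commute)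
    moreover have "((\<lambda>y::real. \<epsilon> * real k + 2 * B * real K) has_integral \<epsilon> * real k + 2 * B * real K) {0..1}"
      using has_integral_const_real[of "\<epsilon> * real k + 2 * B * real K" 0 1] by simp
    ultimately have "((\<lambda>y. S y + (\<epsilon> * real k + 2 * B * real K)) has_integral (0 + (\<epsilon> * real k + 2 * B * real K))) {0..1}"
      by (rule has_integral_add)
    moreover have "((\<lambda>y::real. S x) has_integral S x) {0..1}"
      using has_integral_const_real[of "S x" 0 1] by simp
    ultimately have "S x \<le> 0 + (\<epsilon> * real k + 2 * B * real K)"
      using has_integral_le[where f = "\<lambda>y. S x" and g = "\<lambda>y. S y + (\<epsilon> * real k + 2 * B * real K)"] comp
      by blast
    thus ?thesis by (simp add: S_def)
  qed
  thus ?thesis by blast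
qed

section \<open>Orbits in the closed disc and the mean value property\<close>

context moebius_rotation
begin

primrec orb :: "(nat \<Rightarrow> complex) \<Rightarrow> nat \<Rightarrow> complex \<Rightarrow> complex" where
  "orb \<xi> 0 c = c"
| "orb \<xi> (Suc n) c = \<xi> n * mob (orb \<xi> n c)"

text \<open>For a phase orbit, \<open>2 * logsum\<close> is the excess of
  \<open>- ln (dphase \<Omega> n y c)\<close> over \<open>n * gam\<close>, so large values mean
  strong contraction.\<close>

definition logsum :: "(nat \<Rightarrow> complex) \<Rightarrow> nat \<Rightarrow> complex \<Rightarrow> real" where
  "logsum \<xi> n c = (\<Sum>k<n. ln (norm (1 - of_real r * orb \<xi> k c)))"

lemma norm_mob_le:
  assumes "norm c \<le> 1" shows "norm (mob c) \<le> 1"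
proof -
  have eq: "(norm (1 - of_real r * c))\<^sup>2 - (norm (c - of_real r))\<^sup>2 = (1 - r\<^sup>2) * (1 - (norm c)\<^sup>2)"
    unfolding cmod_power2 by (simp add: power2_eq_square algebra_simps)
  have "(1 - r\<^sup>2) * (1 - (norm c)\<^sup>2) \<ge> 0"
    using one_minus_r_sq_pos assms by (intro mult_nonneg_nonneg) (auto simp: power_le_one)
  with eq have "(norm (c - of_real r))\<^sup>2 \<le> (norm (1 - of_real r * c))\<^sup>2" by linarith
  hence "norm (c - of_real r) \<le> norm (1 - of_real r * c)" by (rule power2_le_imp_le) simp
  thus ?thesis unfolding mob_def norm_divide using norm_one_minus_pos[OF assms] by simp
qed

lemma norm_orb_le:
  assumes "norm c \<le> 1" "\<And>k. norm (\<xi> k) \<le> 1"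
  shows "norm (orb \<xi> n c) \<le> 1"
proof (induction n)
  case (Suc n)
  have "norm (\<xi> n * mob (orb \<xi> n c)) \<le> 1 * 1"
    unfolding norm_mult by (intro mult_mono assms norm_mob_le Suc) auto
  thus ?case by simp
qed (use assms in auto)

lemma orb_add: "orb \<xi> (m + n) c = orb (\<lambda>k. \<xi> (m + k)) n (orb \<xi> m c)"
  by (induction n) simp_all

lemma logsum_add: "logsum \<xi> (m + n) c = logsum \<xi> m c + logsum (\<lambda>k. \<xi> (m + k)) n (orb \<xi> m c)"
  by (induction n) (simp_all add: logsum_def orb_add)

text \<open>All orbit points vanish at \<open>z = 0\<close>, and \<open>1 - r c\<close> stays in the right half-plane, so the sum is
  the real part of a holomorphic function vanishing at the centre.\<close>

lemma logsum_mean_value: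
  assumes \<xi>: "\<And>k. norm (\<xi> k) \<le> 1" and \<kappa>: "norm \<kappa> \<le> 1"
  shows "((\<lambda>t. logsum (\<lambda>k. circ t * \<xi> k) n (circ t * \<kappa>)) has_integral 0) {0..1}"
proof -
  define Z where "Z k z = orb (\<lambda>k. z * \<xi> k) k (z * \<kappa>)" for k z
  have Z1: "norm (Z k z) \<le> 1" if "norm z \<le> 1" for k z
    unfolding Z_def
    by (rule norm_orb_le) (use that \<xi> \<kappa> in \<open>auto simp: norm_mult intro!: mult_le_one\<close>)
  have Z_hol: "Z k holomorphic_on ball 0 1" for k
  proof (induction k)
    case 0 show ?case unfolding Z_def[abs_def] by (auto intro!: holomorphic_intros)
  next
    case (Suc k)
    have "(\<lambda>z. z * \<xi> k * ((Z k z - of_real r) / (1 - of_real r * Z k z))) holomorphic_on ball 0 1"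
      by (intro holomorphic_intros Suc) (use one_minus_nz Z1 in \<open>auto simp: less_imp_le\<close>)
    thus ?case by (simp add: Z_def[abs_def] mob_def)
  qed
  have Z_cont: "continuous_on (cball 0 1) (Z k)" for k
  proof (induction k)
    case 0 show ?case unfolding Z_def[abs_def] by (auto intro!: continuous_intros)
  next
    case (Suc k)
    have "continuous_on (cball 0 1) (\<lambda>z. z * \<xi> k * ((Z k z - of_real r) / (1 - of_real r * Z k z)))"
      by (intro continuous_intros Suc) (use one_minus_nz Z1 in auto)
    thus ?case by (simp add: Z_def[abs_def] mob_def)
  qed
  have Z0: "Z k 0 = 0" for k by (cases k) (simp_all add: Z_def)
  have Re_pos: "Re (1 - of_real r * Z k z) > 0" if "norm z \<le> 1" for k z
  proof -
    have "Re (Z k z) \<le> 1" using complex_Re_le_cmod[of "Z k z"] Z1[OF that, of k] by linarith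
    hence "r * Re (Z k z) \<le> r * 1" using r0 by (intro mult_left_mono) auto
    thus ?thesis using r1 by simp
  qed
  have nn: "1 - of_real r * Z k z \<notin> \<real>\<^sub>\<le>\<^sub>0" if "norm z \<le> 1" for k z
    using Re_pos[OF that, of k] by (auto simp: complex_nonpos_Reals_iff)
  define h where "h z = (\<Sum>k<n. Ln (1 - of_real r * Z k z))" for z
  have "h holomorphic_on ball 0 1" unfolding h_def[abs_def]
    by (intro holomorphic_intros Z_hol nn) auto
  moreover have "continuous_on (cball 0 1) h" unfolding h_def[abs_def]
    by (intro continuous_intros Z_cont nn) auto
  ultimately have "((\<lambda>u. h u / (u - 0)) has_contour_integral (2 * of_real pi * \<i> * h 0)) (circlepath 0 1)"
    by (intro Cauchy_integral_circlepath) auto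
  hence "((\<lambda>u. h u / u) has_contour_integral 0) (circlepath 0 1)"
    by (simp add: h_def Z0)
  hence "((\<lambda>t. h (circlepath 0 1 t) / circlepath 0 1 t * vector_derivative (circlepath 0 1) (at t within {0..1})) has_integral 0) {0..1}"
    unfolding has_contour_integral_def .
  hence "((\<lambda>t. h (circ t) * (2 * of_real pi * \<i>)) has_integral 0) {0..1}"
  proof (rule has_integral_eq[rotated])
    fix t :: real assume t: "t \<in> {0..1}"
    have "circlepath 0 1 t = circ t"
      by (simp add: circlepath cis_conv_exp mult_ac)
    moreover have "vector_derivative (circlepath 0 1) (at t within {0..1}) = 2 * of_real pi * \<i> * circ t"
      using vector_derivative_circlepath01[of t 0 1] t by (simp add: cis_conv_exp mult_ac)
    ultimately show "h (circlepath 0 1 t) / circlepath 0 1 t * vector_derivative (circlepath 0 1) (at t within {0..1})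
        = h (circ t) * (2 * of_real pi * \<i>)" by simp
  qed
  hence "((\<lambda>t. h (circ t) * (2 * of_real pi * \<i>) * inverse (2 * of_real pi * \<i>)) has_integral 0 * inverse (2 * of_real pi * \<i>)) {0..1}"
    by (rule has_integral_mult_left)
  hence "((\<lambda>t. h (circ t)) has_integral 0) {0..1}" by (simp add: field_simps)
  hence "((\<lambda>t. Re (h (circ t))) has_integral Re 0) {0..1}" by (rule has_integral_Re)
  moreover have "Re (h (circ t)) = logsum (\<lambda>k. circ t * \<xi> k) n (circ t * \<kappa>)" for t
    unfolding h_def logsum_def Re_sum
  proof (intro sum.cong refl)
    fix k
    have "1 - of_real r * Z k (circ t) \<noteq> 0" by (intro one_minus_nz Z1) simp
    thus "Re (Ln (1 - of_real r * Z k (circ t))) = ln (norm (1 - of_real r * orb (\<lambda>k. circ t * \<xi> k) k (circ t * \<kappa>)))"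
      by (simp add: Z_def)
  qed
  ultimately show ?thesis by simp
qed

text \<open>In homogeneous coordinates the maps are linear: the product of denominators and its
  multiple by the orbit point are the two entries of a matrix product applied to the vector with
  entries 1 and \<open>c\<close>.\<close>

lemma orb_linear:
  assumes "\<And>k. norm (\<xi> k) \<le> 1"
  shows "\<exists>A B A' B'. \<forall>c. norm c \<le> 1 \<longrightarrow>
     (\<Prod>k<n. 1 - of_real r * orb \<xi> k c) = A + B * c \<and>
     orb \<xi> n c * (\<Prod>k<n. 1 - of_real r * orb \<xi> k c) = A' + B' * c"
proof (induction n)
  case 0
  show ?case by (rule exI[of _ 1], rule exI[of _ 0], rule exI[of _ 0], rule exI[of _ 1]) simp
next
  case (Suc n)
  then obtain A B A' B' where IH: "\<And>c. norm c \<le> 1 \<Longrightarrow> (\<Prod>k<n. 1 - of_real r * orb \<xi> k c) = A + B * c"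
     "\<And>c. norm c \<le> 1 \<Longrightarrow> orb \<xi> n c * (\<Prod>k<n. 1 - of_real r * orb \<xi> k c) = A' + B' * c" by blast
  have "(\<Prod>k<Suc n. 1 - of_real r * orb \<xi> k c) = (A - of_real r * A') + (B - of_real r * B') * c \<and>
     orb \<xi> (Suc n) c * (\<Prod>k<Suc n. 1 - of_real r * orb \<xi> k c)
       = \<xi> n * (A' - of_real r * A) + \<xi> n * (B' - of_real r * B) * c" if c: "norm c \<le> 1" for c
  proof -
    define Q where "Q = (\<Prod>k<n. 1 - of_real r * orb \<xi> k c)"
    define w where "w = orb \<xi> n c"
    have nz: "1 - of_real r * w \<noteq> 0" unfolding w_def
      by (rule one_minus_nz norm_orb_le c assms)+
    have Q: "Q = A + B * c" "w * Q = A' + B' * c" using IH[OF c] by (simp_all add: Q_def w_def)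
    have "(\<Prod>k<Suc n. 1 - of_real r * orb \<xi> k c) = Q - of_real r * (w * Q)"
      by (simp add: Q_def w_def algebra_simps)
    moreover have "orb \<xi> (Suc n) c * (\<Prod>k<Suc n. 1 - of_real r * orb \<xi> k c)
       = \<xi> n * (mob w * (1 - of_real r * w)) * Q" by (simp add: Q_def w_def mult_ac)
    moreover have "mob w * (1 - of_real r * w) = w - of_real r" using nz by (simp add: mob_def)
    moreover have "\<xi> n * (w - of_real r) * Q = \<xi> n * (w * Q - of_real r * Q)" by (simp add: algebra_simps)
    moreover have "Q - of_real r * (w * Q) = (A - of_real r * A') + (B - of_real r * B') * c"
      unfolding Q(2) unfolding Q(1) by (simp add: algebra_simps)
    moreover have "\<xi> n * (w * Q - of_real r * Q) = \<xi> n * (A' - of_real r * A) + \<xi> n * (B' - of_real r * B) * c"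
      unfolding Q(2) unfolding Q(1) by (simp add: algebra_simps)
    ultimately show ?thesis by simp
  qed
  thus ?case by blast
qed

text \<open>The product is \<open>A + B c\<close> without zeros in the unit disc, whence \<open>\<bar>B\<bar> \<le> \<bar>A\<bar>\<close>.\<close>

lemma logsum_le_center:
  assumes \<xi>: "\<And>k. norm (\<xi> k) \<le> 1" and c: "norm c \<le> 1"
  shows "logsum \<xi> n c \<le> logsum \<xi> n 0 + ln 2"
proof -
  define Q where "Q c = (\<Prod>k<n. 1 - of_real r * orb \<xi> k c)" for c
  have no: "norm (orb \<xi> k c) \<le> 1" if "norm c \<le> 1" for k c
    by (rule norm_orb_le) (use that \<xi> in auto)
  have Q0: "Q c \<noteq> 0" if "norm c \<le> 1" for c
    unfolding Q_def prod_zero_iff[OF finite_lessThan]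
    using one_minus_nz[OF no[OF that]] by blast
  have ls: "logsum \<xi> n c = ln (norm (Q c))" if "norm c \<le> 1" for c
    unfolding logsum_def Q_def prod_norm[symmetric]
    using norm_one_minus_pos[OF no[OF that]] by (subst ln_prod) auto
  obtain A B where AB: "\<And>c. norm c \<le> 1 \<Longrightarrow> Q c = A + B * c"
    using orb_linear[of \<xi> n] \<xi> unfolding Q_def by blast
  have BA: "norm B \<le> norm A"
  proof (rule ccontr)
    assume *: "\<not> ?thesis"
    hence "B \<noteq> 0" by auto
    moreover have "norm (- A / B) \<le> 1" using * by (simp add: norm_divide divide_le_eq_1)
    ultimately show False using Q0[of "- A / B"] AB[of "- A / B"] by simp
  qed
  have "norm (Q c) \<le> norm A + norm (B * c)" unfolding AB[OF c] by (rule norm_triangle_ineq)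
  also have "norm (B * c) \<le> norm A * 1" unfolding norm_mult by (intro mult_mono BA c) auto
  also have "norm A + norm A * 1 = 2 * norm (Q 0)" by (simp add: AB)
  finally have "ln (norm (Q c)) \<le> ln (2 * norm (Q 0))" using Q0[OF c] by (intro ln_mono) auto
  also have "\<dots> = ln (norm (Q 0)) + ln 2" using Q0[of 0] by (simp add: ln_mult)
  finally show ?thesis using ls[OF c] ls[of 0] by simp
qed

lemma logsum_upper:
  assumes \<xi>: "\<And>k. norm (\<xi> k) \<le> 1" and c: "norm c \<le> 1"
  shows "logsum \<xi> n c \<le> real n * ln 2"
proof -
  have "logsum \<xi> n c \<le> (\<Sum>k<n. ln 2)" unfolding logsum_def
  proof (intro sum_mono ln_mono)
    fix k
    have "norm (orb \<xi> k c) \<le> 1" by (rule norm_orb_le) (use c \<xi> in auto)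
    from norm_1_minus_upper[OF this] norm_one_minus_pos[OF this] r1
    show "norm (1 - of_real r * orb \<xi> k c) \<le> 2" "0 < norm (1 - of_real r * orb \<xi> k c)" by auto
  qed
  thus ?thesis by simp
qed

section \<open>Uniform upper bound along rotation orbits\<close>

definition rot :: "real \<Rightarrow> real \<Rightarrow> nat \<Rightarrow> complex" where
  "rot \<Omega> y k = circ (y + real k * \<Omega>)"

lemma norm_rot [simp]: "norm (rot \<Omega> y k) = 1" by (simp add: rot_def)

lemma rot_add: "rot \<Omega> y (m + k) = rot \<Omega> (y + real m * \<Omega>) k"
  by (simp add: rot_def algebra_simps)

lemma rot_split: "rot \<Omega> (y + t) k = circ t * rot \<Omega> y k"
  unfolding rot_def cis_mult by (simp add: algebra_simps)

lemma continuous_rot: "continuous_on UNIV (\<lambda>y. rot \<Omega> y k)"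
  unfolding rot_def by (intro continuous_intros)

lemma continuous_logsum:
  "continuous_on UNIV (\<lambda>y. logsum (rot \<Omega> y) n 0)"
proof -
  have o: "continuous_on UNIV (\<lambda>y. orb (rot \<Omega> y) k 0)" for k
  proof (induction k)
    case (Suc k)
    have "continuous_on UNIV (\<lambda>y. rot \<Omega> y k * ((orb (rot \<Omega> y) k 0 - of_real r) / (1 - of_real r * orb (rot \<Omega> y) k 0)))"
      by (intro continuous_intros Suc continuous_rot) (use one_minus_nz norm_orb_le in auto)
    thus ?case by (simp add: mob_def)
  qed simp
  show ?thesis unfolding logsum_def
    by (intro continuous_intros o) (use one_minus_nz norm_orb_le in auto)
qed

text \<open>The orbit is cut into blocks of a fixed length \<open>m\<close>. In each block the
  unknown starting point is replaced by 0 at the cost \<open>ln 2\<close>; what remains is a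
  continuous function of mean zero, summed along the rotation by
  \<open>m * \<Omega>\<close>.\<close>

theorem logsum_uniform_upper_bound:
  assumes dio: "diophantine \<Omega>" and eps: "\<epsilon> > 0"
  obtains C where "\<And>n y c. norm c \<le> 1 \<Longrightarrow> logsum (rot \<Omega> y) n c \<le> \<epsilon> * real n + C"
proof -
  \<comment> \<open>Long enough that the cost \<open>ln 2\<close> per block is at most
    \<open>\<epsilon> / 2\<close> per step; the other half of \<open>\<epsilon>\<close> goes to the
    rotation sum.\<close>
  define m where "m = Suc (nat \<lceil>2 * ln 2 / \<epsilon>\<rceil>)"
  have "2 * ln 2 / \<epsilon> \<le> real m" unfolding m_def by linarith
  hence m: "ln 2 \<le> \<epsilon> / 2 * real m" using eps by (simp add: field_simps)
  have m1: "m \<ge> 1" by (simp add: m_def)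
  define u where "u y = logsum (rot \<Omega> y) m 0" for y
  have "continuous_on UNIV u" unfolding u_def by (rule continuous_logsum)
  moreover have "u (x + 1) = u x" for x
  proof -
    have "rot \<Omega> (x + 1) = rot \<Omega> x" by (rule ext) (simp add: rot_split)
    thus ?thesis by (simp only: u_def)
  qed
  moreover have "((\<lambda>t. u (a + t)) has_integral 0) {0..1}" for a
    using logsum_mean_value[of "rot \<Omega> a" 0 m] by (simp add: u_def rot_split[abs_def])
  moreover have "diophantine (real m * \<Omega>)" by (rule diophantine_mult[OF dio m1])
  moreover have "\<epsilon> / 2 * real m > 0" using eps m1 by simp
  ultimately have "\<exists>C. \<forall>k x. (\<Sum>i<k. u (x + real i * (real m * \<Omega>))) \<le> \<epsilon> / 2 * real m * real k + C"
    by (rule rotation_sum_upper_bound)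
  then obtain C where C: "\<And>k x. (\<Sum>i<k. u (x + real i * (real m * \<Omega>))) \<le> \<epsilon> / 2 * real m * real k + C"
    by blast
  have blocks: "logsum (rot \<Omega> y) (k * m) c \<le> (\<Sum>i<k. u (y + real i * (real m * \<Omega>))) + real k * ln 2"
    if c: "norm c \<le> 1" for k y c
  proof (induction k)
    case (Suc k)
    have "logsum (rot \<Omega> y) (Suc k * m) c = logsum (rot \<Omega> y) (k * m + m) c" by (simp add: add.commute)
    also have "\<dots> = logsum (rot \<Omega> y) (k * m) c
        + logsum (rot \<Omega> (y + real (k * m) * \<Omega>)) m (orb (rot \<Omega> y) (k * m) c)"
      unfolding logsum_add rot_add by simp
    also have "logsum (rot \<Omega> (y + real (k * m) * \<Omega>)) m (orb (rot \<Omega> y) (k * m) c)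
        \<le> u (y + real (k * m) * \<Omega>) + ln 2"
      unfolding u_def by (rule logsum_le_center) (use norm_orb_le c in auto)
    finally show ?case using Suc by (simp add: algebra_simps)
  qed (simp add: logsum_def)
  have "logsum (rot \<Omega> y) n c \<le> \<epsilon> * real n + (C + real m * ln 2)" if c: "norm c \<le> 1" for n y c
  proof -
    define k where "k = n div m"
    define q where "q = n mod m"
    have n: "n = k * m + q" by (simp add: k_def q_def)
    have q: "q \<le> m" using m1 by (simp add: q_def less_imp_le)
    have "logsum (rot \<Omega> y) n c = logsum (rot \<Omega> y) (k * m) c
        + logsum (rot \<Omega> (y + real (k * m) * \<Omega>)) q (orb (rot \<Omega> y) (k * m) c)"
      unfolding n logsum_add rot_add by simp
    also have "logsum (rot \<Omega> (y + real (k * m) * \<Omega>)) q (orb (rot \<Omega> y) (k * m) c) \<le> real q * ln 2"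
      by (rule logsum_upper) (use norm_orb_le c in auto)
    also have "\<dots> \<le> real m * ln 2" using q by (intro mult_right_mono) auto
    also have "logsum (rot \<Omega> y) (k * m) c \<le> (\<epsilon> / 2 * real m * real k + C) + real k * ln 2"
      using blocks[OF c, of y k] C[of y k] by linarith
    also have "real k * ln 2 \<le> real k * (\<epsilon> / 2 * real m)" using m by (intro mult_left_mono) auto
    finally have "logsum (rot \<Omega> y) n c \<le> \<epsilon> * real (k * m) + C + real m * ln 2" by simp
    also have "\<epsilon> * real (k * m) \<le> \<epsilon> * real n" using eps by (intro mult_left_mono) (auto simp: n)
    finally show ?thesis by simp
  qed
  thus ?thesis by (rule that)
qed

end

section \<open>Existence of resonant blocks\<close>

text \<open>On a cell of length \<open>1 / M\<close> the function \<open>u\<close> exceeds its cell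
  average by at most the growth of \<open>V\<close> there, and each cell holds at most
  \<open>B\<close> points. As \<open>u\<close> is nonnegative, an upper bound on the counts is
  enough and no exact equidistribution is asked for.\<close>

lemma koksma_upper:
  fixes u V :: "real \<Rightarrow> real" and M :: nat
  assumes int: "((\<lambda>t. u (a + t)) has_integral I) {0..1}"
    and osc: "\<And>y y'. y \<le> y' \<Longrightarrow> \<bar>u y - u y'\<bar> \<le> V y' - V y"
    and pos: "\<And>y. u y \<ge> 0"
    and Y: "finite Y" "Y \<subseteq> {a..<a+1}" and M: "M \<ge> 1"
    and card: "\<And>b. real (card (Y \<inter> {b..<b + 1 / real M})) \<le> B"
  shows "(\<Sum>y\<in>Y. u y) \<le> B * (real M * I + (V (a + 1) - V a))"
proof -
  define e where "e i = real i / real M" for i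
  define J where "J i = integral {e i..e (Suc i)} (\<lambda>t. u (a + t))" for i
  define W where "W i = V (a + e (Suc i)) - V (a + e i)" for i
  define A where "A i = Y \<inter> {a + e i..<a + e i + 1 / real M}" for i
  have e: "e i \<le> e (Suc i)" "e (Suc i) = e i + 1 / real M" for i
    by (simp_all add: e_def divide_right_mono add_divide_distrib)
  have e0: "e 0 = 0" "e M = 1" "0 \<le> e i" for i using M by (simp_all add: e_def)
  have e1: "e i \<le> 1" if "i \<le> M" for i using that M by (simp add: e_def)
  have intb: "(\<lambda>t. u (a + t)) integrable_on {x..y}" if "0 \<le> x" "y \<le> 1" for x y
    using integrable_on_subinterval[of "\<lambda>t. u (a + t)" "{0..1}" x y] int that by auto
  have sumJ: "(\<Sum>i<n. J i) = integral {0..e n} (\<lambda>t. u (a + t))" if "n \<le> M" for n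
    using that
  proof (induction n)
    case (Suc n)
    have "integral {0..e n} (\<lambda>t. u (a + t)) + integral {e n..e (Suc n)} (\<lambda>t. u (a + t))
        = integral {0..e (Suc n)} (\<lambda>t. u (a + t))"
      by (rule Henstock_Kurzweil_Integration.integral_combine) (use e e0 e1[of "Suc n"] intb Suc.prems in auto)
    thus ?case using Suc by (simp add: J_def)
  qed (simp add: e0)
  have sumJ: "(\<Sum>i<M. J i) = I" using sumJ[of M] int by (simp add: e0 integral_unique)
  have sumW: "(\<Sum>i<M. W i) = V (a + 1) - V a"
    unfolding W_def using sum_lessThan_telescope[of "\<lambda>i. V (a + e i)" M] by (simp add: e0)
  have W0: "W i \<ge> 0" for i using osc[of "a + e i" "a + e (Suc i)"] e[of i] unfolding W_def by linarith
  have J0: "J i \<ge> 0" if "i < M" for i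
    unfolding J_def by (intro integral_nonneg intb pos) (use e0 e1[of "Suc i"] that in auto)
  have ub: "u y \<le> real M * J i + W i" if i: "i < M" and y: "y \<in> A i" for i y
  proof -
    have yb: "a + e i \<le> y" "y \<le> a + e (Suc i)" using y by (auto simp: A_def e(2))
    have "((\<lambda>t::real. u y - W i) has_integral (e (Suc i) - e i) * (u y - W i)) {e i..e (Suc i)}"
      using has_integral_const_real[of "u y - W i" "e i" "e (Suc i)"] e by simp
    moreover have "((\<lambda>t. u (a + t)) has_integral J i) {e i..e (Suc i)}"
      unfolding J_def by (intro integrable_integral intb) (use e0 e1[of "Suc i"] i in auto)
    \<comment> \<open>The three uses of \<open>osc\<close> split the cell at \<open>y\<close> and
      \<open>a + t\<close>; on the outer pieces they only say that \<open>V\<close> does not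
      decrease.\<close>
    moreover have "u y - W i \<le> u (a + t)" if t: "t \<in> {e i..e (Suc i)}" for t
    proof (cases "y \<le> a + t")
      case True
      have "\<bar>u (a + e i) - u y\<bar> \<le> V y - V (a + e i)" using osc yb by blast
      moreover have "\<bar>u y - u (a + t)\<bar> \<le> V (a + t) - V y" using osc[OF True] .
      moreover have "\<bar>u (a + t) - u (a + e (Suc i))\<bar> \<le> V (a + e (Suc i)) - V (a + t)" using t by (intro osc) auto
      ultimately show ?thesis unfolding W_def by linarith
    next
      case False
      hence "\<bar>u (a + t) - u y\<bar> \<le> V y - V (a + t)" by (intro osc) auto
      moreover have "\<bar>u (a + e i) - u (a + t)\<bar> \<le> V (a + t) - V (a + e i)" using t by (intro osc) auto
      moreover have "\<bar>u y - u (a + e (Suc i))\<bar> \<le> V (a + e (Suc i)) - V y" using yb by (intro osc) auto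
      ultimately show ?thesis unfolding W_def by linarith
    qed
    ultimately have "(e (Suc i) - e i) * (u y - W i) \<le> J i"
      using has_integral_le[where f = "\<lambda>t. u y - W i" and g = "\<lambda>t. u (a + t)"] by blast
    hence "(u y - W i) / real M \<le> J i" by (simp add: e(2))
    thus ?thesis using M by (simp add: field_simps)
  qed
  have cover: "Y \<subseteq> (\<Union>i<M. A i)"
  proof
    fix y assume y: "y \<in> Y"
    define i where "i = nat \<lfloor>real M * (y - a)\<rfloor>"
    have "0 \<le> y - a" "y - a < 1" using y Y by auto
    hence nn: "0 \<le> real M * (y - a)" "real M * (y - a) < real M * 1"
      using M by (auto intro!: mult_strict_left_mono)
    hence i: "real i \<le> real M * (y - a)" "real M * (y - a) < real i + 1"
      unfolding i_def by linarith+
    hence "i < M" using nn by linarith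
    moreover have "e i \<le> y - a" "y - a < e i + 1 / real M"
      using i M by (auto simp: e_def field_simps)
    ultimately have "i < M" "y \<in> A i" using y by (auto simp: A_def)
    thus "y \<in> (\<Union>i<M. A i)" by blast
  qed
  have finA: "finite (A i)" for i using Y by (simp add: A_def)
  have "(\<Sum>y\<in>Y. u y) \<le> (\<Sum>y\<in>(\<Union>i<M. A i). u y)"
    by (intro sum_mono2 cover) (use finA pos in auto)
  also have "\<dots> \<le> (\<Sum>i<M. \<Sum>y\<in>A i. u y)"
  proof -
    have "(\<Sum>y\<in>(\<Union>i<n. A i). u y) \<le> (\<Sum>i<n. \<Sum>y\<in>A i. u y)" for n
    proof (induction n)
      case (Suc n)
      have "(\<Sum>y\<in>(\<Union>i<Suc n. A i). u y) = (\<Sum>y\<in>A n. u y) + (\<Sum>y\<in>(\<Union>i<n. A i). u y)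
          - (\<Sum>y\<in>A n \<inter> (\<Union>i<n. A i). u y)"
        unfolding lessThan_Suc UN_insert using finA by (intro sum_Un) auto
      moreover have "(\<Sum>y\<in>A n \<inter> (\<Union>i<n. A i). u y) \<ge> 0" by (intro sum_nonneg pos)
      ultimately show ?case using Suc by simp
    qed simp
    thus ?thesis .
  qed
  also have "\<dots> \<le> (\<Sum>i<M. B * (real M * J i + W i))"
  proof (intro sum_mono)
    fix i assume i: "i \<in> {..<M}"
    have "(\<Sum>y\<in>A i. u y) \<le> (\<Sum>y\<in>A i. real M * J i + W i)"
      by (intro sum_mono ub) (use i in auto)
    also have "\<dots> = real (card (A i)) * (real M * J i + W i)" by simp
    also have "\<dots> \<le> B * (real M * J i + W i)"
      unfolding A_def using W0 J0[of i] i by (intro mult_right_mono card) auto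
    finally show "(\<Sum>y\<in>A i. u y) \<le> B * (real M * J i + W i)" .
  qed
  also have "\<dots> = B * (real M * I + (V (a + 1) - V a))"
    unfolding sum_distrib_left[symmetric] sum.distrib sumJ sumW ..
  finally show ?thesis .
qed

lemma card_nat_interval:
  assumes "\<alpha> \<le> \<beta>"
  shows "finite {i::nat. \<alpha> \<le> real i \<and> real i < \<beta>}"
    and "real (card {i::nat. \<alpha> \<le> real i \<and> real i < \<beta>}) \<le> \<beta> - \<alpha> + 1"
proof -
  have sub: "int ` {i::nat. \<alpha> \<le> real i \<and> real i < \<beta>} \<subseteq> {\<lceil>\<alpha>\<rceil>..<\<lceil>\<beta>\<rceil>}"
    by (auto simp: ceiling_le_iff less_ceiling_iff)
  have "finite (int ` {i::nat. \<alpha> \<le> real i \<and> real i < \<beta>})" by (rule finite_subset[OF sub]) simp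
  thus "finite {i::nat. \<alpha> \<le> real i \<and> real i < \<beta>}" by (rule finite_imageD) auto
  have "card {i::nat. \<alpha> \<le> real i \<and> real i < \<beta>} = card (int ` {i::nat. \<alpha> \<le> real i \<and> real i < \<beta>})"
    by (subst card_image) auto
  also have "\<dots> \<le> nat (\<lceil>\<beta>\<rceil> - \<lceil>\<alpha>\<rceil>)" using card_mono[OF _ sub] by simp
  finally have "real (card {i::nat. \<alpha> \<le> real i \<and> real i < \<beta>}) \<le> real (nat (\<lceil>\<beta>\<rceil> - \<lceil>\<alpha>\<rceil>))" by simp
  also have "\<dots> \<le> \<beta> - \<alpha> + 1" using assms by (simp add: of_nat_nat ceiling_mono) linarith
  finally show "real (card {i::nat. \<alpha> \<le> real i \<and> real i < \<beta>}) \<le> \<beta> - \<alpha> + 1" .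
qed

section \<open>Contraction at most parameters\<close>

context moebius_rotation
begin

text \<open>\<open>gam\<close> is twice the Lyapunov exponent.\<close>

definition gam :: real where "gam = - ln (1 - r\<^sup>2)"

lemma gam_pos: "gam > 0"
  using one_minus_r_sq_pos r0 by (simp add: gam_def)

lemma orb_rot: "orb (rot \<Omega> y) n (circ c) = circ (phase \<Omega> n y c)"
proof (induction n)
  case (Suc n)
  have "circ (y + real n * \<Omega> + lift (phase \<Omega> n y c)) = circ (y + real n * \<Omega>) * circ (lift (phase \<Omega> n y c))"
    by (simp only: cis_mult distrib_left)
  thus ?case unfolding orb.simps phase.simps Suc by (simp only: rot_def circ_lift)
qed simp

lemma ln_dphase: "ln (dphase \<Omega> n y c) = - (2 * logsum (rot \<Omega> y) n (circ c) + real n * gam)"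
proof (induction n)
  case (Suc n)
  define N where "N = norm (1 - of_real r * circ (phase \<Omega> n y c))"
  have N: "N > 0" unfolding N_def by (rule norm_one_minus_pos) simp
  have "ln (dphase \<Omega> (Suc n) y c) = ln (speed (phase \<Omega> n y c)) + ln (dphase \<Omega> n y c)"
    unfolding dphase_Suc using speed_pos[of "phase \<Omega> n y c"] dphase_pos[of \<Omega> n y c] by (simp add: ln_mult)
  also have "ln (speed (phase \<Omega> n y c)) = - gam - 2 * ln N"
    unfolding speed_def N_def[symmetric] gam_def using N one_minus_r_sq_pos
    by (simp add: ln_div ln_realpow)
  also have "ln N = ln (norm (1 - of_real r * orb (rot \<Omega> y) n (circ c)))" by (simp only: orb_rot N_def)
  finally show ?case unfolding Suc logsum_def by (simp add: algebra_simps)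
qed (simp add: logsum_def)

lemma ln_norm_lipschitz:
  "\<bar>ln (norm (1 - of_real r * circ s)) - ln (norm (1 - of_real r * circ t))\<bar> \<le> 2 * pi / (1 - r) * \<bar>s - t\<bar>"
proof -
  have *: "ln (norm (1 - of_real r * circ s)) - ln (norm (1 - of_real r * circ t)) \<le> 2 * pi / (1 - r) * \<bar>s - t\<bar>" for s t
  proof -
    define a b where "a = norm (1 - of_real r * circ s)" and "b = norm (1 - of_real r * circ t)"
    have ab: "a > 0" "b > 0" "b \<ge> 1 - r" unfolding a_def b_def
      by (intro norm_one_minus_pos norm_1_minus_lower; simp)+
    have "(norm (circ s - circ t))\<^sup>2 \<le> 4 * (pi * (s - t))\<^sup>2" unfolding norm_circ_diff
      using abs_sin_x_le_abs_x[of "pi * (s - t)"] by (simp add: abs_le_square_iff)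
    also have "\<dots> = (2 * pi * \<bar>s - t\<bar>)\<^sup>2" by (simp add: power_mult_distrib)
    finally have "norm (circ s - circ t) \<le> 2 * pi * \<bar>s - t\<bar>" by (rule power2_le_imp_le) simp
    moreover have "a - b \<le> norm (circ s - circ t)"
    proof -
      have "a - b \<le> norm ((1 - of_real r * circ s) - (1 - of_real r * circ t))"
        unfolding a_def b_def by (rule norm_triangle_ineq2)
      also have "(1 - of_real r * circ s) - (1 - of_real r * circ t) = of_real r * (circ t - circ s)"
        by (simp add: algebra_simps)
      also have "norm \<dots> \<le> 1 * norm (circ t - circ s)" unfolding norm_mult
        using r0 r1 by (intro mult_right_mono) auto
      finally show ?thesis by (simp add: norm_minus_commute)
    qed
    ultimately have d: "a - b \<le> 2 * pi * \<bar>s - t\<bar>" by linarith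
    have "ln a - ln b = ln (a / b)" using ab by (simp add: ln_div)
    also have "\<dots> \<le> a / b - 1" using ab by (intro ln_le_minus_one) auto
    also have "\<dots> = (a - b) / b" using ab by (simp add: diff_divide_distrib)
    also have "\<dots> \<le> (2 * pi * \<bar>s - t\<bar>) / b" using d ab by (intro divide_right_mono) auto
    also have "\<dots> \<le> (2 * pi * \<bar>s - t\<bar>) / (1 - r)" using ab r1 by (intro divide_left_mono) auto
    finally show ?thesis by (simp add: a_def b_def)
  qed
  from *[of s t] *[of t s] show ?thesis by (simp add: abs_le_iff abs_minus_commute)
qed

text \<open>Each summand is a Lipschitz function of a phase, and all phases increase with both
  arguments. The total advance of the phases is therefore a monotone majorant of the oscillation, as
  \<open>koksma_upper\<close> requires.\<close>

lemma logsum_osc: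
  assumes "y \<le> y'" "c \<le> c'"
  shows "\<bar>logsum (rot \<Omega> y) n (circ c) - logsum (rot \<Omega> y') n (circ c')\<bar>
     \<le> 2 * pi / (1 - r) * (\<Sum>k<n. phase \<Omega> k y' c' - phase \<Omega> k y c)"
proof -
  have "\<bar>logsum (rot \<Omega> y) n (circ c) - logsum (rot \<Omega> y') n (circ c')\<bar>
     \<le> (\<Sum>k<n. \<bar>ln (norm (1 - of_real r * circ (phase \<Omega> k y c))) - ln (norm (1 - of_real r * circ (phase \<Omega> k y' c')))\<bar>)"
    unfolding logsum_def orb_rot sum_subtractf[symmetric] by (rule sum_abs)
  also have "\<dots> \<le> (\<Sum>k<n. 2 * pi / (1 - r) * (phase \<Omega> k y' c' - phase \<Omega> k y c))"
  proof (intro sum_mono)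
    fix k
    have "\<bar>phase \<Omega> k y c - phase \<Omega> k y' c'\<bar> = phase \<Omega> k y' c' - phase \<Omega> k y c"
      using phase_mono[OF assms, of \<Omega> k] by simp
    with ln_norm_lipschitz[of "phase \<Omega> k y c" "phase \<Omega> k y' c'"]
    show "\<bar>ln (norm (1 - of_real r * circ (phase \<Omega> k y c))) - ln (norm (1 - of_real r * circ (phase \<Omega> k y' c')))\<bar>
      \<le> 2 * pi / (1 - r) * (phase \<Omega> k y' c' - phase \<Omega> k y c)" by simp
  qed
  finally show ?thesis by (simp add: sum_distrib_left)
qed

lemma phase_add_one: "phase \<Omega> n (y + 1) (c + 1) = phase \<Omega> n y c + real n + 1"
  using phase_shift_int[of \<Omega> n y 1 "c + 1"] phase_add_int[of \<Omega> n y c 1] by simp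

text \<open>A Markov inequality: \<open>logsum\<close> has mean zero and a small uniform upper
  bound, so it cannot be very negative at many points of a well spread set. The offsets
  \<open>h\<close> and \<open>s\<close> are free so that the statement also covers reversed
  orbits.\<close>

lemma most_parameters_contract:
  assumes dio: "diophantine \<Omega>"
  obtains w0 :: nat where "\<And>w h s a M Y. w \<ge> w0 \<Longrightarrow> finite Y \<Longrightarrow> Y \<subseteq> {a..<a+1} \<Longrightarrow> M \<ge> w\<^sup>2 \<Longrightarrow>
     (\<And>b. real (card (Y \<inter> {b..<b + 1 / real M})) \<le> 8 * real (card Y) / real M) \<Longrightarrow>
     real (card {y\<in>Y. dphase \<Omega> w (y + h) (y + h + s) > exp (- (real w * gam / 2))}) \<le> 2 / 5 * real (card Y)"
proof -
  \<comment> \<open>The spread constant 8 times the two contributions \<open>w * gam / 160\<close>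
    gives \<open>w * gam / 10\<close>, which is \<open>2 / 5\<close> of the threshold
    \<open>w * gam / 4\<close>.\<close>
  define \<epsilon> where "\<epsilon> = gam / 160"
  have eps: "\<epsilon> > 0" using gam_pos by (simp add: \<epsilon>_def)
  obtain C where C: "\<And>n y c. norm c \<le> 1 \<Longrightarrow> logsum (rot \<Omega> y) n c \<le> \<epsilon> * real n + C"
    using logsum_uniform_upper_bound[OF dio eps] by blast
  define K where "K = 2 * pi / (1 - r)"
  have K0: "K \<ge> 0" using r1 by (simp add: K_def)
  define w0 where "w0 = Suc (nat \<lceil>160 * (C + K) / gam\<rceil>)"
  show thesis
  proof (rule that[of w0])
    fix w h s a M and Y :: "real set"
    assume w: "w \<ge> w0" and Y: "finite Y" "Y \<subseteq> {a..<a+1}" and M: "M \<ge> w\<^sup>2"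
      and card: "\<And>b. real (card (Y \<inter> {b..<b + 1 / real M})) \<le> 8 * real (card Y) / real M"
    have "160 * (C + K) / gam \<le> real w0" "1 \<le> w0" unfolding w0_def by linarith+
    with w have w160: "160 * (C + K) \<le> real w * gam" and w1: "w \<ge> 1"
      using gam_pos by (auto simp: pos_divide_le_eq) (smt (verit) mult_right_mono of_nat_mono)
    have M1: "M \<ge> 1" using M w1 by (metis one_le_power order_trans)
    define u where "u y = (\<epsilon> * real w + C) - logsum (rot \<Omega> (y + h)) w (circ (y + h + s))" for y
    define V where "V y = K * (\<Sum>k<w. phase \<Omega> k (y + h) (y + h + s))" for y
    have "((\<lambda>t. logsum (\<lambda>k. circ t * rot \<Omega> (a + h) k) w (circ t * circ (a + h + s))) has_integral 0) {0..1}"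
      by (rule logsum_mean_value) auto
    moreover have "circ t * rot \<Omega> (a + h) k = rot \<Omega> (a + t + h) k" for t k
      using rot_split[of \<Omega> "a + h" t k] by (simp add: algebra_simps)
    moreover have "circ t * circ (a + h + s) = circ (a + t + h + s)" for t
      by (simp add: cis_mult algebra_simps)
    ultimately have "((\<lambda>t. logsum (rot \<Omega> (a + t + h)) w (circ (a + t + h + s))) has_integral 0) {0..1}"
      by simp
    moreover have "((\<lambda>t::real. \<epsilon> * real w + C) has_integral \<epsilon> * real w + C) {0..1}"
      using has_integral_const_real[of "\<epsilon> * real w + C" 0 1] by simp
    ultimately have "((\<lambda>t. u (a + t)) has_integral (\<epsilon> * real w + C) - 0) {0..1}"
      unfolding u_def by (intro has_integral_diff)
    hence "((\<lambda>t. u (a + t)) has_integral (\<epsilon> * real w + C)) {0..1}" by simp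
    moreover have "\<bar>u y - u y'\<bar> \<le> V y' - V y" if "y \<le> y'" for y y'
    proof -
      have "\<bar>u y - u y'\<bar> = \<bar>logsum (rot \<Omega> (y + h)) w (circ (y + h + s)) - logsum (rot \<Omega> (y' + h)) w (circ (y' + h + s))\<bar>"
        by (simp add: u_def abs_minus_commute)
      also have "\<dots> \<le> K * (\<Sum>k<w. phase \<Omega> k (y' + h) (y' + h + s) - phase \<Omega> k (y + h) (y + h + s))"
        unfolding K_def by (rule logsum_osc) (use that in auto)
      finally show ?thesis by (simp add: V_def sum_subtractf right_diff_distrib)
    qed
    moreover have u0: "u y \<ge> 0" for y
      using C[of "circ (y + h + s)" "y + h" w] by (simp add: u_def)
    ultimately have "(\<Sum>y\<in>Y. u y) \<le> 8 * real (card Y) / real M * (real M * (\<epsilon> * real w + C) + (V (a + 1) - V a))"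
      by (rule koksma_upper[OF _ _ _ Y M1 card])
    \<comment> \<open>Over one period the phase of index \<open>k\<close> advances by
      \<open>k + 1\<close> turns, so the variation is quadratic in \<open>w\<close>; hence the
      requirement \<open>M \<ge> w\<^sup>2\<close>.\<close>
    also have "V (a + 1) - V a \<le> K * real M"
    proof -
      have "V (a + 1) - V a = K * (\<Sum>k<w. phase \<Omega> k ((a + h) + 1) ((a + h + s) + 1) - phase \<Omega> k (a + h) (a + h + s))"
        by (simp add: V_def sum_subtractf right_diff_distrib add_ac)
      also have "\<dots> = K * (\<Sum>k<w. real k + 1)" unfolding phase_add_one by simp
      also have "\<dots> \<le> K * (\<Sum>k<w. real w)" by (intro mult_left_mono sum_mono K0) auto
      also have "\<dots> = K * real (w\<^sup>2)" by (simp add: power2_eq_square)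
      also have "\<dots> \<le> K * real M" using M by (intro mult_left_mono K0) (simp only: of_nat_le_iff)
      finally show ?thesis .
    qed
    hence "8 * real (card Y) / real M * (real M * (\<epsilon> * real w + C) + (V (a + 1) - V a))
        \<le> 8 * real (card Y) / real M * (real M * (\<epsilon> * real w + C) + K * real M)"
      by (intro mult_left_mono add_left_mono) auto
    also have "\<dots> = 8 * real (card Y) * (\<epsilon> * real w + (C + K))" using M1 by (simp add: field_simps)
    also have "\<dots> \<le> 8 * real (card Y) * (real w * gam / 160 + real w * gam / 160)"
      using w160 by (intro mult_left_mono add_mono) (auto simp: \<epsilon>_def)
    also have "\<dots> = (real w * gam / 4) * (2 / 5 * real (card Y))" by simp
    finally have sum: "(\<Sum>y\<in>Y. u y) \<le> (real w * gam / 4) * (2 / 5 * real (card Y))" .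
    define Z where "Z = {y\<in>Y. dphase \<Omega> w (y + h) (y + h + s) > exp (- (real w * gam / 2))}"
    have Zu: "real w * gam / 4 \<le> u y" if "y \<in> Z" for y
    proof -
      have "exp (- (real w * gam / 2)) < dphase \<Omega> w (y + h) (y + h + s)" using that by (simp add: Z_def)
      hence "- (real w * gam / 2) < ln (dphase \<Omega> w (y + h) (y + h + s))"
        using dphase_pos[of \<Omega> w "y + h" "y + h + s"] by (metis exp_gt_zero ln_exp ln_less_cancel_iff)
      hence "logsum (rot \<Omega> (y + h)) w (circ (y + h + s)) < - (real w * gam / 4)" unfolding ln_dphase by simp
      moreover have "0 \<le> \<epsilon> * real w + C"
        using C[of 0 0 w] u0 has_integral_nonneg[OF \<open>((\<lambda>t. u (a + t)) has_integral (\<epsilon> * real w + C)) {0..1}\<close>] by blast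
      ultimately show ?thesis by (simp add: u_def)
    qed
    have "(real w * gam / 4) * real (card Z) = (\<Sum>y\<in>Z. real w * gam / 4)" by simp
    also have "\<dots> \<le> (\<Sum>y\<in>Z. u y)" by (intro sum_mono Zu)
    also have "\<dots> \<le> (\<Sum>y\<in>Y. u y)" by (rule sum_mono2) (use Y u0 in \<open>auto simp: Z_def\<close>)
    also note sum
    finally have "real (card Z) \<le> 2 / 5 * real (card Y)"
      using w1 gam_pos by (simp add: mult_le_cancel_left)
    thus "real (card {y\<in>Y. dphase \<Omega> w (y + h) (y + h + s) > exp (- (real w * gam / 2))}) \<le> 2 / 5 * real (card Y)"
      by (simp add: Z_def)
  qed
qed

lemma phase_degree: "\<bar>phase \<Omega> n y c' - phase \<Omega> n y c - (c' - c)\<bar> \<le> 1"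
proof -
  have *: "\<bar>phase \<Omega> n y c' - phase \<Omega> n y c - (c' - c)\<bar> \<le> 1" if "c \<le> c'" for c c'
  proof -
    define j where "j = \<lfloor>c' - c\<rfloor>"
    have j: "c + of_int j \<le> c'" "c' \<le> c + of_int (j + 1)" unfolding j_def by linarith+
    have "phase \<Omega> n y (c + of_int j) \<le> phase \<Omega> n y c'" "phase \<Omega> n y c' \<le> phase \<Omega> n y (c + of_int (j + 1))"
      by (intro phase_mono order_refl j)+
    hence "phase \<Omega> n y c + of_int j \<le> phase \<Omega> n y c'" "phase \<Omega> n y c' \<le> phase \<Omega> n y c + of_int (j + 1)"
      by (simp_all only: phase_add_int)
    thus ?thesis using j by simp
  qed
  show ?thesis using *[of c c'] *[of c' c] by (cases "c \<le> c'") (auto simp: abs_le_iff)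
qed

section \<open>The boundary value problem on a block\<close>

text \<open>Its integer values mark the solutions of the boundary value problem; it gains
  \<open>L + 1\<close> over one period.\<close>

definition diag :: "real \<Rightarrow> nat \<Rightarrow> real \<Rightarrow> real" where
  "diag \<Omega> L y = phase \<Omega> L y y"

lemma diag_rate: "y \<le> y' \<Longrightarrow> y' - y \<le> diag \<Omega> L y' - diag \<Omega> L y"
  unfolding diag_def by (rule phase_rate) auto

lemma diag_mono: "y \<le> y' \<Longrightarrow> diag \<Omega> L y \<le> diag \<Omega> L y'"
  using diag_rate[of y y' \<Omega> L] by linarith

lemma diag_less: "y < y' \<Longrightarrow> diag \<Omega> L y < diag \<Omega> L y'"
  using diag_rate[of y y' \<Omega> L] by linarith

lemma diag_less_imp: "diag \<Omega> L y < diag \<Omega> L y' \<Longrightarrow> y < y'"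
  using diag_mono[of y' y \<Omega> L] by (meson leD leI)

lemma diag_add_int: "diag \<Omega> L (y + of_int j) = diag \<Omega> L y + (real L + 1) * of_int j"
  unfolding diag_def phase_shift_int phase_add_int by (simp add: algebra_simps)

lemma continuous_phase:
  assumes "continuous_on UNIV f" "continuous_on UNIV g"
  shows "continuous_on UNIV (\<lambda>x. phase \<Omega> n (f x) (g x))"
proof (induction n)
  case (Suc n)
  have "continuous_on UNIV lift"
    by (intro continuous_at_imp_continuous_on ballI DERIV_isCont[OF lift_deriv])
  from continuous_on_compose2[OF this Suc]
  have "continuous_on UNIV (\<lambda>x. lift (phase \<Omega> n (f x) (g x)))" by simp
  thus ?case by (auto intro!: continuous_intros assms)
qed (use assms in simp)

lemma diag_surj: "\<exists>y. diag \<Omega> L y = v"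
proof -
  define j where "j = \<lfloor>v - diag \<Omega> L 0\<rfloor>"
  have j: "of_int j \<le> v - diag \<Omega> L 0" "v - diag \<Omega> L 0 \<le> of_int (j + 1)" unfolding j_def by linarith+
  have p: "x * y \<ge> y" if "x \<ge> 1" "y \<ge> 0" for x y :: real using mult_right_mono[of 1 x y] that by simp
  have "diag \<Omega> L (- \<bar>of_int j\<bar>) \<le> v"
    using diag_add_int[of \<Omega> L 0 "- \<bar>j\<bar>"] j(1) p[of "real L + 1" "\<bar>of_int j\<bar>"] by simp
  moreover have "v \<le> diag \<Omega> L (\<bar>of_int (j + 1)\<bar>)"
    using diag_add_int[of \<Omega> L 0 "\<bar>j + 1\<bar>"] j(2) p[of "real L + 1" "\<bar>of_int (j + 1)\<bar>"] by simp
  moreover have "continuous_on {- \<bar>of_int j\<bar>..\<bar>of_int (j + 1)\<bar>} (diag \<Omega> L)"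
    unfolding diag_def[abs_def]
    by (rule continuous_on_subset[OF continuous_phase]) auto
  ultimately show ?thesis using IVT'[of "diag \<Omega> L" "- \<bar>of_int j\<bar>" v "\<bar>of_int (j + 1)\<bar>"] by fastforce
qed

text \<open>The first \<open>L + 1\<close> steps are read in two ways, as one step followed by
  \<open>L\<close> and as \<open>L\<close> steps followed by one. Each \<open>lift\<close>
  contributes an error below \<open>1/2\<close>, and changing the initial value of a degree one map
  contributes at most 1.\<close>

lemma diag_rotate: "\<bar>diag \<Omega> L (y + \<Omega>) - diag \<Omega> L y - (real L + 1) * \<Omega>\<bar> \<le> 2"
proof -
  have "phase \<Omega> (1 + L) y y = phase \<Omega> L (y + \<Omega>) (y + lift y)" unfolding phase_add by simp
  moreover have "phase \<Omega> (1 + L) y y = y + real L * \<Omega> + lift (diag \<Omega> L y)" by (simp add: diag_def)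
  moreover have "\<bar>phase \<Omega> L (y + \<Omega>) (y + lift y) - diag \<Omega> L (y + \<Omega>) - (lift y - \<Omega>)\<bar> \<le> 1"
    using phase_degree[of \<Omega> L "y + \<Omega>" "y + lift y" "y + \<Omega>"] by (simp add: diag_def)
  moreover have "\<bar>lift y - y\<bar> < 1/2" "\<bar>lift (diag \<Omega> L y) - diag \<Omega> L y\<bar> < 1/2" by (rule lift_near)+
  moreover have "(real L + 1) * \<Omega> = real L * \<Omega> + \<Omega>" by (simp add: algebra_simps)
  ultimately show ?thesis by linarith
qed

lemma diag_increment_rotate:
  "diag \<Omega> L y' - diag \<Omega> L y \<le> diag \<Omega> L (y' + real k * \<Omega>) - diag \<Omega> L (y + real k * \<Omega>) + 4 * real k"
proof (induction k)
  case (Suc k)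
  have eqs: "z + real (Suc k) * \<Omega> = z + real k * \<Omega> + \<Omega>" "4 * real (Suc k) = 4 * real k + 4" for z
    by (simp_all add: algebra_simps)
  show ?case unfolding eqs
    using Suc diag_rotate[of \<Omega> L "y' + real k * \<Omega>"] diag_rotate[of \<Omega> L "y + real k * \<Omega>"]
    by linarith
qed simp

text \<open>The interval can be rotated, in at most \<open>Q\<close> steps, to within
  \<open>1 / M\<close> of every grid point. Its increment is thus at most that over the three cells
  around any grid point, plus \<open>4 * Q\<close>. Averaging over the \<open>M\<close> grid points
  counts every cell three times.\<close>

lemma diag_increment_le:
  assumes M: "M \<ge> (1::nat)"
    and cov: "\<And>x y. \<exists>k\<le>Q. \<exists>j::int. \<bar>y - x - real k * \<Omega> - of_int j\<bar> \<le> 1 / real M"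
  shows "diag \<Omega> L (a + 1 / real M) - diag \<Omega> L a \<le> 3 * (real L + 1) / real M + 4 * real Q"
proof -
  define D where "D = diag \<Omega> L (a + 1 / real M) - diag \<Omega> L a"
  define g where "g i = diag \<Omega> L ((real i - 1) / real M)" for i :: nat
  have "D \<le> (g (i + 3) - g i) + 4 * real Q" for i
  proof -
    define b where "b = real i / real M"
    obtain k j where k: "k \<le> Q" "\<bar>b - a - real k * \<Omega> - of_int j\<bar> \<le> 1 / real M" using cov by blast
    have "D \<le> diag \<Omega> L (a + 1 / real M + real k * \<Omega>) - diag \<Omega> L (a + real k * \<Omega>) + 4 * real k"
      unfolding D_def by (rule diag_increment_rotate)
    also have "\<dots> = diag \<Omega> L (a + 1 / real M + real k * \<Omega> + of_int j) - diag \<Omega> L (a + real k * \<Omega> + of_int j) + 4 * real k"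
      by (simp add: diag_add_int)
    finally have D: "D \<le> diag \<Omega> L (a + 1 / real M + real k * \<Omega> + of_int j) - diag \<Omega> L (a + real k * \<Omega> + of_int j) + 4 * real k" .
    have "(real (i + 3) - 1) / real M = b + 2 * (1 / real M)" by (simp add: b_def add_divide_distrib)
    hence "diag \<Omega> L (a + 1 / real M + real k * \<Omega> + of_int j) \<le> g (i + 3)"
      unfolding g_def using k(2) by (intro diag_mono) linarith
    moreover have "(real i - 1) / real M = b - 1 / real M" by (simp add: b_def diff_divide_distrib)
    hence "g i \<le> diag \<Omega> L (a + real k * \<Omega> + of_int j)"
      unfolding g_def using k(2) by (intro diag_mono) linarith
    ultimately show ?thesis using D k(1) by linarith
  qed
  hence "(\<Sum>i<M. D) \<le> (\<Sum>i<M. (g (i + 3) - g i) + 4 * real Q)" by (intro sum_mono) blast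
  also have "\<dots> = (\<Sum>i<M. g (i + 3) - g i) + real M * (4 * real Q)" by (simp add: sum.distrib)
  also have "(\<Sum>i<M. g (i + 3) - g i)
     = (\<Sum>i<M. g (Suc i + 2) - g (i + 2)) + (\<Sum>i<M. g (Suc i + 1) - g (i + 1)) + (\<Sum>i<M. g (Suc i) - g i)"
    unfolding sum.distrib[symmetric] by (intro sum.cong refl) (simp add: numeral_3_eq_3)
  also have "\<dots> = (g (M + 2) - g 2) + (g (M + 1) - g 1) + (g M - g 0)"
    using sum_lessThan_telescope[of "\<lambda>i. g (i + 2)" M] sum_lessThan_telescope[of "\<lambda>i. g (i + 1)" M]
      sum_lessThan_telescope[of g M] by (simp add: numeral_2_eq_2)
  finally have "real M * D \<le> (g (M + 2) - g 2) + (g (M + 1) - g 1) + (g M - g 0) + real M * (4 * real Q)"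
    by simp
  moreover have "g (M + i) = g i + (real L + 1)" for i
  proof -
    have "(real (M + i) - 1) / real M = (real i - 1) / real M + of_int 1" using M by (simp add: field_simps)
    thus ?thesis unfolding g_def by (simp only: diag_add_int) simp
  qed
  note this[of 2] this[of 1] this[of 0]
  ultimately have "real M * D \<le> 3 * (real L + 1) + real M * (4 * real Q)" by simp
  thus ?thesis using M by (simp add: D_def field_simps)
qed

text \<open>A solution is picked at which both the first \<open>w\<close> steps and the last
  \<open>w\<close> steps, read backwards, contract. The block is cut where the accumulated
  derivative is smallest: this value does not exceed the one at time \<open>w\<close>, and the
  growth from there to the end is at least the growth over the last \<open>w\<close> steps.\<close>

theorem resonance_exists:
  assumes dio: "diophantine \<Omega>"
  shows "\<exists>b w0 :: nat. \<forall>w\<ge>w0. \<exists>L p y. p \<le> L \<and> L \<le> w ^ b \<and>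
     dphase \<Omega> p y y \<le> exp (- (real w * gam / 2)) \<and>
     dphase \<Omega> (L - p) (y + real p * \<Omega>) (phase \<Omega> p y y) \<ge> exp (real w * gam / 2)"
proof -
  obtain K b0 where K: "\<And>M x y. M \<ge> 1 \<Longrightarrow>
     \<exists>k\<le>K * M ^ b0. \<exists>j::int. \<bar>y - x - real k * \<Omega> - of_int j\<bar> \<le> 1 / real M"
    using diophantine_covering[OF dio] by blast
  obtain w1 where few1: "\<And>w h s a M Y. w \<ge> w1 \<Longrightarrow> finite Y \<Longrightarrow> Y \<subseteq> {a..<a+1} \<Longrightarrow> M \<ge> w\<^sup>2 \<Longrightarrow>
     (\<And>b. real (card (Y \<inter> {b..<b + 1 / real M})) \<le> 8 * real (card Y) / real M) \<Longrightarrow>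
     real (card {y\<in>Y. dphase \<Omega> w (y + h) (y + h + s) > exp (- (real w * gam / 2))}) \<le> 2 / 5 * real (card Y)"
    using most_parameters_contract[OF dio] by blast
  obtain w2 where few2: "\<And>w h s a M Y. w \<ge> w2 \<Longrightarrow> finite Y \<Longrightarrow> Y \<subseteq> {a..<a+1} \<Longrightarrow> M \<ge> w\<^sup>2 \<Longrightarrow>
     (\<And>b. real (card (Y \<inter> {b..<b + 1 / real M})) \<le> 8 * real (card Y) / real M) \<Longrightarrow>
     real (card {y\<in>Y. dphase (-\<Omega>) w (y + h) (y + h + s) > exp (- (real w * gam / 2))}) \<le> 2 / 5 * real (card Y)"
    using most_parameters_contract[OF diophantine_uminus[OF dio]] by blast
  show ?thesis
  proof (rule exI[of _ "2 * b0 + 3"], rule exI[of _ "max (max w1 w2) (4 * K + 1)"], intro allI impI)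
    fix w assume "w \<ge> max (max w1 w2) (4 * K + 1)"
    hence w: "w \<ge> w1" "w \<ge> w2" "4 * K + 1 \<le> w" by auto
    define M where "M = w\<^sup>2"
    define Q where "Q = K * M ^ b0"
    \<comment> \<open>Makes the error \<open>4 * Q + 1\<close> in the count of solutions at most
      \<open>(L + 1) / M\<close>, comparable to the expected number per cell, while \<open>L\<close>
      stays polynomial in \<open>w\<close>.\<close>
    define L where "L = M * (4 * Q + 1)"
    define \<eta> where "\<eta> = exp (- (real w * gam / 2))"
    have M1: "M \<ge> 1" using w(3) by (simp add: M_def)
    have wL: "w \<le> L"
    proof -
      have "w * 1 \<le> w * w" using w(3) by (intro mult_le_mono) auto
      also have "\<dots> = M * 1" by (simp add: M_def power2_eq_square)
      also have "\<dots> \<le> L" unfolding L_def by (intro mult_le_mono) auto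
      finally show ?thesis by simp
    qed
    have Lb: "L \<le> w ^ (2 * b0 + 3)"
    proof -
      have "4 * Q + 1 \<le> (4 * K + 1) * M ^ b0" using M1 by (simp add: Q_def algebra_simps)
      also have "\<dots> \<le> w * M ^ b0" using w(3) by (intro mult_le_mono) auto
      finally have "L \<le> w\<^sup>2 * (w * M ^ b0)" unfolding L_def M_def[symmetric] by (intro mult_le_mono) auto
      also have "\<dots> = w ^ (2 * b0 + 3)" unfolding M_def power_mult[symmetric] by (simp add: power_add power2_eq_square power3_eq_cube)
      finally show ?thesis .
    qed
    define g where "g = diag \<Omega> L"
    define yy where "yy i = (SOME y. g y = real i)" for i :: nat
    have yy: "g (yy i) = real i" for i
      unfolding yy_def g_def using diag_surj[of \<Omega> L "real i"] by (rule someI_ex)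
    have inj: "inj yy" by (rule injI) (metis yy of_nat_eq_iff)
    define Y where "Y = yy ` {..L}"
    have Y: "finite Y" "card Y = L + 1" unfolding Y_def using inj by (auto simp: card_image inj_on_subset)
    have Ysub: "Y \<subseteq> {yy 0..<yy 0 + 1}"
    proof
      fix y assume "y \<in> Y"
      then obtain i where i: "i \<le> L" "y = yy i" by (auto simp: Y_def)
      have "g (yy 0 + of_int 1) = g (yy 0) + (real L + 1) * of_int 1" unfolding g_def by (rule diag_add_int)
      hence "g y < g (yy 0 + 1)" using i by (simp add: yy)
      moreover have "\<not> g y < g (yy 0)" by (simp add: i yy)
      ultimately show "y \<in> {yy 0..<yy 0 + 1}"
        using diag_less[of y "yy 0" \<Omega> L] diag_less_imp[of \<Omega> L y "yy 0 + 1"] by (auto simp: g_def not_less[symmetric])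
    qed
    have card: "real (card (Y \<inter> {b..<b + 1 / real M})) \<le> 8 * real (card Y) / real M" for b
    proof -
      define S where "S = {i::nat. g b \<le> real i \<and> real i < g (b + 1 / real M)}"
      have le: "g b \<le> g (b + 1 / real M)" unfolding g_def by (rule diag_mono) simp
      have "Y \<inter> {b..<b + 1 / real M} \<subseteq> yy ` S"
      proof
        fix y assume y: "y \<in> Y \<inter> {b..<b + 1 / real M}"
        then obtain i where i: "y = yy i" by (auto simp: Y_def)
        have "g b \<le> g y" "g y < g (b + 1 / real M)"
          unfolding g_def using y by (auto intro: diag_mono diag_less)
        thus "y \<in> yy ` S" by (auto simp: i S_def yy)
      qed
      hence "card (Y \<inter> {b..<b + 1 / real M}) \<le> card S"
        using card_nat_interval(1)[OF le] by (intro surj_card_le) (simp_all add: S_def)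
      hence "real (card (Y \<inter> {b..<b + 1 / real M})) \<le> real (card S)" by simp
      also have "\<dots> \<le> g (b + 1 / real M) - g b + 1"
        unfolding S_def by (rule card_nat_interval(2)[OF le])
      also have "g (b + 1 / real M) - g b \<le> 3 * (real L + 1) / real M + 4 * real Q"
        unfolding g_def by (rule diag_increment_le[OF M1]) (use K[OF M1] in \<open>auto simp: Q_def\<close>)
      also have "3 * (real L + 1) / real M + 4 * real Q + 1 \<le> 8 * (real L + 1) / real M"
      proof -
        have "real M * (4 * real Q + 1) = real L" by (simp add: L_def algebra_simps)
        hence "4 * real Q + 1 \<le> (real L + 1) / real M" using M1 by (simp add: field_simps)
        moreover have "8 * (real L + 1) / real M = 3 * (real L + 1) / real M + 5 * ((real L + 1) / real M)"
          by (simp flip: add_divide_distrib)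
        moreover have "0 \<le> (real L + 1) / real M" by simp
        ultimately show ?thesis by linarith
      qed
      finally show ?thesis by (simp add: Y(2) add.commute)
    qed
    \<comment> \<open>Together with \<open>s\<close>, these are the offsets of the reversed orbit:
      its parameter is \<open>y + h\<close>, and because the forward orbit ends at an integer its
      initial phase is \<open>y + h + s\<close> modulo 1, whichever solution \<open>y\<close>
      is.\<close>
    define h where "h = (real L - 2) * \<Omega>"
    define s where "s = \<Omega> + 1 / 2"
    define B1 where "B1 = {y\<in>Y. dphase \<Omega> w (y + 0) (y + 0 + 0) > \<eta>}"
    define B2 where "B2 = {y\<in>Y. dphase (-\<Omega>) w (y + h) (y + h + s) > \<eta>}"
    have "real (card B1) \<le> 2/5 * real (card Y)"
      unfolding B1_def \<eta>_def by (rule few1[OF w(1) Y(1) Ysub _ card]) (simp add: M_def)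
    moreover have "real (card B2) \<le> 2/5 * real (card Y)"
      unfolding B2_def \<eta>_def by (rule few2[OF w(2) Y(1) Ysub _ card]) (simp add: M_def)
    moreover have "card (B1 \<union> B2) \<le> card B1 + card B2" by (rule card_Un_le)
    \<comment> \<open>Two exceptional sets of \<open>2 / 5\<close> each leave at least a fifth of
      the solutions.\<close>
    ultimately have "real (card (B1 \<union> B2)) < real (card Y)" using Y(2) by simp
    moreover have "B1 \<union> B2 \<subseteq> Y" by (auto simp: B1_def B2_def)
    ultimately obtain y where y: "y \<in> Y" "y \<notin> B1" "y \<notin> B2" by (metis Un_iff less_irrefl subsetI subset_antisym)
    from y(1) obtain i where i: "y = yy i" by (auto simp: Y_def)
    define E where "E k = dphase \<Omega> k y y" for k
    have Epos: "E k > 0" for k by (simp add: E_def dphase_pos)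
    have Ew: "E w \<le> \<eta>" using y(1,2) by (simp add: B1_def E_def)
    have phL: "phase \<Omega> L y y = of_int (int i)" using yy[of i] by (simp add: i g_def diag_def)
    have "dphase (-\<Omega>) w (y + h) (y + h + s) \<le> \<eta>" using y(1,3) by (simp add: B2_def)
    also have "y + h + s = (y + (real L - real 0 - 1) * \<Omega> + 1/2 - phase \<Omega> (L - 0) y y) + of_int (int i)"
      unfolding minus_nat.diff_0 phL by (simp add: h_def s_def algebra_simps)
    finally have "1 / dphase \<Omega> w (y + real (L - w) * \<Omega>) (phase \<Omega> (L - w) y y) \<le> \<eta>"
      unfolding dphase_add_int h_def by (subst (asm) phase_reverse(2)[OF wL])
    hence right: "1 / \<eta> \<le> dphase \<Omega> w (y + real (L - w) * \<Omega>) (phase \<Omega> (L - w) y y)"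
      using dphase_pos[of \<Omega> w] by (simp add: \<eta>_def field_simps)
    obtain p where p: "p \<le> L" "\<And>k. k \<le> L \<Longrightarrow> E p \<le> E k"
    proof -
      have "finite (E ` {..L})" "E ` {..L} \<noteq> {}" by auto
      from Min_in[OF this] obtain p where "p \<le> L" "Min (E ` {..L}) = E p" by blast
      moreover have "Min (E ` {..L}) \<le> E k" if "k \<le> L" for k using that by (intro Min_le) auto
      ultimately show ?thesis by (intro that[of p]) auto
    qed
    have "E p \<le> \<eta>" using p(2)[OF wL] Ew by linarith
    have "E p * (1 / \<eta>) \<le> E (L - w) * dphase \<Omega> w (y + real (L - w) * \<Omega>) (phase \<Omega> (L - w) y y)"
      by (intro mult_mono right p(2)) (use Epos[of "L - w"] in \<open>auto simp: \<eta>_def\<close>)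
    also have "\<dots> = E L" unfolding E_def dphase_add[symmetric] using wL by simp
    also have "\<dots> = E p * dphase \<Omega> (L - p) (y + real p * \<Omega>) (phase \<Omega> p y y)"
      unfolding E_def dphase_add[symmetric] using p(1) by simp
    finally have "1 / \<eta> \<le> dphase \<Omega> (L - p) (y + real p * \<Omega>) (phase \<Omega> p y y)"
      using Epos[of p] by (simp only: mult_le_cancel_left_pos)
    moreover have "1 / \<eta> = exp (real w * gam / 2)" by (simp add: \<eta>_def exp_minus inverse_eq_divide)
    ultimately show "\<exists>L p y. p \<le> L \<and> L \<le> w ^ (2 * b0 + 3) \<and>
       dphase \<Omega> p y y \<le> exp (- (real w * gam / 2)) \<and>
       dphase \<Omega> (L - p) (y + real p * \<Omega>) (phase \<Omega> p y y) \<ge> exp (real w * gam / 2)"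
      using p(1) Lb \<open>E p \<le> \<eta>\<close> unfolding E_def \<eta>_def by (intro exI[of _ L] exI[of _ p] exI[of _ y]) simp
  qed
qed

end

section \<open>Comparison of Laplace functionals\<close>

lemma centered_rep_add_int: "centered_rep (t + of_int j) = centered_rep t"
proof -
  have "t + of_int j + 1 / 2 = (t + 1 / 2) + of_int j" by simp
  thus ?thesis unfolding centered_rep_def by (simp only: floor_add_int[symmetric] of_int_add add_diff_cancel_right)
qed

lemma centered_rep_self: "t \<in> {- 1 / 2..<1 / 2} \<Longrightarrow> centered_rep t = t"
  by (simp add: centered_rep_unique)

lemma centered_rep_measurable [measurable]: "centered_rep \<in> borel_measurable borel"
  unfolding centered_rep_def[abs_def] by measurable

lemma set_integrable_bounded_interval:
  fixes p :: "real \<Rightarrow> real"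
  assumes "p \<in> borel_measurable borel" "\<And>x. \<bar>p x\<bar> \<le> B"
  shows "set_integrable lborel {a..<b} p"
  unfolding set_integrable_def
proof (rule Bochner_Integration.integrable_bound)
  show "integrable lborel (\<lambda>x. B * indicator {a..<b} x)"
    by (intro integrable_mult_right integrable_real_indicator emeasure_bounded_finite) auto
  show "(\<lambda>x. indicator {a..<b} x *\<^sub>R p x) \<in> borel_measurable lborel" using assms(1) by measurable
  show "AE x in lborel. norm (indicator {a..<b} x *\<^sub>R p x) \<le> norm (B * indicator {a..<b} x)"
    using assms(2) by (auto simp: indicator_def intro: order_trans[OF _ abs_ge_self])
qed

lemma set_integral_shift_int:
  fixes p :: "real \<Rightarrow> real"
  assumes per: "\<And>x. p (x + 1) = p x"
  shows "(LBINT u:{x + of_int j..<y + of_int j}. p u) = (LBINT u:{x..<y}. p u)"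
proof -
  note pj = periodic_int[of p, OF per]
  have "(LBINT u:{x + of_int j..<y + of_int j}. p u)
      = (LBINT u. indicator {x + of_int j..<y + of_int j} (of_int j + 1 * u) *\<^sub>R p (of_int j + 1 * u))"
    unfolding set_lebesgue_integral_def
    by (subst lborel_integral_real_affine[where c = 1 and t = "of_int j"]) auto
  also have "\<dots> = (LBINT u. indicator {x..<y} u *\<^sub>R p u)"
    using pj by (intro Bochner_Integration.integral_cong refl) (auto simp: indicator_def add.commute)
  finally show ?thesis by (simp add: set_lebesgue_integral_def)
qed

lemma set_integral_period:
  fixes p :: "real \<Rightarrow> real"
  assumes per: "\<And>x. p (x + 1) = p x" and meas: "p \<in> borel_measurable borel" and bd: "\<And>x. \<bar>p x\<bar> \<le> B"
  shows "(LBINT u:{c..<c+1}. p u) = (LBINT u:{0..<1}. p u)"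
proof -
  note int = set_integrable_bounded_interval[OF meas bd]
  define k where "k = \<lceil>c\<rceil>"
  have k: "c \<le> of_int k" "of_int k \<le> c + 1" "of_int k - 1 \<le> c" unfolding k_def by linarith+
  have split: "(LBINT u:{x..<z}. p u) = (LBINT u:{x..<y}. p u) + (LBINT u:{y..<z}. p u)"
    if "x \<le> y" "y \<le> z" for x y z
  proof -
    have "{x..<z} = {x..<y} \<union> {y..<z}" using that by auto
    thus ?thesis by (simp only:) (intro set_integral_Un int; auto)
  qed
  have "(LBINT u:{c..<c+1}. p u) = (LBINT u:{c..<of_int k}. p u) + (LBINT u:{of_int k..<c+1}. p u)"
    using k by (intro split) auto
  also have "(LBINT u:{of_int k..<c+1}. p u) = (LBINT u:{of_int k - 1 + of_int 1..<c + of_int 1}. p u)" by simp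
  also have "\<dots> = (LBINT u:{of_int k - 1..<c}. p u)" by (rule set_integral_shift_int[of p, OF per])
  also have "(LBINT u:{c..<of_int k}. p u) + (LBINT u:{of_int k - 1..<c}. p u) = (LBINT u:{of_int k - 1..<of_int k}. p u)"
    using split[of "of_int k - 1" c "of_int k"] k by simp
  also have "\<dots> = (LBINT u:{0 + of_int (k - 1)..<1 + of_int (k - 1)}. p u)" by simp
  also have "\<dots> = (LBINT u:{0..<1}. p u)" by (rule set_integral_shift_int[of p, OF per])
  finally show ?thesis .
qed

text \<open>The right-hand side does not depend on \<open>a\<close>: this is the translation
  invariance by which the unknown shift of the zeros drops out.\<close>

lemma set_integral_period_reflect:
  fixes p :: "real \<Rightarrow> real"
  assumes per: "\<And>x. p (x + 1) = p x" and meas: "p \<in> borel_measurable borel" and bd: "\<And>x. \<bar>p x\<bar> \<le> B"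
  shows "(LBINT t:{0..<1}. p (a - t)) = (LBINT u:{-1/2..<1/2}. p u)"
proof -
  have "(LBINT t:{0..<1}. p (a - t)) = (LBINT u. indicator {0..<1} (a + (-1) * u) *\<^sub>R p (a - (a + (-1) * u)))"
    unfolding set_lebesgue_integral_def
    by (subst lborel_integral_real_affine[where c = "-1" and t = a]) auto
  \<comment> \<open>Reflection exchanges the closed and the open end of the interval, so the
    integrands agree only away from two points.\<close>
  also have "\<dots> = (LBINT u. indicator {a - 1..<a - 1 + 1} u *\<^sub>R p u)"
  proof (rule integral_cong_AE)
    show "AE u in lborel. indicator {0..<1} (a + (-1) * u) *\<^sub>R p (a - (a + (-1) * u)) = indicator {a - 1..<a - 1 + 1} u *\<^sub>R p u"
      using AE_lborel_singleton[of a] AE_lborel_singleton[of "a - 1"]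
      by eventually_elim (auto simp: indicator_def)
  qed (use meas in measurable)
  also have "\<dots> = (LBINT u:{0..<1}. p u)"
    using set_integral_period[OF assms, of "a - 1"] by (simp add: set_lebesgue_integral_def)
  also have "\<dots> = (LBINT u:{-1/2..<1/2}. p u)"
    using set_integral_period[OF assms, of "-1/2"] by simp
  finally show ?thesis .
qed

lemma set_integral_period_le:
  fixes p :: "real \<Rightarrow> real"
  assumes per: "\<And>x. p (x + 1) = p x" and meas: "p \<in> borel_measurable borel" and bd: "\<And>x. \<bar>p x\<bar> \<le> B"
    and le: "\<And>u. u \<in> {-1/2..<1/2} \<Longrightarrow> p u \<le> e * indicator {-S..S} u" and "e \<ge> 0" "S \<ge> 0"
  shows "(LBINT t:{0..<1}. p (a - t)) \<le> e * (2 * S)"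
proof -
  have "(LBINT t:{0..<1}. p (a - t)) = (LBINT u:{-1/2..<1/2}. p u)"
    by (rule set_integral_period_reflect[OF per meas bd])
  also have "\<dots> \<le> (LBINT u. e * indicator {-S..S} u)"
    unfolding set_lebesgue_integral_def
  proof (rule integral_mono)
    show "integrable lborel (\<lambda>x. indicator {- 1 / 2..<1 / 2} x *\<^sub>R p x)"
      using set_integrable_bounded_interval[OF meas bd] by (simp add: set_integrable_def)
    show "integrable lborel (\<lambda>x. e * indicator {- S..S} x)"
      by (intro integrable_mult_right integrable_real_indicator emeasure_bounded_finite) auto
    show "indicator {- 1 / 2..<1 / 2} x *\<^sub>R p x \<le> e * indicator {- S..S} x" for x
      using le[of x] \<open>e \<ge> 0\<close> by (auto simp: indicator_def split: if_splits)
  qed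
  also have "\<dots> = e * (2 * S)" using \<open>S \<ge> 0\<close> by simp
  finally show ?thesis .
qed

lemma exp_minus_diff_le:
  fixes a b :: real
  assumes "a \<ge> 0" "b \<ge> 0" shows "\<bar>exp (- a) - exp (- b)\<bar> \<le> \<bar>a - b\<bar>"
proof -
  have *: "exp (- a) - exp (- b) \<le> b - a" if "0 \<le> a" "a \<le> b" for a b :: real
  proof -
    have "exp (- a) - exp (- b) = exp (- a) * (1 - exp (- (b - a)))" by (simp add: algebra_simps flip: exp_add)
    also have "\<dots> \<le> 1 * (b - a)"
    proof (intro mult_mono)
      show "1 - exp (- (b - a)) \<le> b - a" using exp_ge_add_one_self[of "- (b - a)"] by linarith
    qed (use that in auto)
    finally show ?thesis by simp
  qed
  show ?thesis using *[of a b] *[of b a] assms by (cases "a \<le> b") (auto simp: abs_if)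
qed

text \<open>The exponential is 1-Lipschitz on the sums, which are split into matched pairs and
  unmatched points of either kind. Each bump lives on a set of length of order \<open>1 / N\<close>.
  So \<open>N\<close> matched pairs with discrepancy \<open>e\<close> cost a multiple of
  \<open>e\<close>, and the at most \<open>2 * L\<close> unmatched points cost a multiple of
  \<open>L / N\<close>.\<close>

lemma laplace_functional_close:
  fixes f :: "real \<Rightarrow> real"
  assumes f0: "\<And>v. f v \<ge> 0" and fB: "\<And>v. f v \<le> B" and fm: "f \<in> borel_measurable borel"
    and supp: "\<And>v. \<bar>v\<bar> > R \<Longrightarrow> f v = 0" and R: "R \<ge> 0"
    and uc: "\<And>v v'. \<bar>v - v'\<bar> \<le> \<delta> \<Longrightarrow> \<bar>f v - f v'\<bar> \<le> e" and \<delta>: "\<delta> \<le> 1" and e: "e \<ge> 0"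
    and N: "real N \<ge> 2 * R + 5"
    and I: "I \<subseteq> {1..N}" and \<sigma>: "inj_on \<sigma> I" "\<sigma> ` I \<subseteq> {1..N}" and L: "card ({1..N} - I) \<le> L"
    and close: "\<And>n. n \<in> I \<Longrightarrow> \<exists>i::int. \<bar>\<theta> (\<sigma> n) - x n - c - of_int i\<bar> \<le> \<delta> / real N"
  shows "\<bar>laplace_functional \<theta> N f - laplace_functional x N f\<bar>
     \<le> 2 * (R + 1) * e + 4 * real L * R * B / real N"
proof -
  define h where "h t = f (real N * centered_rep t)" for t
  have N0: "real N > 0" using N R by linarith
  have h_int: "h (t + of_int j) = h t" for t j by (simp add: h_def centered_rep_add_int)
  have h_per: "h (t + 1) = h t" for t using h_int[of t 1] by simp
  have hm [measurable]: "h \<in> borel_measurable borel" unfolding h_def[abs_def] using fm by measurable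
  have h0: "h t \<ge> 0" and hB: "h t \<le> B" for t by (simp_all add: h_def f0 fB)
  have habs: "\<bar>h t\<bar> \<le> B" for t using h0[of t] hB[of t] by simp
  have B0: "B \<ge> 0" using f0[of 0] fB[of 0] by linarith
  define A where "A t = (\<Sum>j=1..N. h (\<theta> j - t))" for t
  define D where "D t = (\<Sum>n=1..N. h (x n + c - t))" for t
  have AD0: "A t \<ge> 0" "D t \<ge> 0" for t by (simp_all add: A_def D_def sum_nonneg h0)
  have [measurable]: "A \<in> borel_measurable borel" "D \<in> borel_measurable borel"
    unfolding A_def[abs_def] D_def[abs_def] by measurable
  have lapA: "laplace_functional \<theta> N f = (LBINT t:{0..<1}. exp (- A t))"
    by (simp add: laplace_functional_def A_def h_def)
  have lapD: "laplace_functional x N f = (LBINT t:{0..<1}. exp (- D t))"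
  proof -
    define p where "p v = exp (- (\<Sum>n=1..N. h (x n + v)))" for v
    have "p (v + 1) = p v" for v using h_per by (simp add: p_def add.assoc[symmetric])
    moreover have "p \<in> borel_measurable borel" unfolding p_def[abs_def] by measurable
    moreover have "\<bar>p v\<bar> \<le> 1" for v by (simp add: p_def sum_nonneg h0)
    ultimately have "(LBINT t:{0..<1}. p (c - t)) = (LBINT t:{0..<1}. p (0 - t))"
      by (simp only: set_integral_period_reflect[of p 1])
    thus ?thesis by (simp add: p_def D_def laplace_functional_def h_def add_diff_eq)
  qed
  define J1 where "J1 t = (\<Sum>n\<in>I. \<bar>h (\<theta> (\<sigma> n) - t) - h (x n + c - t)\<bar>)" for t
  define J2 where "J2 t = (\<Sum>j\<in>{1..N} - \<sigma> ` I. h (\<theta> j - t))" for t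
  define J3 where "J3 t = (\<Sum>n\<in>{1..N} - I. h (x n + c - t))" for t
  have finI: "finite I" using I finite_subset by blast
  have ptw: "\<bar>exp (- A t) - exp (- D t)\<bar> \<le> J1 t + J2 t + J3 t" for t
  proof -
    have "A t = (\<Sum>j\<in>\<sigma> ` I. h (\<theta> j - t)) + J2 t"
      unfolding A_def J2_def using \<sigma>(2) by (subst sum.subset_diff[of "\<sigma> ` I"]) auto
    also have "(\<Sum>j\<in>\<sigma> ` I. h (\<theta> j - t)) = (\<Sum>n\<in>I. h (\<theta> (\<sigma> n) - t))"
      by (subst sum.reindex[OF \<sigma>(1)]) simp
    finally have 1: "A t = (\<Sum>n\<in>I. h (\<theta> (\<sigma> n) - t)) + J2 t" .
    have 2: "D t = (\<Sum>n\<in>I. h (x n + c - t)) + J3 t"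
      unfolding D_def J3_def using I by (subst sum.subset_diff[of I]) auto
    have "\<bar>(\<Sum>n\<in>I. h (\<theta> (\<sigma> n) - t)) - (\<Sum>n\<in>I. h (x n + c - t))\<bar> \<le> J1 t"
      unfolding J1_def sum_subtractf[symmetric] by (rule sum_abs)
    moreover have "J2 t \<ge> 0" "J3 t \<ge> 0" by (simp_all add: J2_def J3_def sum_nonneg h0)
    ultimately have "\<bar>A t - D t\<bar> \<le> J1 t + J2 t + J3 t" unfolding 1 2 by linarith
    with exp_minus_diff_le[OF AD0(1)[of t] AD0(2)[of t]] show ?thesis by linarith
  qed
  have sint: "set_integrable lborel {0..<1} g" if "g \<in> borel_measurable borel" "\<And>x. \<bar>g x\<bar> \<le> b"
    for g :: "real \<Rightarrow> real" and b
    by (rule set_integrable_bounded_interval[OF that])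
  have int_h: "set_integrable lborel {0..<1} (\<lambda>t. h (a - t))" for a
    by (rule sint[where b = B]) (use habs in auto)
  have int_d: "set_integrable lborel {0..<1} (\<lambda>t. \<bar>h (a - t) - h (b - t)\<bar>)" for a b
  proof (rule sint[where b = B])
    show "\<bar>\<bar>h (a - t) - h (b - t)\<bar>\<bar> \<le> B" for t
      using h0[of "a - t"] h0[of "b - t"] hB[of "a - t"] hB[of "b - t"] by linarith
  qed auto
  have sum_int: "set_integrable lborel {0..<1} (\<lambda>t. \<Sum>i\<in>F. g i t) \<and>
      (LBINT t:{0..<1}. (\<Sum>i\<in>F. g i t)) = (\<Sum>i\<in>F. LBINT t:{0..<1}. g i t)"
    if "\<And>i. i \<in> F \<Longrightarrow> set_integrable lborel {0..<1} (g i)" for F :: "nat set" and g :: "nat \<Rightarrow> real \<Rightarrow> real"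
    using that unfolding set_integrable_def set_lebesgue_integral_def
    by (simp add: sum_distrib_left)
  have h_le: "(LBINT t:{0..<1}. h (a - t)) \<le> B * (2 * (R / real N))" for a
  proof (rule set_integral_period_le[OF h_per hm habs])
    fix u :: real assume u: "u \<in> {-1/2..<1/2}"
    show "h u \<le> B * indicator {- (R / real N)..R / real N} u"
    proof (cases "\<bar>real N * u\<bar> > R")
      case True
      thus ?thesis using centered_rep_self[OF u] supp B0 by (simp add: h_def)
    next
      case False
      hence "real N * \<bar>u\<bar> \<le> R" by (simp add: abs_mult)
      hence "\<bar>u\<bar> \<le> R / real N" using N0 by (simp add: field_simps)
      thus ?thesis using hB[of u] by (simp add: abs_le_iff)
    qed
  qed (use R B0 in auto)
  have d_le: "(LBINT t:{0..<1}. \<bar>h (b - t) - h (a - t)\<bar>) \<le> e * (2 * ((R + 1) / real N))"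
    if ab: "\<bar>b - a - of_int i\<bar> \<le> \<delta> / real N" for a b and i :: int
  proof -
    define d where "d = b - a - of_int i"
    define p where "p u = \<bar>h (u + d) - h u\<bar>" for u
    have Nd: "\<bar>real N * d\<bar> \<le> \<delta>" using ab N0 by (simp add: abs_mult pos_le_divide_eq mult.commute flip: d_def)
    have dN: "\<bar>d\<bar> \<le> 1 / real N" using ab \<delta> N0 unfolding d_def
      by (meson divide_right_mono less_imp_le order_trans)
    have "h (b - t) = h (a - t + d)" for t
      using h_int[of "a - t + d" i] by (simp add: d_def algebra_simps)
    hence "(LBINT t:{0..<1}. \<bar>h (b - t) - h (a - t)\<bar>) = (LBINT t:{0..<1}. p (a - t))"
      by (simp add: p_def)
    also have "\<dots> \<le> e * (2 * ((R + 1) / real N))"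
    proof (rule set_integral_period_le[where B = B])
      show "p (u + 1) = p u" for u
        using h_per[of "u + d"] h_per[of u] by (simp add: p_def add_ac)
      show "p \<in> borel_measurable borel" unfolding p_def[abs_def] by measurable
      show "\<bar>p u\<bar> \<le> B" for u
        using h0[of "u + d"] h0[of u] hB[of "u + d"] hB[of u] unfolding p_def by linarith
      fix u :: real assume u: "u \<in> {-1/2..<1/2}"
      \<comment> \<open>Here \<open>N \<ge> 2 * R + 5\<close> is used: the enlarged support, moved
        by up to \<open>1 / N\<close>, stays inside the fundamental interval.\<close>
      have n1: "(R + 1) / real N + 1 / real N < 1/2" using N N0 by (simp add: field_simps)
      show "p u \<le> e * indicator {- ((R + 1) / real N)..(R + 1) / real N} u"
      proof (cases "\<bar>u\<bar> \<le> (R + 1) / real N")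
        case True
        hence "u + d \<in> {-1/2..<1/2}" using n1 dN unfolding atLeastLessThan_iff abs_le_iff by linarith
        hence "p u = \<bar>f (real N * (u + d)) - f (real N * u)\<bar>"
          using centered_rep_self[OF u] centered_rep_self[of "u + d"] by (simp add: p_def h_def)
        also have "\<dots> \<le> e" by (rule uc) (use Nd in \<open>simp add: algebra_simps\<close>)
        finally show ?thesis using True by (simp add: abs_le_iff)
      next
        case False
        have far: "h v = 0" if "v \<in> {-1/2..<1/2}" "\<bar>v\<bar> > R / real N" for v
        proof -
          have "\<bar>real N * v\<bar> > R" using that(2) N0 by (simp add: abs_mult field_simps)
          thus ?thesis using centered_rep_self[OF that(1)] supp by (simp add: h_def)
        qed
        have RR: "R / real N + 1 / real N = (R + 1) / real N" by (simp add: add_divide_distrib)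
        have R4: "R / real N < 1/2 - 1 / real N" using n1 RR N0 by (smt (verit) divide_pos_pos)
        have Np: "0 < 1 / real N" "0 \<le> (R + 1) / real N" using N0 R by simp_all
        hence "h u = 0" using u False RR by (intro far) (simp, linarith)
        moreover have "h (u + d) = 0"
        proof -
          \<comment> \<open>The shift may carry the point across the cut of the circle. It then
            reappears near the opposite end, still outside the support.\<close>
          consider "u + d < -1/2" | "u + d \<in> {-1/2..<1/2}" | "u + d \<ge> 1/2" by fastforce
          thus ?thesis
          proof cases
            case 1
            have "u + d + of_int 1 \<in> {-1/2..<1/2}" "u + d + of_int 1 > R / real N"
              using 1 u dN n1 R4 Np unfolding atLeastLessThan_iff abs_le_iff of_int_1 by linarith+
            hence "h (u + d + of_int 1) = 0" by (intro far) auto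
            thus ?thesis by (simp only: h_int)
          next
            case 2
            thus ?thesis using False RR dN by (intro far) (simp, linarith)
          next
            case 3
            have "u + d + of_int (- 1) \<in> {-1/2..<1/2}" "u + d + of_int (- 1) < - (R / real N)"
              using 3 u dN n1 R4 Np unfolding atLeastLessThan_iff abs_le_iff of_int_1 of_int_minus by linarith+
            hence "h (u + d + of_int (- 1)) = 0" by (intro far) auto
            thus ?thesis by (simp only: h_int)
          qed
        qed
        ultimately show ?thesis using e by (simp add: p_def)
      qed
    qed (use R e in auto)
    finally show ?thesis .
  qed
  have int_exp: "set_integrable lborel {0..<1} (\<lambda>t. exp (- A t))" "set_integrable lborel {0..<1} (\<lambda>t. exp (- D t))"
    by (rule sint[where b = 1]; simp add: AD0)+
  have i1: "set_integrable lborel {0..<1} J1" "(LBINT t:{0..<1}. J1 t) \<le> 2 * (R + 1) * e"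
  proof -
    have s: "set_integrable lborel {0..<1} J1 \<and> (LBINT t:{0..<1}. J1 t)
        = (\<Sum>n\<in>I. LBINT t:{0..<1}. \<bar>h (\<theta> (\<sigma> n) - t) - h (x n + c - t)\<bar>)"
      unfolding J1_def[abs_def] by (intro sum_int int_d)
    thus "set_integrable lborel {0..<1} J1" by blast
    have "(LBINT t:{0..<1}. J1 t) \<le> (\<Sum>n\<in>I. e * (2 * ((R + 1) / real N)))"
      unfolding s[THEN conjunct2]
    proof (intro sum_mono)
      fix n assume "n \<in> I"
      then obtain i :: int where "\<bar>\<theta> (\<sigma> n) - x n - c - of_int i\<bar> \<le> \<delta> / real N" using close by blast
      thus "(LBINT t:{0..<1}. \<bar>h (\<theta> (\<sigma> n) - t) - h (x n + c - t)\<bar>) \<le> e * (2 * ((R + 1) / real N))"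
        by (intro d_le[of _ _ i]) (simp add: algebra_simps)
    qed
    also have "\<dots> = real (card I) * (e * (2 * ((R + 1) / real N)))" by simp
    also have "\<dots> \<le> real N * (e * (2 * ((R + 1) / real N)))"
      using card_mono[OF _ I] e R by (intro mult_right_mono) auto
    also have "\<dots> = 2 * (R + 1) * e" using N0 by simp
    finally show "(LBINT t:{0..<1}. J1 t) \<le> 2 * (R + 1) * e" .
  qed
  have few: "(\<Sum>n\<in>F. LBINT t:{0..<1}. h (a n - t)) \<le> real L * (B * (2 * (R / real N)))"
    if "card F \<le> L" for F :: "nat set" and a
  proof -
    have "(\<Sum>n\<in>F. LBINT t:{0..<1}. h (a n - t)) \<le> (\<Sum>n\<in>F. B * (2 * (R / real N)))" by (intro sum_mono h_le)
    also have "\<dots> = real (card F) * (B * (2 * (R / real N)))" by simp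
    also have "\<dots> \<le> real L * (B * (2 * (R / real N)))" using that B0 R by (intro mult_right_mono) auto
    finally show ?thesis .
  qed
  have i2: "set_integrable lborel {0..<1} J2 \<and> (LBINT t:{0..<1}. J2 t) = (\<Sum>j\<in>{1..N} - \<sigma> ` I. LBINT t:{0..<1}. h (\<theta> j - t))"
    unfolding J2_def[abs_def] by (intro sum_int int_h)
  have i3: "set_integrable lborel {0..<1} J3 \<and> (LBINT t:{0..<1}. J3 t) = (\<Sum>n\<in>{1..N} - I. LBINT t:{0..<1}. h (x n + c - t))"
    unfolding J3_def[abs_def] by (intro sum_int int_h)
  have cards: "card ({1..N} - \<sigma> ` I) = card ({1..N} - I)"
    using \<sigma> I finI by (simp add: card_Diff_subset card_image)
  have b2: "(LBINT t:{0..<1}. J2 t) \<le> real L * (B * (2 * (R / real N)))"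
    unfolding i2[THEN conjunct2] by (rule few) (use cards L in simp)
  have b3: "(LBINT t:{0..<1}. J3 t) \<le> real L * (B * (2 * (R / real N)))"
    unfolding i3[THEN conjunct2] by (rule few[OF L])
  have "\<bar>laplace_functional \<theta> N f - laplace_functional x N f\<bar> = \<bar>LBINT t:{0..<1}. exp (- A t) - exp (- D t)\<bar>"
    unfolding lapA lapD by (subst set_integral_diff(2)[OF int_exp]) simp
  also have "\<dots> \<le> (LBINT t:{0..<1}. \<bar>exp (- A t) - exp (- D t)\<bar>)"
    using set_integral_norm_bound[OF set_integral_diff(1)[OF int_exp]] by simp
  also have "\<dots> \<le> (LBINT t:{0..<1}. J1 t + J2 t + J3 t)"
    by (intro set_integral_mono set_integrable_abs set_integral_diff(1) set_integral_add(1) int_exp i1(1)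
         i2[THEN conjunct1] i3[THEN conjunct1] ptw)
  also have "\<dots> = (LBINT t:{0..<1}. J1 t) + (LBINT t:{0..<1}. J2 t) + (LBINT t:{0..<1}. J3 t)"
    using i1(1) i2 i3 by (subst set_integral_add(2), auto intro!: set_integral_add)
  also have "\<dots> \<le> 2 * (R + 1) * e + real L * (B * (2 * (R / real N))) + real L * (B * (2 * (R / real N)))"
    by (intro add_mono i1 b2 b3)
  also have "\<dots> = 2 * (R + 1) * e + 4 * real L * R * B / real N" by simp
  finally show ?thesis .
qed

section \<open>Zeros of para-orthogonal polynomials\<close>

lemma poly_reversed_unit_circle:
  assumes "norm z = 1"
  shows "poly (reversed_poly n (szego_poly \<alpha> n)) z = z ^ n * cnj (poly (szego_poly \<alpha> n) z)"
proof -
  have "z * cnj z = 1" using assms by (simp add: complex_norm_square[symmetric])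
  hence "inverse (cnj z) = z" by (simp add: inverse_unique mult.commute)
  moreover have "z \<noteq> 0" using assms by auto
  ultimately show ?thesis using poly_reversed_poly[OF degree_szego_poly] by simp
qed

lemma power_decay_exp:
  assumes "g > 0"
  shows "(\<lambda>w. real (w + 1) ^ k * exp (- (real w * g))) \<longlonglongrightarrow> 0"
proof -
  have "filterlim (\<lambda>w. real (w + 1) * g) at_top sequentially"
  proof (rule filterlim_at_top_mult_tendsto_pos[OF tendsto_const assms])
    show "filterlim (\<lambda>w. real (w + 1)) at_top sequentially"
      using filterlim_compose[OF filterlim_real_sequentially filterlim_Suc] by simp
  qed
  from filterlim_compose[OF tendsto_power_div_exp_0 this, of k]
  have "(\<lambda>w. (exp g / g ^ k) * ((real (w + 1) * g) ^ k / exp (real (w + 1) * g))) \<longlonglongrightarrow> (exp g / g ^ k) * 0"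
    by (intro tendsto_mult tendsto_const)
  moreover have "(exp g / g ^ k) * ((real (w + 1) * g) ^ k / exp (real (w + 1) * g)) = real (w + 1) ^ k * exp (- (real w * g))" for w
  proof -
    have eq: "exp (real (w + 1) * g) = exp g * exp (real w * g)" by (simp add: ring_distribs exp_add)
    show ?thesis unfolding power_mult_distrib eq exp_minus using assms by (simp add: divide_simps)
  qed
  ultimately show ?thesis by simp
qed

section \<open>From the Szego recursion to phases\<close>

context moebius_rotation
begin

text \<open>Multiplying by the phase of \<open>\<alpha> n\<close> makes the coefficient in the
  recursion real. The increment of this phase is \<open>\<omega> + 2 * n * \<omega>\<close>, so the
  quadratic exponent becomes a rotation by \<open>2 * \<omega>\<close> per step. That the reversed
  polynomial does not vanish is carried along, since each step multiplies it by
  \<open>1 - r * c\<close>.\<close>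

lemma phase_szego:
  fixes l :: complex and \<omega> s x :: real
  assumes l: "l = of_real r * circ s"
    and \<alpha>: "\<And>n. \<alpha> n = l * circ (\<omega> * real n ^ 2)"
  defines "S \<equiv> \<lambda>n. poly (szego_poly \<alpha> n) (circ x)"
    and "R \<equiv> \<lambda>n. poly (reversed_poly n (szego_poly \<alpha> n)) (circ x)"
  shows "R n \<noteq> 0 \<and> circ x * S n * circ (\<omega> * real n ^ 2 + s) = circ (phase (2 * \<omega>) n (x + \<omega>) (x + s)) * R n"
proof (induction n)
  case 0
  have "circ (x + s) = circ x * circ s" by (simp only: cis_mult distrib_left)
  thus ?case by (simp add: S_def R_def reversed_poly_def)
next
  case (Suc n)
  define z c A where "z = circ x" and "c = circ (phase (2 * \<omega>) n (x + \<omega>) (x + s))"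
    and "A = circ (\<omega> * real n ^ 2 + s)"
  have unit: "z * cnj z = 1" "A * cnj A = 1" by (simp_all add: z_def A_def cis_cnj cis_mult)
  have z0: "z \<noteq> 0" by (simp add: z_def)
  have R: "R n = z ^ n * cnj (S n)" for n
    unfolding R_def S_def z_def by (rule poly_reversed_unit_circle) simp
  have S_Suc: "S (Suc n) = z * S n - cnj (\<alpha> n) * R n" by (simp add: S_def R_def z_def)
  have "A = circ s * circ (\<omega> * real n ^ 2)" unfolding A_def cis_mult by (simp add: algebra_simps)
  hence a: "\<alpha> n = of_real r * A" by (simp add: \<alpha> l)
  have R_Suc: "R (Suc n) = R n - \<alpha> n * (z * S n)"
  proof -
    have "R (Suc n) = z ^ n * (z * cnj z) * cnj (S n) - \<alpha> n * (z * (z ^ n * cnj (R n)))"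
      unfolding R[of "Suc n"] S_Suc by (simp add: algebra_simps)
    also have "z ^ n * cnj (R n) = (z * cnj z) ^ n * S n" unfolding R[of n] by (simp add: power_mult_distrib mult_ac)
    finally show ?thesis by (simp add: unit R[of n])
  qed
  have IH: "R n \<noteq> 0" "z * S n * A = c * R n" using Suc by (simp_all add: z_def c_def A_def)
  have nz: "1 - of_real r * c \<noteq> 0" by (rule one_minus_nz) (simp add: c_def)
  have R1: "R (Suc n) = (1 - of_real r * c) * R n"
  proof -
    have "\<alpha> n * (z * S n) = of_real r * (z * S n * A)" by (simp add: a mult_ac)
    thus ?thesis unfolding R_Suc IH(2) by (simp add: algebra_simps)
  qed
  have "S (Suc n) * A = (c - of_real r) * R n"
  proof -
    have "S (Suc n) * A = z * S n * A - of_real r * (A * cnj A) * R n"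
      unfolding S_Suc a by (simp add: algebra_simps)
    also have "\<dots> = (c - of_real r) * R n" unfolding unit IH(2) by (simp add: algebra_simps)
    finally show ?thesis .
  qed
  hence S1: "S (Suc n) * A = mob c * R (Suc n)" using nz by (simp add: R1 mob_def)
  have shift: "circ (\<omega> * real (Suc n) ^ 2 + s) = A * circ (\<omega> + real n * (2 * \<omega>))"
    unfolding A_def cis_mult by (simp add: algebra_simps power2_eq_square)
  have ph: "circ (phase (2 * \<omega>) (Suc n) (x + \<omega>) (x + s)) = z * circ (\<omega> + real n * (2 * \<omega>)) * mob c"
    unfolding z_def c_def circ_lift[symmetric] cis_mult by (simp add: algebra_simps)
  have "z * S (Suc n) * circ (\<omega> * real (Suc n) ^ 2 + s) = z * circ (\<omega> + real n * (2 * \<omega>)) * (S (Suc n) * A)"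
    unfolding shift by (simp add: mult_ac)
  also have "\<dots> = circ (phase (2 * \<omega>) (Suc n) (x + \<omega>) (x + s)) * R (Suc n)"
    unfolding S1 ph by (simp add: mult_ac)
  finally show ?case using IH(1) nz by (simp add: z_def R1)
qed

lemma para_orthogonal_zero_iff:
  fixes l \<beta> :: complex and \<omega> s x :: real
  assumes l: "l = of_real r * circ s"
    and \<alpha>: "\<And>n. \<alpha> n = l * circ (\<omega> * real n ^ 2)" and b: "cnj \<beta> = circ b"
  shows "poly (para_orthogonal_poly \<alpha> \<beta> (Suc n)) (circ x) = 0 \<longleftrightarrow>
     phase (2 * \<omega>) n (x + \<omega>) (x + s) - (b + (\<omega> * real n ^ 2 + s)) \<in> \<int>"
proof -
  define S R where "S = poly (szego_poly \<alpha> n) (circ x)"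
    and "R = poly (reversed_poly n (szego_poly \<alpha> n)) (circ x)"
  define A where "A = circ (\<omega> * real n ^ 2 + s)"
  have *: "R \<noteq> 0" "circ x * S * A = circ (phase (2 * \<omega>) n (x + \<omega>) (x + s)) * R"
    using phase_szego[OF l \<alpha>, of n x] by (simp_all add: S_def R_def A_def)
  have A0: "A \<noteq> 0" by (simp add: A_def)
  have "poly (para_orthogonal_poly \<alpha> \<beta> (Suc n)) (circ x) = circ x * S - circ b * R"
    by (simp add: para_orthogonal_poly_def S_def R_def b)
  hence "poly (para_orthogonal_poly \<alpha> \<beta> (Suc n)) (circ x) = 0 \<longleftrightarrow> circ x * S * A = circ b * R * A"
    using A0 by simp
  also have "\<dots> \<longleftrightarrow> circ (phase (2 * \<omega>) n (x + \<omega>) (x + s)) * R = (circ b * A) * R"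
    unfolding *(2) by (simp add: mult_ac)
  also have "\<dots> \<longleftrightarrow> circ (phase (2 * \<omega>) n (x + \<omega>) (x + s)) = circ (b + (\<omega> * real n ^ 2 + s))"
    using *(1) by (simp add: A_def cis_mult distrib_left)
  finally show ?thesis by (simp only: circ_eq_iff)
qed

text \<open>At \<open>x = y - h - k * \<Omega>\<close> the parameter has been rotated to
  \<open>y\<close> after \<open>k\<close> steps, where the block acts on whatever phase arrives. The
  full turn it forces survives to time \<open>n\<close>, so every value \<open>t\<close> is attained
  modulo 1.\<close>

lemma resonance_zero:
  assumes eps: "0 < \<epsilon>" "\<epsilon> < 1/2" and p: "p \<le> L" and n: "k + L \<le> n"
    and con: "dphase \<Omega> p y y \<le> \<epsilon> ^ 3"
    and expa: "dphase \<Omega> (L - p) (y + real p * \<Omega>) (phase \<Omega> p y y) \<ge> 1 / \<epsilon> ^ 3"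
  shows "\<exists>x. \<bar>x - (y - h - real k * \<Omega>)\<bar> \<le> 4 * \<epsilon> \<and> phase \<Omega> n (x + h) (x + s) - t \<in> \<int>"
proof -
  define x0 where "x0 = y - h - real k * \<Omega>"
  define F where "F j x = phase \<Omega> j (x + h) (x + s)" for j x
  have F_rate: "x' - x \<le> F j x' - F j x" if "x \<le> x'" for x x' j
    unfolding F_def using phase_rate[of "x + h" "x' + h" "x' + s" "x + s"] that by simp
  have "phase \<Omega> (p + (L - p)) (y + 4 * \<epsilon>) (F k (x0 + 4 * \<epsilon>)) - phase \<Omega> (p + (L - p)) (y - 4 * \<epsilon>) (F k (x0 - 4 * \<epsilon>)) \<ge> 1"
    by (rule resonance_turn[OF eps con expa F_rate])
  moreover have "F (k + L) (x0 + v) = phase \<Omega> L (y + v) (F k (x0 + v))" for v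
    unfolding F_def phase_add by (simp add: x0_def add_ac)
  from this[of "4 * \<epsilon>"] this[of "- (4 * \<epsilon>)"]
  have "F (k + L) (x0 + 4 * \<epsilon>) = phase \<Omega> L (y + 4 * \<epsilon>) (F k (x0 + 4 * \<epsilon>))"
    "F (k + L) (x0 - 4 * \<epsilon>) = phase \<Omega> L (y - 4 * \<epsilon>) (F k (x0 - 4 * \<epsilon>))" by simp_all
  ultimately have turn: "F (k + L) (x0 + 4 * \<epsilon>) - F (k + L) (x0 - 4 * \<epsilon>) \<ge> 1" using p by simp
  have "F n x = phase \<Omega> (n - (k + L)) (x + h + real (k + L) * \<Omega>) (F (k + L) x)" for x
    unfolding F_def phase_add[symmetric] using n by simp
  hence "F n (x0 + 4 * \<epsilon>) - F n (x0 - 4 * \<epsilon>) \<ge> 1"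
    using phase_increase_tail[OF _ turn] eps by simp
  moreover define j where "j = \<lceil>F n (x0 - 4 * \<epsilon>) - t\<rceil>"
  have "F n (x0 - 4 * \<epsilon>) \<le> t + of_int j" "t + of_int j \<le> F n (x0 - 4 * \<epsilon>) + 1"
    unfolding j_def by linarith+
  ultimately have "F n (x0 - 4 * \<epsilon>) \<le> t + of_int j" "t + of_int j \<le> F n (x0 + 4 * \<epsilon>)" by linarith+
  moreover have "continuous_on {x0 - 4 * \<epsilon>..x0 + 4 * \<epsilon>} (F n)"
    unfolding F_def[abs_def]
    by (rule continuous_on_subset[OF continuous_phase]) (auto intro!: continuous_intros)
  ultimately obtain x where "x0 - 4 * \<epsilon> \<le> x" "x \<le> x0 + 4 * \<epsilon>" "F n x = t + of_int j"
    using IVT'[of "F n" "x0 - 4 * \<epsilon>" "t + of_int j" "x0 + 4 * \<epsilon>"] eps by auto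
  thus ?thesis by (intro exI[of _ x]) (auto simp: F_def x0_def abs_le_iff)
qed

end

section \<open>Choice of scales and matching of the zeros\<close>

theorem theorem1p3:
  fixes l \<beta> :: complex and \<tau> \<omega> :: real
    and \<alpha> :: "nat \<Rightarrow> complex" and \<theta> :: "nat \<Rightarrow> nat \<Rightarrow> real" and f :: "real \<Rightarrow> real"
  assumes "0 < norm l" and "norm l < 1"
    and "\<tau> > 1"
    and "(INF q\<in>{1::int..}. real_of_int q powr \<tau> * infdist (real_of_int q * \<omega>) \<int>) > 0"
    and "\<And>n. \<alpha> n = l * exp (2 * of_real pi * \<i> * of_real \<omega> * of_nat n ^ 2)"
    and "norm \<beta> = 1"
    and "\<And>N j. 1 \<le> N \<Longrightarrow> j \<in> {1..N} \<Longrightarrow> \<theta> N j \<in> {0..<1}"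
    and "\<And>N. 1 \<le> N \<Longrightarrow>
           bij_betw (\<lambda>j. exp (2 * of_real pi * \<i> * of_real (\<theta> N j))) {1..N}
             {z. poly (para_orthogonal_poly \<alpha> \<beta> N) z = 0}"
    and "\<And>x. f x \<ge> 0" and "continuous_on UNIV f" and "compact (closure {x. f x \<noteq> 0})"
  shows "(\<lambda>N. laplace_functional (\<theta> N) N f
            - laplace_functional (\<lambda>n. frac (2 * real n * \<omega>)) N f) \<longlonglongrightarrow> 0"
proof -
  define r where "r = norm l"
  interpret moebius_rotation r by unfold_locales (use assms(1,2) in \<open>auto simp: r_def\<close>)
  define \<Omega> where "\<Omega> = 2 * \<omega>"
  have circ_exp: "circ x = exp (2 * of_real pi * \<i> * of_real x)" for x
    by (simp add: cis_conv_exp mult_ac)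
  define s where "s = Arg l / (2 * pi)"
  have l: "l = of_real r * circ s"
    using rcis_cmod_Arg[of l] by (simp add: s_def r_def rcis_def)
  have \<alpha>: "\<alpha> n = l * circ (\<omega> * real n ^ 2)" for n
    unfolding assms(5) circ_exp by (simp add: mult_ac)
  define b where "b = Arg (cnj \<beta>) / (2 * pi)"
  have b: "cnj \<beta> = circ b"
    using rcis_cmod_Arg[of "cnj \<beta>"] assms(6) by (simp add: b_def rcis_def)

  have dio: "diophantine \<Omega>"
  proof -
    define c where "c = (INF q\<in>{1::int..}. real_of_int q powr \<tau> * infdist (real_of_int q * \<omega>) \<int>)"
    have c0: "c > 0" using assms(4) by (simp add: c_def)
    have c_le: "c \<le> real_of_int q powr \<tau> * infdist (real_of_int q * \<omega>) \<int>" if "q \<ge> 1" for q :: int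
      unfolding c_def
    proof (rule cINF_lower)
      show "bdd_below ((\<lambda>q. real_of_int q powr \<tau> * infdist (real_of_int q * \<omega>) \<int>) ` {1..})"
        by (rule bdd_belowI2[of _ 0]) (simp add: infdist_nonneg)
    qed (use that in simp)
    define T where "T = nat \<lceil>\<tau>\<rceil>"
    have T: "\<tau> \<le> real T" unfolding T_def by linarith
    \<comment> \<open>The hypothesis is applied at \<open>2 * q\<close>, because
      \<open>q * \<Omega>\<close> is \<open>2 * q * \<omega>\<close>; this costs the factor
      \<open>2 ^ T\<close>.\<close>
    have "(c / 2 ^ T) / real q ^ T \<le> \<bar>real q * \<Omega> - of_int j\<bar>" if q: "q \<ge> 1" for q :: nat and j :: int
    proof -
      have "c \<le> real (2 * q) powr \<tau> * infdist (real (2 * q) * \<omega>) \<int>" using c_le[of "int (2 * q)"] q by simp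
      also have "\<dots> \<le> real (2 * q) ^ T * \<bar>real q * \<Omega> - of_int j\<bar>"
      proof (intro mult_mono)
        have "real (2 * q) powr \<tau> \<le> real (2 * q) powr real T" using q T by (intro powr_mono) auto
        thus "real (2 * q) powr \<tau> \<le> real (2 * q) ^ T" using q by (simp add: powr_realpow)
        have "infdist (real (2 * q) * \<omega>) \<int> \<le> dist (real (2 * q) * \<omega>) (of_int j)" by (rule infdist_le) simp
        thus "infdist (real (2 * q) * \<omega>) \<int> \<le> \<bar>real q * \<Omega> - of_int j\<bar>" by (simp add: dist_real_def \<Omega>_def mult_ac)
      qed (auto simp: infdist_nonneg)
      finally show ?thesis using q by (simp add: field_simps power_mult_distrib)
    qed
    moreover have "c / 2 ^ T > 0" using c0 by simp
    ultimately show ?thesis unfolding diophantine_def by blast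
  qed
  obtain cd td where cd: "cd > 0" "\<And>q j. q \<ge> (1::nat) \<Longrightarrow> cd / real q ^ td \<le> \<bar>real q * \<Omega> - of_int j\<bar>"
    using diophantineE[OF dio] by blast
  obtain b0 w0 where res: "\<forall>w\<ge>w0. \<exists>L p y. p \<le> L \<and> L \<le> w ^ b0 \<and>
     dphase \<Omega> p y y \<le> exp (- (real w * gam / 2)) \<and>
     dphase \<Omega> (L - p) (y + real p * \<Omega>) (phase \<Omega> p y y) \<ge> exp (real w * gam / 2)"
    using resonance_exists[OF dio] by (elim exE)

  have "bounded {x. f x \<noteq> 0}"
    using assms(11) by (meson bounded_closure_image closure_subset bounded_subset compact_imp_bounded)
  then obtain R where R: "R > 0" "\<And>x. f x \<noteq> 0 \<Longrightarrow> \<bar>x\<bar> \<le> R"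
    unfolding bounded_pos real_norm_def by blast
  have supp: "f v = 0" if "\<bar>v\<bar> > R" for v using R(2)[of v] that by linarith
  have "bounded (f ` {-R..R})"
    by (intro compact_imp_bounded compact_continuous_image continuous_on_subset[OF assms(10)]) auto
  then obtain B where B: "B > 0" "\<And>x. x \<in> {-R..R} \<Longrightarrow> \<bar>f x\<bar> \<le> B"
    unfolding bounded_pos by auto
  have fB: "f v \<le> B" for v
    using B(2)[of v] supp[of v] B(1) by (cases "\<bar>v\<bar> \<le> R") (auto simp: abs_le_iff)
  have fm: "f \<in> borel_measurable borel" by (rule borel_measurable_continuous_onI[OF assms(10)])

  \<comment> \<open>With \<open>w\<close> the integer part of the \<open>D\<close>-th root of
    \<open>N\<close>, the bound \<open>L \<le> w ^ (b0 + 1)\<close> gives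
    \<open>L\<^sup>2 \<le> N\<close>, so that \<open>L / N\<close> tends to 0.\<close>
  define D where "D = 2 * b0 + 2"
  define w where "w N = nat \<lfloor>root D (real N)\<rfloor>" for N
  have D0: "D > 0" by (simp add: D_def)
  have w_le: "w N ^ D \<le> N" for N
  proof -
    have "real (w N) \<le> root D (real N)"
      unfolding w_def using real_root_ge_zero[of "real N" D] by linarith
    hence "real (w N) ^ D \<le> root D (real N) ^ D" by (intro power_mono) auto
    also have "\<dots> = real N" using D0 by simp
    finally show ?thesis by (simp only: of_nat_power[symmetric] of_nat_le_iff)
  qed
  have w_gt: "real N \<le> real (w N + 1) ^ D" for N
  proof -
    have "root D (real N) \<le> real (w N + 1)" unfolding w_def by linarith
    hence "root D (real N) ^ D \<le> real (w N + 1) ^ D"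
      by (intro power_mono) (simp_all add: real_root_ge_zero)
    thus ?thesis using D0 by simp
  qed
  have w_lim: "filterlim w at_top sequentially"
    unfolding filterlim_at_top
  proof
    fix Z :: nat
    show "\<forall>\<^sub>F N in sequentially. Z \<le> w N"
      using eventually_ge_at_top[of "Z ^ D"]
    proof eventually_elim
      case (elim N)
      have "real Z = root D (real (Z ^ D))" using D0 by (simp add: real_root_power_cancel)
      also have "\<dots> \<le> root D (real N)" using D0 elim by simp
      finally show ?case unfolding w_def by linarith
    qed
  qed
  \<comment> \<open>The cube root of the contraction factor \<open>exp (- w * gam / 2)\<close>. It
    decays exponentially in \<open>w\<close>, while \<open>N\<close> is at most a power of
    \<open>w + 1\<close>, so it beats every power of \<open>N\<close>.\<close>
  define \<epsilon> where "\<epsilon> N = exp (- (real (w N) * (gam / 6)))" for N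
  have eps_lim: "(\<lambda>N. real N ^ k * \<epsilon> N) \<longlonglongrightarrow> 0" for k
  proof (rule tendsto_sandwich[OF _ _ tendsto_const])
    have "(\<lambda>v. real (v + 1) ^ (D * k) * exp (- (real v * (gam / 6)))) \<longlonglongrightarrow> 0"
      using gam_pos by (intro power_decay_exp) auto
    from filterlim_compose[OF this w_lim]
    show "(\<lambda>N. real (w N + 1) ^ (D * k) * \<epsilon> N) \<longlonglongrightarrow> 0" by (simp add: \<epsilon>_def)
    show "\<forall>\<^sub>F N in sequentially. real N ^ k * \<epsilon> N \<le> real (w N + 1) ^ (D * k) * \<epsilon> N"
      unfolding power_mult by (intro always_eventually allI mult_right_mono power_mono w_gt) (auto simp: \<epsilon>_def)
  qed (auto simp: \<epsilon>_def)
  have eps3: "\<epsilon> N ^ 3 = exp (- (real (w N) * gam / 2))" for N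
    unfolding \<epsilon>_def exp_of_nat_mult[symmetric] by simp

  show ?thesis
  proof (rule LIMSEQ_I)
    fix e :: real assume e: "e > 0"
    define e0 where "e0 = e / (8 * (R + 1))"
    have e0: "e0 > 0" using e R by (simp add: e0_def)
    have "uniformly_continuous_on {-R-1..R+1} f"
      by (intro compact_uniformly_continuous continuous_on_subset[OF assms(10)]) auto
    then obtain d0 where d0: "d0 > 0"
      "\<And>x y. x \<in> {-R-1..R+1} \<Longrightarrow> y \<in> {-R-1..R+1} \<Longrightarrow> dist x y < d0 \<Longrightarrow> dist (f x) (f y) < e0"
      unfolding uniformly_continuous_on_def using e0 by metis
    define \<delta> where "\<delta> = min 1 (d0 / 2)"
    have \<delta>: "\<delta> > 0" "\<delta> \<le> 1" "\<delta> < d0" using d0(1) by (auto simp: \<delta>_def)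
    have uc: "\<bar>f v - f v'\<bar> \<le> e0" if "\<bar>v - v'\<bar> \<le> \<delta>" for v v'
    proof (cases "\<bar>v\<bar> > R \<and> \<bar>v'\<bar> > R")
      case True
      thus ?thesis using supp e0 by simp
    next
      case False
      hence "v \<in> {-R-1..R+1}" "v' \<in> {-R-1..R+1}" using that \<delta>(2) by auto
      from d0(2)[OF this] that \<delta>(3) show ?thesis by (simp add: dist_real_def)
    qed
    have ev1: "\<forall>\<^sub>F N in sequentially. 4 * (real N ^ 1 * \<epsilon> N) < \<delta>"
      by (rule order_tendstoD[OF tendsto_mult_right_zero[OF eps_lim]]) (use \<delta> in auto)
    have ev2: "\<forall>\<^sub>F N in sequentially. 8 * (real N ^ td * \<epsilon> N) < cd"
      by (rule order_tendstoD[OF tendsto_mult_right_zero[OF eps_lim]]) (use cd in auto)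
    have ev3: "\<forall>\<^sub>F N in sequentially. 4 * R * B / (e / 4) < sqrt (real N)"
      by (rule filterlim_at_top_dense[THEN iffD1, rule_format])
         (intro filterlim_compose[OF sqrt_at_top] filterlim_real_sequentially)
    have ev4: "\<forall>\<^sub>F N in sequentially. max w0 1 \<le> w N" using w_lim unfolding filterlim_at_top by blast
    have ev5: "\<forall>\<^sub>F N in sequentially. 2 * R + 5 \<le> real N"
      using filterlim_real_sequentially by (simp add: filterlim_at_top)
    have ev6: "\<forall>\<^sub>F N in sequentially. 1 * (real N ^ 0 * \<epsilon> N) < 1/2"
      by (rule order_tendstoD[OF tendsto_mult_right_zero[OF eps_lim]]) auto
    have "\<forall>\<^sub>F N in sequentially. norm (laplace_functional (\<theta> N) N f
            - laplace_functional (\<lambda>n. frac (2 * real n * \<omega>)) N f - 0) < e"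
      using ev1 ev2 ev3 ev4 ev5 ev6 eventually_ge_at_top[of 1]
    proof eventually_elim
      case (elim N)
      have N1: "N \<ge> 1" by fact
      have eN: "\<epsilon> N > 0" "\<epsilon> N < 1/2" using elim(6) by (auto simp: \<epsilon>_def)
      obtain L p y where Lp: "p \<le> L" "L \<le> w N ^ b0"
        "dphase \<Omega> p y y \<le> exp (- (real (w N) * gam / 2))"
        "dphase \<Omega> (L - p) (y + real p * \<Omega>) (phase \<Omega> p y y) \<ge> exp (real (w N) * gam / 2)"
        using res[rule_format, of "w N"] elim(4) by auto
      have con: "dphase \<Omega> p y y \<le> \<epsilon> N ^ 3" using Lp(3) by (simp add: eps3)
      have expa: "dphase \<Omega> (L - p) (y + real p * \<Omega>) (phase \<Omega> p y y) \<ge> 1 / \<epsilon> N ^ 3"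
        using Lp(4) unfolding eps3 exp_minus inverse_eq_divide by simp
      \<comment> \<open>Blocks starting at time \<open>N - n\<close> sit at
        \<open>y - \<omega> - (N - n) * \<Omega>\<close>, that is at
        \<open>c + n * \<Omega>\<close>: counted from the end, their positions follow the rotation
        orbit forwards.\<close>
      define c where "c = y - \<omega> - real N * \<Omega>"
      define x where "x n = frac (2 * real n * \<omega>)" for n
      define t where "t = b + (\<omega> * real (N - 1) ^ 2 + s)"
      \<comment> \<open>For \<open>n > L\<close> the block starting at time \<open>N - n\<close>
        still fits into the \<open>N - 1\<close> steps that precede the boundary condition.\<close>
      define I where "I = {L + 1..N}"
      have zero: "\<exists>j\<in>{1..N}. \<exists>i::int. \<bar>\<theta> N j - x n - c - of_int i\<bar> \<le> 4 * \<epsilon> N" if n: "n \<in> I" for n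
      proof -
        have "(N - n) + L \<le> N - 1" using n by (auto simp: I_def)
        from resonance_zero[OF eN Lp(1) this con expa, of \<omega> s t] obtain v where
          v: "\<bar>v - (y - \<omega> - real (N - n) * \<Omega>)\<bar> \<le> 4 * \<epsilon> N" "phase \<Omega> (N - 1) (v + \<omega>) (v + s) - t \<in> \<int>" by blast
        from v(2) have "poly (para_orthogonal_poly \<alpha> \<beta> (Suc (N - 1))) (circ v) = 0"
          unfolding para_orthogonal_zero_iff[OF l \<alpha> b] by (simp add: \<Omega>_def t_def)
        hence "circ v \<in> {z. poly (para_orthogonal_poly \<alpha> \<beta> N) z = 0}" using N1 by simp
        with assms(8)[OF N1] have "circ v \<in> (\<lambda>j. exp (2 * of_real pi * \<i> * of_real (\<theta> N j))) ` {1..N}"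
          by (simp add: bij_betw_def)
        then obtain j where j: "j \<in> {1..N}" "circ v = circ (\<theta> N j)" unfolding circ_exp by auto
        hence "\<theta> N j - v \<in> \<int>" by (metis circ_eq_iff)
        then obtain i where i: "\<theta> N j - v = of_int i" by (auto elim: Ints_cases)
        have "y - \<omega> - real (N - n) * \<Omega> = c + real n * \<Omega>"
          using n by (simp add: I_def c_def of_nat_diff algebra_simps)
        moreover have "x n = real n * \<Omega> - of_int \<lfloor>2 * real n * \<omega>\<rfloor>"
          by (simp add: x_def frac_def \<Omega>_def)
        ultimately have "\<bar>\<theta> N j - x n - c - of_int (i + \<lfloor>2 * real n * \<omega>\<rfloor>)\<bar> \<le> 4 * \<epsilon> N"
          using v(1) i by simp
        with j(1) show ?thesis by blast
      qed
      then obtain \<sigma> where \<sigma>: "\<And>n. n \<in> I \<Longrightarrow> \<sigma> n \<in> {1..N}"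
        "\<And>n. n \<in> I \<Longrightarrow> \<exists>i::int. \<bar>\<theta> N (\<sigma> n) - x n - c - of_int i\<bar> \<le> 4 * \<epsilon> N"
        by metis
      \<comment> \<open>Two targets sharing a zero would be within \<open>8 * \<epsilon> N\<close>
        of each other modulo 1, which is less than the Diophantine lower bound for index differences
        up to \<open>N\<close>.\<close>
      have inj: "inj_on \<sigma> I"
      proof (rule linorder_inj_onI)
        fix m n assume mn: "m < n" "m \<in> I" "n \<in> I"
        show "\<sigma> m \<noteq> \<sigma> n"
        proof
          assume eq: "\<sigma> m = \<sigma> n"
          obtain i j :: int where "\<bar>\<theta> N (\<sigma> m) - x m - c - of_int i\<bar> \<le> 4 * \<epsilon> N"
            "\<bar>\<theta> N (\<sigma> n) - x n - c - of_int j\<bar> \<le> 4 * \<epsilon> N" using \<sigma>(2) mn by metis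
          hence "\<bar>(x n + of_int j) - (x m + of_int i)\<bar> \<le> 8 * \<epsilon> N" unfolding eq by linarith
          moreover have "x k = real k * \<Omega> - of_int \<lfloor>2 * real k * \<omega>\<rfloor>" for k
            by (simp add: x_def frac_def \<Omega>_def)
          ultimately have "\<bar>real (n - m) * \<Omega> - of_int (\<lfloor>2 * real n * \<omega>\<rfloor> - \<lfloor>2 * real m * \<omega>\<rfloor> + i - j)\<bar> \<le> 8 * \<epsilon> N"
            using mn(1) by (simp add: of_nat_diff algebra_simps)
          with cd(2)[of "n - m"] mn(1) have "cd / real (n - m) ^ td \<le> 8 * \<epsilon> N"
            by (metis One_nat_def Suc_leI order_trans zero_less_diff)
          hence "cd \<le> 8 * \<epsilon> N * real (n - m) ^ td" using mn(1) by (simp add: field_simps)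
          also have "\<dots> \<le> 8 * \<epsilon> N * real N ^ td"
            using mn eN by (intro mult_left_mono power_mono) (auto simp: I_def)
          finally show False using elim(2) by (simp add: mult_ac)
        qed
      qed auto
      have "4 * \<epsilon> N \<le> \<delta> / real N" using elim(1) N1 by (simp add: field_simps)
      hence close: "\<exists>i::int. \<bar>\<theta> N (\<sigma> n) - x n - c - of_int i\<bar> \<le> \<delta> / real N" if "n \<in> I" for n
        using \<sigma>(2)[OF that] order_trans by blast
      have cardI: "card ({1..N} - I) \<le> L"
      proof -
        have "{1..N} - I \<subseteq> {1..L}" by (auto simp: I_def)
        from card_mono[OF _ this] show ?thesis by simp
      qed
      have "\<bar>laplace_functional (\<theta> N) N f - laplace_functional x N f\<bar>
         \<le> 2 * (R + 1) * e0 + 4 * real L * R * B / real N"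
      proof (rule laplace_functional_close[where f = f and \<delta> = \<delta> and \<sigma> = \<sigma> and I = I and c = c and N = N
            and B = B and R = R and \<theta> = "\<theta> N" and x = x])
        show "\<And>v v'. \<bar>v - v'\<bar> \<le> \<delta> \<Longrightarrow> \<bar>f v - f v'\<bar> \<le> e0" by (rule uc)
        show "\<And>n. n \<in> I \<Longrightarrow> \<exists>i::int. \<bar>\<theta> N (\<sigma> n) - x n - c - of_int i\<bar> \<le> \<delta> / real N" by (rule close)
        show "\<sigma> ` I \<subseteq> {1..N}" using \<sigma>(1) by blast
        show "I \<subseteq> {1..N}" by (auto simp: I_def)
      qed (use assms(9) fB fm supp \<delta>(2) elim(5) inj cardI R e0 in auto)
      also have "2 * (R + 1) * e0 = e / 4" using R by (simp add: e0_def field_simps)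
      also have "4 * real L * R * B / real N \<le> e / 4"
      proof -
        have "L \<le> w N ^ (b0 + 1)"
        proof -
          have "w N ^ b0 \<le> w N ^ (b0 + 1)" using elim(4) by (intro power_increasing) auto
          with Lp(2) show ?thesis by linarith
        qed
        hence "L ^ 2 \<le> (w N ^ (b0 + 1)) ^ 2" by (rule power_mono) simp
        also have "\<dots> = w N ^ D" unfolding D_def power_mult[symmetric] by (simp add: mult.commute)
        also have "\<dots> \<le> N" by (rule w_le)
        finally have "real L \<le> sqrt (real N)"
          by (intro real_le_rsqrt) (simp only: of_nat_power[symmetric] of_nat_le_iff)
        hence "4 * real L * R * B / real N \<le> 4 * sqrt (real N) * R * B / real N"
          using R B by (intro divide_right_mono mult_right_mono mult_left_mono) auto
        also have "\<dots> = 4 * R * B * (sqrt (real N) / real N)" by (simp add: mult_ac)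
        also have "sqrt (real N) / real N = 1 / sqrt (real N)"
          using N1 by (simp add: field_simps)
        also have "4 * R * B * (1 / sqrt (real N)) \<le> e / 4"
          using elim(3) e N1 by (simp add: field_simps)
        finally show ?thesis .
      qed
      finally show ?case using e unfolding x_def by simp
    qed
    thus "\<exists>no. \<forall>N\<ge>no. norm (laplace_functional (\<theta> N) N f
            - laplace_functional (\<lambda>n. frac (2 * real n * \<omega>)) N f - 0) < e"
      by (simp add: eventually_sequentially)
  qed
qed

end
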